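(* Let $\pmb{\lambda}=(\lambda^{(1)},\dots,\lambda^{(d)})$ be a $d$-tuple of partitions of $m$, and assume $\ell(\lambda^{(i)})\le n$ and $\lambda^{(i)}_1\le n$ for all $i$. (i) Let $d$ be odd. For every $\ell\in[d]$ and $1\le i<j\le \ell((\lambda^{(\ell)})')$: $$\sum_{T\in\partial^{(\ell)}_{ji}(X)}\Delta_T=0\quad\text{for all }X\in B(\alpha^{(\ell)}_{ij}\pmb\lambda'),\qquad \sum_{S\in\partial^{(\ell)}_{ji}(Y)}\nabla_S=0\quad\text{for all }Y\in A(\alpha^{(\ell)}_{ij}\pmb\lambda').$$ Moreover, let $\Delta:\mathrm{WV}_{\pmb\lambda'}\bigwedge V\to \mathrm{HWV}_{\pmb\lambda}\bigvee V$ be the linear map with $\bigwedge e_T\mapsto\Delta_T$ for $T\in B^{\mathrm{lex}}(\pmb\lambda')$, and $\nabla:\mathrm{WV}_{\pmb\lambda'}\bigvee V\to\mathrm{HWV}_{\pmb\lambda}\bigwedge V$ the linear map with $\bigvee e_S\mapsto\nabla_S$ for $S\in A^{\mathrm{lex}}(\pmb\lambda')$. Then $$\mathrm{Ker}(\Delta)=\mathrm{span}\{\textstyle\bigwedge\partial^{(\ell)}_{ji}(X):\ \ell\in[d],\ i<j,\ X\in B(\alpha^{(\ell)}_{ij}\pmb\lambda')\},$$ $$\mathrm{Ker}(\nabla)=\mathrm{span}\{\textstyle\bigvee\partial^{(\ell)}_{ji}(Y):\ \ell\in[d],\ i<j,\ Y\in A(\alpha^{(\ell)}_{ij}\pmb\lambda')\},$$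 i.e. every linear relation among the $\Delta_T$ (resp. the $\nabla_S$) follows linearly from the relations above. (ii) Let $d$ be even. For every $\ell\in[d]$ and $1\le i<j\le\ell((\lambda^{(\ell)})')$: $$\sum_{S\in\partial^{(\ell)}_{ji}(Y)}\Delta_S=0\quad\text{for all }Y\in A(\alpha^{(\ell)}_{ij}\pmb\lambda'),\qquad\sum_{T\in\partial^{(\ell)}_{ji}(X)}\nabla_T=0\quad\text{for all }X\in B(\alpha^{(\ell)}_{ij}\pmb\lambda').$$ Moreover, let $\Delta:\mathrm{WV}_{\pmb\lambda'}\bigvee V\to\mathrm{HWV}_{\pmb\lambda}\bigvee V$ be the linear map with $\bigvee e_S\mapsto\Delta_S$ ($S\in A^{\mathrm{lex}}(\pmb\lambda')$) and $\nabla:\mathrm{WV}_{\pmb\lambda'}\bigwedge V\to\mathrm{HWV}_{\pmb\lambda}\bigwedge V$ the linear map with $\bigwedge e_T\mapsto\nabla_T$ ($T\in B^{\mathrm{lex}}(\pmb\lambda')$). Then $$\mathrm{Ker}(\Delta)=\mathrm{span}\{\textstyle\bigvee\partial^{(\ell)}_{ji}(Y):\ \ell\in[d],\ i<j,\ Y\in A(\alpha^{(\ell)}_{ij}\pmb\lambda')\},$$ $$\mathrm{Ker}(\nabla)=\mathrm{span}\{\textstyle\bigwedge\partial^{(\ell)}_{ji}(X):\ \ell\in[d],\ i<j,\ X\in B(\alpha^{(\ell)}_{ij}\pmb\lambda')\}.$$ (iii) Any algebraic relation of the form $\sum_c\alpha_c\,\Delta_{T^{(c,1)}}\vee\cdots\vee\Delta_{T^{(c,k)}}=0$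 or $\sum_c\beta_c\,\nabla_{S^{(c,1)}}\wedge\cdots\wedge\nabla_{S^{(c,k)}}=0$ among the highest weight vectors $\Delta$ and $\nabla$ (for all $m$ and all $d$-tuples of partitions of $m$) follows from the linear relations listed in (i) and (ii).
   Context: Integers $d,n\ge1$, $m\ge0$; $[r]=\{1,\dots,r\}$. $V=(\mathbb C^n)^{\otimes d}$ with basis $e_{\mathbf i}=e_{i_1}\otimes\cdots\otimes e_{i_d}$, $\mathbf i\in[n]^d$. $\bigvee V$ is the symmetric algebra of $V$ (polynomial ring in the commuting variables $e_{\mathbf i}$, product written $\vee$) and $\bigwedge V$ the exterior algebra. $G=\mathrm{GL}(n,\mathbb C)^{\times d}$ acts on $V$ by $(g_1,\dots,g_d)(v_1\otimes\cdots\otimes v_d)=g_1v_1\otimes\cdots\otimes g_dv_d$ and on $\bigvee V,\bigwedge V$ by algebra automorphisms. For a $d$-tuple $\pmb\alpha$ of vectors in $\mathbb Z^n_{\ge0}$, $\mathrm{WV}_{\pmb\alpha}W$ is the weight space of weight $\pmb\alpha$ for the torus of $d$-tuples of diagonal matrices, and $\mathrm{HWV}_{\pmb\alpha}W$ the subspace of it fixed by $U(n)^{\times d}$ ($U(n)$ = upper unitriangular matrices). Partitions of length $\le n$ are viewed as vectors in $\mathbb Z^n_{\ge0}$; $\lambda'$ is the conjugate partition, $\pmb\lambda'$ the componentwise conjugate; "$d$-tuple of partitions of $m$" means each part has size $m$. Words/tables: for a sequence $\alpha=(\alpha_1,\dots,\alpha_r)$ of nonnegative integers with sum $m$, $A(\alpha)$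 is the set of words of length $m$ in which letter $i$ occurs exactly $\alpha_i$ times. For $\pmb\alpha=(\alpha^{(1)},\dots,\alpha^{(d)})$, $A(\pmb\alpha)=A(\alpha^{(1)})\times\cdots\times A(\alpha^{(d)})$; an element is a $d\times m$ table with rows the words and columns $S(1),\dots,S(m)$. $B(\pmb\alpha)\subseteq A(\pmb\alpha)$ consists of tables with pairwise distinct columns. $S_m$ acts by permuting columns. $\|T\|=\prod_{\mathbf c}(\#\{j:T(j)=\mathbf c\})!$. $A^{\mathrm{lex}}(\pmb\alpha)$, $B^{\mathrm{lex}}(\pmb\alpha)$: tables in $A(\pmb\alpha)$, $B(\pmb\alpha)$ with columns weakly increasing in lexicographic order. For a table $S$ with entries in $[n]$, $\bigvee e_S=e_{S(1)}\vee\cdots\vee e_{S(m)}$ and $\bigwedge e_S=e_{S(1)}\wedge\cdots\wedge e_{S(m)}$; $\{\bigvee e_S:S\in A^{\mathrm{lex}}(\pmb\alpha)\}$ and $\{\bigwedge e_S:S\in B^{\mathrm{lex}}(\pmb\alpha)\}$ are bases of the weight spaces of weight $\pmb\alpha$. Signs: for a word $w$, $(-1)^w=(-1)^{\#\{i<j:w_i>w_j\}}$; for a table $T$ with rows $t_1,\dots,t_d$, $(-1)^T=\prod_i(-1)^{t_i}$. For words $s,x$ of length $m$, $\mathrm{sgn}_s(x)=\prod_c\mathrm{sgn}(x_{b_1},\dots,x_{b_k})$, the product over letters $c$ of $s$ with $b_1<\dots<b_k$ the positions of $c$ in $s$, where $\mathrm{sgn}(a_1,\dots,a_k)$ is the sign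 of the permutation $(a_1,\dots,a_k)$ if it is a permutation of $[k]$ and $0$ otherwise. For tables, $\mathrm{sgn}_T(X)=\prod_i\mathrm{sgn}_{t_i}(x_i)$ (rows $t_i$ of $T$, $x_i$ of $X$). Vectors: for a $d\times m$ table $T$ with positive integer entries, $\Delta_T=\frac{(-1)^T}{\|T\|}\sum_X\mathrm{sgn}_T(X)\bigvee e_X\in\bigvee^mV$, $\nabla_T=\frac{(-1)^T}{\|T\|}\sum_X\mathrm{sgn}_T(X)\bigwedge e_X\in\bigwedge^mV$, sums over all $d\times m$ tables $X$ with entries in $[n]$. Boundary tables: for a table $S$, $\ell\in[d]$ and letters $a,b$, $\partial^{(\ell)}_{ab}(S)$ is the set of tables obtained from $S$ by replacing exactly one occurrence of the letter $b$ in row $\ell$ by $a$ (column order unchanged). $\bigvee\partial(S)=\sum_{S'\in\partial(S)}\bigvee e_{S'}$ and $\bigwedge\partial(S)=\sum_{S'\in\partial(S)}\bigwedge e_{S'}$. For a $d$-tuple of sequences $\pmb\mu$, $\alpha^{(\ell)}_{ij}\pmb\mu$ is obtained by replacing $\mu^{(\ell)}$ with $\mu^{(\ell)}+e_i-e_j$.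
   Formalization: For Y in A the relations and kernel generators carry weights: the sum of ‖S‖Δ_S (resp. ‖S‖∇_S) vanishes and ⋁∂(Y) is the sum of ‖S‖⋁e_S; unweighted is false, e.g. d=n=2, λ=((2,1),(2,1)), Y=111/112. In (iii) a product is ±Δ (±∇) of the juxtaposed table; first parts may exceed n. *)

theory Defs
  imports
    Complex_Main
    "HOL-Library.Poly_Mapping"
    "HOL-Library.Multiset"
    "HOL-Library.FSet"
    "HOL-Library.List_Lexorder"
    "HOL-Combinatorics.Permutations"
begin

section \<open>Complex vector spaces of finitely supported functions\<close>

definition cscale :: "complex \<Rightarrow> ('k \<Rightarrow>\<^sub>0 complex) \<Rightarrow> ('k \<Rightarrow>\<^sub>0 complex)" where
  "cscale c p = Poly_Mapping.map ((*) c) p"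

lemma lookup_cscale [simp]: "Poly_Mapping.lookup (cscale c p) k = c * Poly_Mapping.lookup p k"
  by (simp add: cscale_def Poly_Mapping.map.rep_eq when_def)

global_interpretation cvec: vector_space "cscale :: complex \<Rightarrow> ('k \<Rightarrow>\<^sub>0 complex) \<Rightarrow> ('k \<Rightarrow>\<^sub>0 complex)"
  by unfold_locales (auto intro!: poly_mapping_eqI simp: lookup_add algebra_simps)

definition linear_with ::
  "(('k \<Rightarrow>\<^sub>0 complex) \<Rightarrow> ('h \<Rightarrow>\<^sub>0 complex)) \<Rightarrow>
     't set \<Rightarrow> ('t \<Rightarrow> ('k \<Rightarrow>\<^sub>0 complex)) \<Rightarrow> ('t \<Rightarrow> ('h \<Rightarrow>\<^sub>0 complex)) \<Rightarrow> bool"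
where
  "linear_with D I b v \<longleftrightarrow> Vector_Spaces.linear cscale cscale D \<and> (\<forall>t\<in>I. D (b t) = v t)"

section \<open>Symmetric and exterior algebra\<close>

text \<open>
  The basis vector \<open>e\<^sub>c\<close> of the \<open>d\<close>-fold tensor power of \<open>\<complex>\<^sup>n\<close> is indexed by a list \<open>c\<close> of
  length \<open>d\<close> with entries in \<open>{1..n}\<close>. A monomial of the symmetric algebra is a multiset of such
  indices, and multiplication is the one of \<open>Poly_Mapping\<close>. The exterior algebra has as basis the
  finite sets of indices, a set standing for the wedge product of its elements in increasing
  lexicographic order.
\<close>

type_synonym sym_alg = "nat list multiset \<Rightarrow>\<^sub>0 complex"
type_synonym ext_alg = "nat list fset \<Rightarrow>\<^sub>0 complex"

definition svar :: "nat list \<Rightarrow> sym_alg" where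
  "svar c = Poly_Mapping.single {#c#} 1"

definition evar :: "nat list \<Rightarrow> ext_alg" where
  "evar c = Poly_Mapping.single {|c|} 1"

definition wedge_sign :: "nat list fset \<Rightarrow> nat list fset \<Rightarrow> complex" where
  "wedge_sign P Q =
     (if P |\<inter>| Q = {||} then (- 1) ^ card {(a, b). a |\<in>| P \<and> b |\<in>| Q \<and> b < a} else 0)"

definition wedge :: "ext_alg \<Rightarrow> ext_alg \<Rightarrow> ext_alg" where
  "wedge p q = (\<Sum>P\<in>Poly_Mapping.keys p. \<Sum>Q\<in>Poly_Mapping.keys q.
     Poly_Mapping.single (P |\<union>| Q)
       (wedge_sign P Q * Poly_Mapping.lookup p P * Poly_Mapping.lookup q Q))"

definition wedge_list :: "ext_alg list \<Rightarrow> ext_alg" where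
  "wedge_list ws = foldr wedge ws (Poly_Mapping.single {||} 1)"

definition indices :: "nat \<Rightarrow> nat \<Rightarrow> nat list set" where
  "indices n d = {c. length c = d \<and> set c \<subseteq> {1..n}}"

definition Sym :: "nat \<Rightarrow> nat \<Rightarrow> sym_alg set" where
  "Sym n d = {p. \<forall>M\<in>Poly_Mapping.keys p. set_mset M \<subseteq> indices n d}"

definition Ext :: "nat \<Rightarrow> nat \<Rightarrow> ext_alg set" where
  "Ext n d = {w. \<forall>P\<in>Poly_Mapping.keys w. fset P \<subseteq> indices n d}"

section \<open>Group action, weight vectors and highest weight vectors\<close>

text \<open>
  A tuple of matrices is a function \<open>g\<close>, where \<open>g l i j\<close> is the entry in row \<open>i\<close> and column \<open>j\<close>
  of the matrix acting on tensor factor \<open>l < d\<close>; only \<open>i, j \<in> {1..n}\<close> matter. Tensor factors and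
  rows of tables are numbered from 0, letters and matrix entries from 1.
\<close>

type_synonym mats = "nat \<Rightarrow> nat \<Rightarrow> nat \<Rightarrow> complex"

definition tensor_coeff :: "mats \<Rightarrow> nat list \<Rightarrow> nat list \<Rightarrow> complex" where
  "tensor_coeff g b c = (\<Prod>l<length c. g l (b ! l) (c ! l))"

definition act_sym :: "nat \<Rightarrow> mats \<Rightarrow> sym_alg \<Rightarrow> sym_alg" where
  "act_sym n g p = (\<Sum>M\<in>Poly_Mapping.keys p. cscale (Poly_Mapping.lookup p M)
     (\<Prod>c\<in>#M. \<Sum>b\<in>indices n (length c). cscale (tensor_coeff g b c) (svar b)))"

definition act_ext :: "nat \<Rightarrow> mats \<Rightarrow> ext_alg \<Rightarrow> ext_alg" where
  "act_ext n g w = (\<Sum>P\<in>Poly_Mapping.keys w. cscale (Poly_Mapping.lookup w P)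
     (wedge_list (map (\<lambda>c. \<Sum>b\<in>indices n (length c). cscale (tensor_coeff g b c) (evar b))
       (sorted_list_of_fset P))))"

definition torus :: "nat \<Rightarrow> nat \<Rightarrow> mats set" where
  "torus n d = {g. \<forall>l<d. \<forall>i\<in>{1..n}. \<forall>j\<in>{1..n}. g l i j \<noteq> 0 \<longleftrightarrow> i = j}"

definition unitriangular :: "nat \<Rightarrow> nat \<Rightarrow> mats set" where
  "unitriangular n d =
     {g. \<forall>l<d. \<forall>i\<in>{1..n}. \<forall>j\<in>{1..n}. (i = j \<longrightarrow> g l i j = 1) \<and> (j < i \<longrightarrow> g l i j = 0)}"

text \<open>A list of nonnegative integers is read as a vector, padded by zeros.\<close>

definition entry :: "nat list \<Rightarrow> nat \<Rightarrow> nat" where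
  "entry a i = (if 1 \<le> i \<and> i \<le> length a then a ! (i - 1) else 0)"

definition weight_char :: "nat \<Rightarrow> nat list list \<Rightarrow> mats \<Rightarrow> complex" where
  "weight_char n al g = (\<Prod>l<length al. \<Prod>i=1..n. g l i i ^ entry (al ! l) i)"

definition WV_sym :: "nat \<Rightarrow> nat list list \<Rightarrow> sym_alg set" where
  "WV_sym n al = {p \<in> Sym n (length al).
     \<forall>g\<in>torus n (length al). act_sym n g p = cscale (weight_char n al g) p}"

definition WV_ext :: "nat \<Rightarrow> nat list list \<Rightarrow> ext_alg set" where
  "WV_ext n al = {w \<in> Ext n (length al).
     \<forall>g\<in>torus n (length al). act_ext n g w = cscale (weight_char n al g) w}"

definition HWV_sym :: "nat \<Rightarrow> nat list list \<Rightarrow> sym_alg set" where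
  "HWV_sym n al = {p \<in> WV_sym n al. \<forall>u\<in>unitriangular n (length al). act_sym n u p = p}"

definition HWV_ext :: "nat \<Rightarrow> nat list list \<Rightarrow> ext_alg set" where
  "HWV_ext n al = {w \<in> WV_ext n al. \<forall>u\<in>unitriangular n (length al). act_ext n u w = w}"

section \<open>Partitions, words and tables\<close>

definition is_partition :: "nat \<Rightarrow> nat list \<Rightarrow> bool" where
  "is_partition m p \<longleftrightarrow> sorted_wrt (\<ge>) p \<and> 0 \<notin> set p \<and> sum_list p = m"

definition partition_tuple :: "nat \<Rightarrow> nat \<Rightarrow> nat list list \<Rightarrow> bool" where
  "partition_tuple d m lam \<longleftrightarrow> length lam = d \<and> (\<forall>p\<in>set lam. is_partition m p)"

definition conj_part :: "nat list \<Rightarrow> nat list" where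
  "conj_part p = map (\<lambda>j. length (filter (\<lambda>x. j \<le> x) p)) [1..<Suc (entry p 1)]"

definition words :: "nat list \<Rightarrow> nat list set" where
  "words a = {w. set w \<subseteq> {1..length a} \<and> (\<forall>i\<in>{1..length a}. count_list w i = a ! (i - 1))}"

text \<open>A table is the list of its rows; its columns are the elements of \<^const>\<open>List.transpose\<close>.\<close>

type_synonym table = "nat list list"

definition tabA :: "nat list list \<Rightarrow> table set" where
  "tabA al = listset (map words al)"

definition tabB :: "nat list list \<Rightarrow> table set" where
  "tabB al = {S \<in> tabA al. distinct (List.transpose S)}"

definition tabA_lex :: "nat list list \<Rightarrow> table set" where
  "tabA_lex al = {S \<in> tabA al. sorted (List.transpose S)}"

definition tabB_lex :: "nat list list \<Rightarrow> table set" where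
  "tabB_lex al = {S \<in> tabB al. sorted (List.transpose S)}"

definition table_norm :: "table \<Rightarrow> complex" where
  "table_norm T = (\<Prod>c\<in>set (List.transpose T). fact (count_list (List.transpose T) c))"

definition vee_e :: "table \<Rightarrow> sym_alg" where
  "vee_e S = prod_list (map svar (List.transpose S))"

definition wedge_e :: "table \<Rightarrow> ext_alg" where
  "wedge_e S = wedge_list (map evar (List.transpose S))"

definition word_sign :: "nat list \<Rightarrow> complex" where
  "word_sign w = (- 1) ^ card {(i, j). i < j \<and> j < length w \<and> w ! i > w ! j}"

definition table_sign :: "table \<Rightarrow> complex" where
  "table_sign T = prod_list (map word_sign T)"

definition seq_sgn :: "nat list \<Rightarrow> complex" where
  "seq_sgn a = (if distinct a \<and> set a = {1..length a}
     then of_int (sign (\<lambda>i. if i \<in> {1..length a} then a ! (i - 1) else i)) else 0)"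

definition word_sgn :: "nat list \<Rightarrow> nat list \<Rightarrow> complex" where
  "word_sgn s x =
     (\<Prod>c\<in>set s. seq_sgn (map (nth x) (filter (\<lambda>b. s ! b = c) [0..<length s])))"

definition table_sgn :: "table \<Rightarrow> table \<Rightarrow> complex" where
  "table_sgn T X = prod_list (map2 word_sgn T X)"

definition same_shape :: "nat \<Rightarrow> table \<Rightarrow> table set" where
  "same_shape n T = listset (map (\<lambda>t. indices n (length t)) T)"

definition Delta :: "nat \<Rightarrow> table \<Rightarrow> sym_alg" where
  "Delta n T = cscale (table_sign T / table_norm T)
     (\<Sum>X\<in>same_shape n T. cscale (table_sgn T X) (vee_e X))"

definition Nabla :: "nat \<Rightarrow> table \<Rightarrow> ext_alg" where
  "Nabla n T = cscale (table_sign T / table_norm T)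
     (\<Sum>X\<in>same_shape n T. cscale (table_sgn T X) (wedge_e X))"

section \<open>Boundaries and the linear relations\<close>

definition boundary :: "nat \<Rightarrow> nat \<Rightarrow> nat \<Rightarrow> table \<Rightarrow> table set" where
  "boundary l a b S = {S[l := (S ! l)[q := a]] | q. q < length (S ! l) \<and> S ! l ! q = b}"

definition move :: "nat \<Rightarrow> nat \<Rightarrow> nat \<Rightarrow> nat list list \<Rightarrow> nat list list" where
  "move l i j mu = mu[l := (mu ! l)[i - 1 := mu ! l ! (i - 1) + 1, j - 1 := mu ! l ! (j - 1) - 1]]"

text \<open>
  The weights \<^const>\<open>table_norm\<close> in \<open>vee_boundary\<close> compensate the factor
  \<^term>\<open>1 / table_norm T\<close> in \<^const>\<open>Delta\<close> and \<^const>\<open>Nabla\<close>: unweighted boundary sums of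
  these vectors need not vanish when columns are repeated, see
  \<open>unweighted_boundary_sum_nonzero\<close> below. No weight is needed in \<open>wedge_boundary\<close>: a table with
  distinct columns has norm 1, and one with a repeated column has wedge product 0.
\<close>

definition vee_boundary :: "nat \<Rightarrow> nat \<Rightarrow> nat \<Rightarrow> table \<Rightarrow> sym_alg" where
  "vee_boundary l a b Y = (\<Sum>S\<in>boundary l a b Y. cscale (table_norm S) (vee_e S))"

definition wedge_boundary :: "nat \<Rightarrow> nat \<Rightarrow> nat \<Rightarrow> table \<Rightarrow> ext_alg" where
  "wedge_boundary l a b X = (\<Sum>T\<in>boundary l a b X. wedge_e T)"

definition sym_relations :: "nat list list \<Rightarrow> sym_alg set" where
  "sym_relations mu = {vee_boundary l j i Y | l i j Y. l < length mu \<and> 1 \<le> i \<and> i < j \<and>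
     j \<le> length (mu ! l) \<and> Y \<in> tabA (move l i j mu)}"

definition ext_relations :: "nat list list \<Rightarrow> ext_alg set" where
  "ext_relations mu = {wedge_boundary l j i X | l i j X. l < length mu \<and> 1 \<le> i \<and> i < j \<and>
     j \<le> length (mu ! l) \<and> X \<in> tabB (move l i j mu)}"

section \<open>Products of highest weight vectors\<close>

text \<open>
  A product of vectors \<open>\<Delta>\<close> (or \<open>\<nabla>\<close>) is, up to sign, a single such vector: its table is obtained
  by writing the tables side by side with the letters in each row made disjoint, and then
  renumbering the letters of each row so that their multiplicities decrease weakly.
\<close>

definition juxt_word :: "nat list \<Rightarrow> nat list \<Rightarrow> nat list" where
  "juxt_word u v = u @ map (\<lambda>a. foldr max u 0 + a) v"

definition juxt :: "nat \<Rightarrow> table list \<Rightarrow> table" where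
  "juxt d Ts = foldr (map2 juxt_word) Ts (replicate d [])"

definition sort_letters :: "nat list \<Rightarrow> nat list" where
  "sort_letters w = map (\<lambda>a. card {b \<in> set w. count_list w b > count_list w a \<or>
     count_list w b = count_list w a \<and> b \<le> a}) w"

definition prod_table :: "nat \<Rightarrow> table list \<Rightarrow> table" where
  "prod_table d Ts = map sort_letters (juxt d Ts)"

definition prod_sign :: "nat \<Rightarrow> table list \<Rightarrow> complex" where
  "prod_sign d Ts = table_sign (juxt d Ts) * table_sign (prod_table d Ts)"

definition hw_shapes :: "nat \<Rightarrow> nat \<Rightarrow> nat list list set" where
  "hw_shapes n d = {lam. (\<exists>m. partition_tuple d m lam) \<and> (\<forall>p\<in>set lam. length p \<le> n)}"

definition hw_tables :: "nat \<Rightarrow> nat \<Rightarrow> table set" where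
  "hw_tables n d = (\<Union>lam\<in>hw_shapes n d. tabA (map conj_part lam))"

definition all_sym_relations :: "nat \<Rightarrow> nat \<Rightarrow> sym_alg set" where
  "all_sym_relations n d = (\<Union>lam\<in>hw_shapes n d. sym_relations (map conj_part lam))"

definition all_ext_relations :: "nat \<Rightarrow> nat \<Rightarrow> ext_alg set" where
  "all_ext_relations n d = (\<Union>lam\<in>hw_shapes n d. ext_relations (map conj_part lam))"

section \<open>The weights in the boundary sums are necessary\<close>

lemma ex_indices:
  "indices 2 3 = {[1,1,1],[1,1,2],[1,2,1],[1,2,2],[2,1,1],[2,1,2],[2,2,1],[2,2,2]}"
proof -
  have "{1..2::nat} = {1, 2}" by auto
  then have "indices 2 3 = {c. set c \<subseteq> {1, 2} \<and> length c = 3}" by (auto simp: indices_def)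
  also have "\<dots> = set (List.n_lists 3 [1, 2])" by (auto simp: set_n_lists)
  also have "\<dots> = {[1,1,1],[1,1,2],[1,2,1],[1,2,2],[2,1,1],[2,1,2],[2,2,1],[2,2,2]}"
    by (simp add: numeral_3_eq_3 insert_commute)
  finally show ?thesis .
qed

lemma ex_shape: "(\<Sum>X\<in>same_shape n [s, t]. f X) =
  (\<Sum>x\<in>indices n (length s). \<Sum>y\<in>indices n (length t). f [x, y])"
proof -
  have "same_shape n [s,t] = (\<lambda>(x,y). [x,y]) ` (indices n (length s) \<times> indices n (length t))"
    by (auto simp: same_shape_def set_Cons_def image_iff)
  then show ?thesis
    by (simp add: sum.reindex inj_on_def sum.cartesian_product case_prod_unfold)
qed

lemma ex_seq_sgn: "seq_sgn [a] = (if a = 1 then 1 else 0)"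
  "seq_sgn [a,b] = (if a = 1 \<and> b = 2 then 1 else if a = 2 \<and> b = 1 then -1 else 0)"
proof -
  have i1: "(\<lambda>i. if i = Suc 0 then [Suc 0] ! (i - 1) else i) = id"
    by (rule ext) simp
  have i2: "(\<lambda>i::nat. if i \<in> {1, 2} then [1, 2] ! (i - 1) else i) = id"
    by (rule ext) auto
  have i3: "(\<lambda>i::nat. if i \<in> {1, 2} then [2, 1] ! (i - 1) else i) = Transposition.transpose 1 2"
    by (rule ext) (auto simp: Transposition.transpose_def)
  have s: "{1..length [x, y]} = {1, 2}" for x y :: nat by auto
  show "seq_sgn [a] = (if a = 1 then 1 else 0)"
    using sign_id[where 'a = nat] unfolding i1[symmetric] seq_sgn_def by auto
  have "seq_sgn [1, 2] = 1"
    unfolding seq_sgn_def s i2 by simp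
  moreover have "seq_sgn [2, 1] = - 1"
    unfolding seq_sgn_def s i3 by (simp add: sign_swap_id insert_commute)
  moreover have "seq_sgn [a, b] = 0" if "\<not> (a = 1 \<and> b = 2)" "\<not> (a = 2 \<and> b = 1)"
    using that unfolding seq_sgn_def s by (simp add: doubleton_eq_iff)
  ultimately show "seq_sgn [a,b] = (if a = 1 \<and> b = 2 then 1 else if a = 2 \<and> b = 1 then -1 else 0)"
    by auto
qed

lemma ex_word_sgn: "word_sgn [1,1,2] [a,b,c] = seq_sgn [a,b] * seq_sgn [c]"
 "word_sgn [1,2,1] [a,b,c] = seq_sgn [a,c] * seq_sgn [b]"
 "word_sgn [2,1,1] [a,b,c] = seq_sgn [b,c] * seq_sgn [a]"
  by (simp_all add: word_sgn_def upt_rec insert_commute[of 1 2] insert_commute[of "Suc 0" 2])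

lemma ex_inversions: "card {(i, j). i < j \<and> j < length [a,b,c] \<and> [a,b,c] ! i > [a,b,c] ! j}
  = of_bool (a > b) + of_bool (a > c) + of_bool (b > (c::nat))"
proof -
  have "{(i, j). i < j \<and> j < length [a,b,c] \<and> [a,b,c] ! i > [a,b,c] ! j} =
    (if a > b then {(0,1)} else {}) \<union> (if a > c then {(0,2)} else {}) \<union> (if b > c then {(1,2)} else {})"
    by (auto simp: less_Suc_eq numeral_2_eq_2 split: if_splits)
  then show ?thesis by (simp split: if_splits)
qed

lemma ex_boundary: "boundary 0 2 1 [[1,1,1],[1,1,2]] =
  {[[2,1,1],[1,1,2]], [[1,2,1],[1,1,2]], [[1,1,2],[1,1,2]]}"
  by (auto simp: boundary_def less_Suc_eq numeral_2_eq_2 intro: exI[of _ 0] exI[of _ 1] exI[of _ 2])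

lemma ex_lookup: "Poly_Mapping.lookup (vee_e [[a,b,c],[x,y,z]]) {#[1,1],[1,1],[2,2]#} =
  (if {#[a,x],[b,y],[c,z]#} = {#[1,1],[1,1],[2,2]#} then 1 else 0)"
  by (simp add: vee_e_def svar_def mult_single lookup_single when_def add_mset_commute)

lemma ex_sum: "(\<Sum>S\<in>boundary 0 2 1 [[1,1,1],[1,1,2]]. Delta 2 S) \<noteq> 0"
proof -
  have ne: "{#[Suc 0, 2], [2, Suc 0]#} \<noteq> {#[2, 2], [Suc 0, Suc 0]#}"
    "{#[2, Suc 0], [Suc 0, 2]#} \<noteq> {#[2, 2], [Suc 0, Suc 0]#}"
    by (auto dest!: arg_cong[where f = set_mset] simp: doubleton_eq_iff)
  have "Poly_Mapping.lookup (\<Sum>S\<in>boundary 0 2 1 [[1,1,1],[1,1,2]]. Delta 2 S) {#[1,1],[1,1],[2,2]#} = - 1"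
    unfolding ex_boundary
    by (simp add: Delta_def ex_shape ex_indices[unfolded numeral_3_eq_3] lookup_add lookup_minus
        lookup_sum table_sgn_def ex_word_sgn ex_word_sgn[simplified] ex_seq_sgn
        ex_seq_sgn[simplified] ex_lookup ex_lookup[simplified] table_sign_def word_sign_def
        ex_inversions ex_inversions[simplified] table_norm_def numeral_3_eq_3 ne)
  then show ?thesis
    by (metis lookup_zero zero_neq_neg_one)
qed

lemma ex_tabA: "[[1,1,1],[1,1,2]] \<in> tabA (move 0 1 2 (map conj_part [[2,1],[2,1]]))"
proof -
  have c: "conj_part [2, Suc 0] = [2, Suc 0]" by (simp add: conj_part_def entry_def upt_rec)
  have i: "{Suc 0..2} = {Suc 0, 2}" by auto
  show ?thesis by (simp add: c move_def tabA_def words_def set_Cons_def i)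
qed

theorem unweighted_boundary_sum_nonzero:
  "\<exists>n m lam l i j Y. partition_tuple 2 m lam \<and>
     (\<forall>p\<in>set lam. length p \<le> n \<and> entry p 1 \<le> n) \<and> l < 2 \<and> 1 \<le> i \<and> i < j \<and>
     j \<le> length (map conj_part lam ! l) \<and> Y \<in> tabA (move l i j (map conj_part lam)) \<and>
     (\<Sum>S\<in>boundary l j i Y. Delta n S) \<noteq> 0"
proof (intro exI conjI)
  show "partition_tuple 2 3 [[2,1],[2,1]]" by (simp add: partition_tuple_def is_partition_def)
  show "\<forall>p\<in>set [[2,1],[2,1]]. length p \<le> 2 \<and> entry p 1 \<le> 2" by (simp add: entry_def)
  show "(0::nat) < 2" "(1::nat) \<le> 1" "(1::nat) < 2" by simp_all
  show "2 \<le> length (map conj_part [[2,1],[2,1]] ! 0)" by (simp add: conj_part_def entry_def)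
  show "[[1,1,1],[1,1,2]] \<in> tabA (move 0 1 2 (map conj_part [[2,1],[2,1]]))" by (fact ex_tabA)
  show "(\<Sum>S\<in>boundary 0 2 1 [[1,1,1],[1,1,2]]. Delta 2 S) \<noteq> 0" by (fact ex_sum)
qed

end

theory Submission
  imports Defs "HOL-Library.Product_Lexorder"
begin

text \<open>
  Write \<open>c t x\<close> (below \<open>cw t x\<close>) for the signed coefficient of the word \<open>x\<close> in the vector attached to the word \<open>t\<close>.
  Up to the sign of a column permutation, \<open>\<Delta>\<close> and \<open>\<nabla>\<close> are the maps induced by the matrix
  \<open>(T, X) \<mapsto> \<Prod>\<^sub>l c T\<^sub>l X\<^sub>l\<close> on (anti)symmetrised functions of the columns. The boundary sums are the
  lowering operators of \<open>gl\<close> acting on the letters of one row, so a linear functional that kills all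
  of them is, as a function of tables, a highest weight vector in each row.

  The point is that every such function is a combination of the columns \<open>T \<mapsto> \<Prod>\<^sub>l c T\<^sub>l X\<^sub>l\<close> of the
  matrix. Its lexicographically largest table has lattice (Yamanouchi) words as rows, because the
  part with the largest first letter is again a highest weight vector and highest weights are
  dominant; and each lattice word is the largest word of the column indexed by its list of ranks.
  Hence the functional factors through the map, after averaging over column permutations, and
  vanishes on the kernel. A product of vectors \<open>\<Delta>\<close> or \<open>\<nabla>\<close> is one such vector for the juxtaposed
  table with disjoint letters, so algebraic relations are linear ones.
\<close>

text \<open>One argument serves four maps. Permuting the columns of \<open>T\<close> and
  \<open>X\<close> together multiplies the coefficient by one sign per row, so if products in the
  source change by \<open>s1\<close> under a transposition of factors, the target must have the sign
  \<open>s2\<close> with \<open>s1 * s2 = (- 1) ^ d\<close>. For odd \<open>d\<close> the two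
  algebras are of different kind, for even \<open>d\<close> of the same kind. Completeness of the
  relations is obtained by duality instead of counting dimensions: a vector outside their span is
  detected by a functional that kills them, and the elimination among tables constructs a functional
  on the target that takes the same value on the image. Repeated columns make the factor
  \<open>1 / table_norm T\<close> visible. Boundary sums vanish for the vectors cleared of it, which
  is the origin of the weights on the symmetric side. The bound on the lengths keeps the ranks used
  as column indices within \<open>{1..n}\<close>; the bound on the first parts does the same for
  tables of content \<lambda>'. Algebraic relations mix shapes, but functionals of different shapes
  live on tables of different content and can be added.\<close>

abbreviation "lookup \<equiv> Poly_Mapping.lookup"
abbreviation "single \<equiv> Poly_Mapping.single"
abbreviation "keys \<equiv> Poly_Mapping.keys"
abbreviation "cols \<equiv> List.transpose"
abbreviation "swap \<equiv> Transposition.transpose"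

section \<open>Alternating functions on lists\<close>

text \<open>Inversions are counted at their left entry, which is the bookkeeping of insertion
  sort.\<close>

fun inv_count :: "'a::linorder list \<Rightarrow> nat" where
  "inv_count [] = 0"
| "inv_count (x # xs) = length (filter (\<lambda>y. y < x) xs) + inv_count xs"

text \<open>Only adjacent swaps are mentioned, since they generate all permutations. With
  \<open>s = 1\<close> such functions are symmetric, with \<open>s = - 1\<close>
  antisymmetric.\<close>

definition alternates :: "complex \<Rightarrow> ('a list \<Rightarrow> complex) \<Rightarrow> bool" where
  "alternates s G \<longleftrightarrow> (\<forall>xs a b ys. G (xs @ a # b # ys) = s * G (xs @ b # a # ys))"

lemma alternatesD: "alternates s G \<Longrightarrow> G (xs @ a # b # ys) = s * G (xs @ b # a # ys)"
  unfolding alternates_def by blast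

lemma alternates_Cons: "alternates s G \<Longrightarrow> alternates s (\<lambda>xs. G (x # xs))"
  unfolding alternates_def by (metis append_Cons)

lemma alternates_append: "alternates s G \<Longrightarrow> alternates s (\<lambda>xs. G (zs @ xs))"
  unfolding alternates_def by (metis append.assoc)

lemma alternates_map: "alternates s G \<Longrightarrow> alternates s (\<lambda>xs. G (map f xs))"
  unfolding alternates_def map_append list.map by blast

text \<open>Insertion carries \<open>x\<close> past exactly the strictly smaller entries, at a
  factor \<open>s\<close> each, and stops in front of an equal entry.\<close>

lemma alternates_insort:
  fixes G :: "'a::linorder list \<Rightarrow> complex"
  assumes "alternates s G" "sorted ys"
  shows "G (x # ys) = s ^ length (filter (\<lambda>y. y < x) ys) * G (insort x ys)"
  using assms
proof (induction ys arbitrary: G)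
  case (Cons y ys)
  show ?case
  proof (cases "x \<le> y")
    case True
    then have "filter (\<lambda>y. y < x) (y # ys) = []"
      using Cons.prems(2) by (auto simp: filter_empty_conv)
    then show ?thesis using True by simp
  next
    case False
    have "G (x # y # ys) = s * G (y # x # ys)"
      using alternatesD[OF Cons.prems(1), of "[]" x y ys] by simp
    also have "G (y # x # ys) = s ^ length (filter (\<lambda>y. y < x) ys) * G (y # insort x ys)"
      using Cons.IH[OF alternates_Cons[OF Cons.prems(1), of y]] Cons.prems(2) by simp
    finally have "G (x # y # ys) = s * (s ^ length (filter (\<lambda>y. y < x) ys) * G (y # insort x ys))" .
    moreover have "y < x" using False by simp
    ultimately show ?thesis using False by simp
  qed
qed simp

lemma length_filter_sort: "length (filter P (sort xs)) = length (filter P xs)"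
  by (metis mset_filter mset_sort size_mset)

text \<open>Consequently \<open>G\<close> is determined by its values on sorted lists, the normal
  forms of products in both algebras.\<close>

lemma alternates_sort:
  fixes G :: "'a::linorder list \<Rightarrow> complex"
  assumes "alternates s G"
  shows "G xs = s ^ inv_count xs * G (sort xs)"
  using assms
proof (induction xs arbitrary: G)
  case (Cons x xs)
  have "G (x # xs) = s ^ inv_count xs * G (x # sort xs)"
    using Cons.IH[OF alternates_Cons[OF Cons.prems]] .
  also have "G (x # sort xs) = s ^ length (filter (\<lambda>y. y < x) xs) * G (sort (x # xs))"
    using alternates_insort[OF Cons.prems, of "sort xs" x] by (simp add: length_filter_sort)
  finally show ?case by (simp add: power_add)
qed simp

text \<open>For \<open>s = 1\<close> the trivial character of the symmetric group, for
  \<open>s = - 1\<close> the sign.\<close>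

definition perm_eps :: "complex \<Rightarrow> nat \<Rightarrow> (nat \<Rightarrow> nat) \<Rightarrow> complex" where
  "perm_eps s m p = s ^ inv_count (map p [0..<m])"

lemma perm_eps_mult: "perm_eps (s * t) m p = perm_eps s m p * perm_eps t m p"
  by (simp add: perm_eps_def power_mult_distrib)

lemma perm_eps_power: "perm_eps (s ^ k) m p = perm_eps s m p ^ k"
  by (simp add: perm_eps_def power_mult[symmetric] mult.commute)

lemma perm_eps_1 [simp]: "perm_eps 1 m p = 1"
  by (simp add: perm_eps_def)

lemma sort_map_permutes:
  assumes "p permutes {..<m}"
  shows "sort (map p [0..<m]) = [0..<m]"
proof -
  have "p i < m" if "i < m" for i
    using permutes_in_image[OF assms, of i] that by simp
  then have "permute_list p [0..<m] = map p [0..<m]"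
    by (auto simp: permute_list_def)
  then have "mset (map p [0..<m]) = mset [0..<m]"
    using mset_permute_list[of p "[0..<m]"] assms by simp
  then show ?thesis by (simp add: properties_for_sort)
qed

text \<open>The sorting is done on the positions \<open>[0..<length xs]\<close>, of which
  \<open>xs\<close> is the image under \<open>nth xs\<close>. So the factor is the character of
  \<open>p\<close> even if \<open>xs\<close> has repeated entries.\<close>

lemma alternates_permute_list:
  assumes G: "alternates s G" and p: "p permutes {..<length xs}"
  shows "G (permute_list p xs) = perm_eps s (length xs) p * G xs"
proof -
  have "G (permute_list p xs) = G (map ((!) xs) (map p [0..<length xs]))"
    by (simp add: permute_list_def o_def)
  also have "\<dots> = perm_eps s (length xs) p * G (map ((!) xs) (sort (map p [0..<length xs])))"
    unfolding perm_eps_def by (rule alternates_sort[OF alternates_map[OF G]])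
  finally show ?thesis using sort_map_permutes[OF p] by (simp add: map_nth)
qed

lemma alternates_move:
  assumes "alternates s G"
  shows "G (a # ys @ zs) = s ^ length ys * G (ys @ a # zs)"
  using assms
proof (induction ys arbitrary: G)
  case (Cons y ys)
  have "G (a # y # ys @ zs) = s * G (y # a # ys @ zs)"
    using alternatesD[OF Cons.prems, of "[]" a y "ys @ zs"] by simp
  also have "\<dots> = s * (s ^ length ys * G (y # ys @ a # zs))"
    using Cons.IH[OF alternates_Cons[OF Cons.prems, of y]] by simp
  finally show ?case by simp
qed simp

text \<open>Carrying \<open>a\<close> across \<open>ys\<close> and bringing \<open>b\<close> back
  costs \<open>2 * length ys + 1\<close> adjacent swaps, and the even part cancels.\<close>

lemma alternates_exchange:
  assumes G: "alternates s G" and s: "s * s = 1"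
  shows "G (xs @ a # ys @ b # zs) = s * G (xs @ b # ys @ a # zs)"
proof -
  have e: "s ^ k * s ^ k = 1" for k
    using s by (simp add: power_mult_distrib[symmetric])
  let ?G = "\<lambda>w. G (xs @ w)"
  have A: "alternates s ?G" by (rule alternates_append[OF G])
  have "?G (a # ys @ b # zs) = s ^ length ys * ?G (ys @ a # b # zs)"
    by (rule alternates_move[OF A])
  also have "?G (ys @ a # b # zs) = s * ?G (ys @ b # a # zs)"
    by (rule alternatesD[OF A])
  also have "?G (b # ys @ a # zs) = s ^ length ys * ?G (ys @ b # a # zs)"
    by (rule alternates_move[OF A])
  then have "?G (ys @ b # a # zs) = s ^ length ys * ?G (b # ys @ a # zs)"
    using e[of "length ys"] by (simp add: mult.assoc[symmetric])
  finally show ?thesis using e[of "length ys"] by (simp add: ac_simps)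
qed

lemma alternates_swap:
  assumes G: "alternates s G" and s: "s * s = 1" and ij: "i < j" "j < length xs"
  shows "G (xs[i := xs ! j, j := xs ! i]) = s * G xs"
proof -
  define A B C where "A = take i xs" and "B = take (j - Suc i) (drop (Suc i) xs)"
    and "C = drop (Suc j) xs"
  have xs: "xs = A @ xs ! i # B @ xs ! j # C"
  proof -
    have "drop (Suc i) xs = B @ drop (j - Suc i) (drop (Suc i) xs)"
      unfolding B_def by (metis append_take_drop_id)
    also have "drop (j - Suc i) (drop (Suc i) xs) = drop j xs" using ij by simp
    also have "drop j xs = xs ! j # C" using ij by (simp add: C_def Cons_nth_drop_Suc)
    finally show ?thesis using ij id_take_nth_drop[of i xs] by (simp add: A_def)
  qed
  have len: "length A = i" "length B = j - Suc i" using ij by (auto simp: A_def B_def)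
  have u: "(A @ x # B @ y # C)[i := x', j := y'] = A @ x' # B @ y' # C" for x y x' y'
    using len ij by (auto simp: list_update_append split: nat.split)
  have "xs[i := xs ! j, j := xs ! i] = A @ xs ! j # B @ xs ! i # C"
    using u[of "xs ! i" "xs ! j" "xs ! j" "xs ! i"] xs by metis
  then show ?thesis using alternates_exchange[OF G s] xs by metis
qed

lemma alternates_swap_neq:
  assumes "alternates s G" "s * s = 1" "i \<noteq> j" "i < length xs" "j < length xs"
  shows "G (xs[i := xs ! j, j := xs ! i]) = s * G xs"
proof (cases "i < j")
  case True
  then show ?thesis using alternates_swap[OF assms(1,2)] assms(5) by blast
next
  case False
  then have "j < i" using assms(3) by simp
  then show ?thesis
    using alternates_swap[OF assms(1,2) _ assms(4), of j] list_update_swap[OF assms(3)] by metis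
qed

lemma alternates_not_distinct:
  assumes G: "alternates (- 1) G" and "\<not> distinct xs"
  shows "G xs = 0"
proof -
  obtain A B C a where "xs = A @ [a] @ B @ [a] @ C"
    using not_distinct_decomp[OF assms(2)] by blast
  then have "G xs = - G xs"
    using alternates_exchange[OF G, of A a B a C] by simp
  then show ?thesis by simp
qed

lemma inv_count_append:
  "inv_count (xs @ ys) = inv_count xs + inv_count ys
     + (\<Sum>x\<leftarrow>xs. length (filter (\<lambda>y. y < x) ys))"
  by (induction xs) auto

text \<open>Swapping two different neighbours changes the number of inversions by exactly one. The
  condition sees only the multiset, so the swap keeps it.\<close>

lemma alternates_inv_count:
  fixes P :: "'a::linorder multiset \<Rightarrow> bool"
  assumes "\<And>xs. P (mset xs) \<Longrightarrow> distinct xs"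
  shows "alternates (- 1) (\<lambda>xs. if P (mset xs) then (- 1) ^ inv_count xs else 0)"
  unfolding alternates_def
proof (intro allI)
  fix xs ys :: "'a list" and a b
  show "(if P (mset (xs @ a # b # ys)) then (- 1) ^ inv_count (xs @ a # b # ys) else 0) =
      (- 1) * ((if P (mset (xs @ b # a # ys)) then (- 1) ^ inv_count (xs @ b # a # ys) else 0) :: complex)"
  proof (cases "P (mset (xs @ a # b # ys))")
    case True
    have P': "P (mset (xs @ b # a # ys))" using True by (simp add: add_mset_commute)
    have "a \<noteq> b" using assms[OF True] by auto
    moreover have "(\<Sum>x\<leftarrow>xs. length (filter (\<lambda>y. y < x) (a # b # ys))) =
        (\<Sum>x\<leftarrow>xs. length (filter (\<lambda>y. y < x) (b # a # ys)))"
      by (intro arg_cong[where f = sum_list] map_cong) auto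
    ultimately show ?thesis
      unfolding inv_count_append using True P' by (cases "a < b") (auto simp: power_add)
  next
    case False
    then show ?thesis by (simp add: add_mset_commute)
  qed
qed

section \<open>Words\<close>

lemma inversions_card:
  "card {(i, j). i < j \<and> j < length w \<and> w ! i > w ! j} = inv_count (w :: 'a::linorder list)"
proof (induction w)
  case (Cons x w)
  let ?S = "\<lambda>w. {(i, j). i < j \<and> j < length w \<and> w ! i > (w ! j :: 'a)}"
  let ?A = "(\<lambda>j. (0::nat, Suc j)) ` {j. j < length w \<and> w ! j < x}"
  let ?B = "(\<lambda>(i, j). (Suc i, Suc j)) ` ?S w"
  have eq: "?S (x # w) = ?A \<union> ?B"
  proof (intro equalityI subsetI)
    fix p assume "p \<in> ?S (x # w)"
    then obtain i j where p: "p = (i, j)" "i < j" "j < Suc (length w)" "(x # w) ! i > (x # w) ! j"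
      by auto
    then obtain j' where "j = Suc j'" by (cases j) auto
    with p show "p \<in> ?A \<union> ?B" by (cases i) (auto simp: image_iff)
  qed auto
  have fin: "finite (?S w)"
    by (rule finite_subset[of _ "{..length w} \<times> {..length w}"]) auto
  have "card (?A \<union> ?B) = card ?A + card ?B"
    by (rule card_Un_disjoint) (use fin in auto)
  also have "card ?A = length (filter (\<lambda>y. y < x) w)"
    by (subst card_image) (auto simp: inj_on_def length_filter_conv_card)
  also have "card ?B = inv_count w"
    using Cons by (subst card_image) (auto simp: inj_on_def)
  finally show ?case using eq by simp
qed simp

lemma word_sign_inv_count: "word_sign w = (- 1) ^ inv_count w"
  by (simp add: word_sign_def inversions_card)

text \<open>A swap of neighbours composes the permutation on the right with a transposition of
  positions, whose sign is -1; if the list is no permutation, neither is the swapped one.\<close>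

lemma seq_sgn_alternates: "alternates (- 1) seq_sgn"
  unfolding alternates_def
proof (intro allI)
  fix xs ys :: "nat list" and a b
  let ?u = "xs @ a # b # ys" and ?v = "xs @ b # a # ys"
  let ?k = "length xs + length ys + 2"
  define f where "f w i = (if i \<in> {1..?k} then (w ! (i - 1) :: nat) else i)" for w i
  have c: "(distinct ?u \<and> set ?u = {1..?k}) = (distinct ?v \<and> set ?v = {1..?k})" by auto
  show "seq_sgn ?u = - 1 * seq_sgn ?v"
  proof (cases "distinct ?v \<and> set ?v = {1..?k}")
    case True
    let ?t = "swap (length xs + 1) (length xs + 2)"
    have fu: "f ?u = f ?v \<circ> ?t"
    proof
      fix i
      consider "i = length xs + 1" | "i = length xs + 2" | "i \<noteq> length xs + 1" "i \<noteq> length xs + 2"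
        by blast
      then show "f ?u i = (f ?v \<circ> ?t) i"
      proof cases
        case 3
        then have "?u ! (i - 1) = ?v ! (i - 1)" if "1 \<le> i"
          using that by (auto simp: nth_append nth_Cons split: nat.split)
        then show ?thesis using 3 by (auto simp: f_def)
      qed (auto simp: f_def nth_append)
    qed
    have "bij_betw (f ?v) {1..?k} {1..?k}"
    proof (rule bij_betwI')
      fix x y assume xy: "x \<in> {1..?k}" "y \<in> {1..?k}"
      then have "x - 1 < length ?v" "y - 1 < length ?v" by auto
      then have "?v ! (x - 1) = ?v ! (y - 1) \<longleftrightarrow> x - 1 = y - 1"
        using True by (intro nth_eq_iff_index_eq) blast
      then show "(f ?v x = f ?v y) = (x = y)"
        using xy by (auto simp: f_def)
    next
      fix x assume x: "x \<in> {1..?k}"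
      then have "?v ! (x - 1) \<in> set ?v" by (intro nth_mem) auto
      then have "?v ! (x - 1) \<in> {1..?k}" using True by metis
      then show "f ?v x \<in> {1..?k}" using x unfolding f_def by (simp only: if_True)
    next
      fix y assume "y \<in> {1..?k}"
      then have "y \<in> set ?v" using True by simp
      then obtain i where "i < length ?v" "?v ! i = y" by (metis in_set_conv_nth)
      then show "\<exists>x\<in>{1..?k}. y = f ?v x"
        by (intro bexI[of _ "Suc i"]) (auto simp: f_def)
    qed
    then have "f ?v permutes {1..?k}"
      by (rule bij_imp_permutes) (auto simp: f_def)
    then have P: "permutation (f ?v)" by (rule permutes_imp_permutation[rotated]) simp
    have "sign (f ?u) = sign (f ?v) * sign ?t"
      unfolding fu using P by (intro sign_compose) (simp_all add: permutation_swap_id)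
    then have sg: "sign (f ?u) = - sign (f ?v)" by (simp add: sign_swap_id)
    have l: "length ?u = ?k" "length ?v = ?k" by simp_all
    have su: "seq_sgn ?u = of_int (sign (f ?u))"
      unfolding seq_sgn_def l f_def[abs_def] using True c by presburger
    have sv: "seq_sgn ?v = of_int (sign (f ?v))"
      unfolding seq_sgn_def l f_def[abs_def] using True c by presburger
    show ?thesis unfolding su sv sg by simp
  next
    case False
    have l: "length ?u = ?k" "length ?v = ?k" by simp_all
    have "\<not> (distinct ?u \<and> set ?u = {1..?k})" using False c by blast
    with False show ?thesis unfolding seq_sgn_def l by (simp only: if_False mult_zero_right)
  qed
qed

text \<open>Sorting an alternating function costs the sign of the inversions, and the value at the
  identity is 1.\<close>

lemma seq_sgn_inv_count:
  "seq_sgn a = (if distinct a \<and> set a = {1..length a} then (- 1) ^ inv_count a else 0)"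
proof (cases "distinct a \<and> set a = {1..length a}")
  case True
  define k where "k = length a"
  have "sort a = [1..<Suc k]"
  proof -
    have "sort a = sorted_list_of_set (set a)"
      using True by (metis distinct_remdups_id sorted_list_of_set_sort_remdups)
    also have "set a = {1..<Suc k}" using True by (simp add: k_def atLeastLessThanSuc_atLeastAtMost)
    finally show ?thesis by (simp only: sorted_list_of_set_range)
  qed
  moreover have "seq_sgn [1..<Suc k] = 1"
  proof -
    have "(\<lambda>i. if i \<in> {1..length [1..<Suc k]} then [1..<Suc k] ! (i - 1) else i) = id"
      by (rule ext) (auto simp del: upt_Suc)
    moreover have "distinct [1..<Suc k] \<and> set [1..<Suc k] = {1..length [1..<Suc k]}"
      by (auto simp del: upt_Suc)
    ultimately show ?thesis unfolding seq_sgn_def by (metis of_int_1 sign_id)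
  qed
  ultimately show ?thesis
    using True alternates_sort[OF seq_sgn_alternates, of a] by simp
next
  case False
  then show ?thesis unfolding seq_sgn_def by (simp only: if_False)
qed

section \<open>Coefficients as sorting signs of lists of pairs\<close>

definition block :: "nat \<Rightarrow> (nat \<times> nat) list \<Rightarrow> nat list" where
  "block k ps = map snd (filter (\<lambda>p. fst p = k) ps)"

lemma block_Nil [simp]: "block k [] = []"
  and block_Cons [simp]:
    "block k (p # ps) = (if fst p = k then snd p # block k ps else block k ps)"
  by (simp_all add: block_def)

lemma count_block: "count (mset (block k ps)) v = count (mset ps) (k, v)"
  by (induction ps) auto

lemma length_block: "length (block k ps) = count (mset (map fst ps)) k"
  by (induction ps) auto

text \<open>The nonvanishing condition of \<open>word_sgn\<close>: every letter meets each value
  from 1 to its multiplicity once and no other value. Stated for multisets, it is visibly invariant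
  under simultaneous permutation of both words.\<close>

definition std_pairs :: "(nat \<times> nat) multiset \<Rightarrow> bool" where
  "std_pairs M \<longleftrightarrow> (\<forall>k v. count M (k, v) = of_bool (1 \<le> v \<and> v \<le> count (image_mset fst M) k))"

lemma std_pairs_distinct: "std_pairs (mset ps) \<Longrightarrow> distinct ps"
  unfolding distinct_count_atmost_1
proof
  fix a assume "std_pairs (mset ps)"
  then have "count (mset ps) a \<le> 1" unfolding std_pairs_def by (cases a) auto
  then show "count (mset ps) a = (if a \<in> set ps then 1 else 0)"
    using count_mset_0_iff[of ps a] by (auto simp del: count_mset_0_iff)
qed

lemma std_pairs_blocks:
  "std_pairs (mset ps) \<longleftrightarrow>
     (\<forall>k\<in>fst ` set ps. distinct (block k ps) \<and> set (block k ps) = {1..length (block k ps)})"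
proof -
  have *: "distinct (block k ps) \<and> set (block k ps) = {1..length (block k ps)} \<longleftrightarrow>
      (\<forall>v. count (mset ps) (k, v) = of_bool (1 \<le> v \<and> v \<le> count (image_mset fst (mset ps)) k))" for k
  proof -
    have "distinct (block k ps) \<and> set (block k ps) = {1..length (block k ps)} \<longleftrightarrow>
      (\<forall>v. count (mset (block k ps)) v = of_bool (v \<in> {1..length (block k ps)}))"
    proof safe
      fix v assume "distinct (block k ps)" "set (block k ps) = {1..length (block k ps)}"
      then show "count (mset (block k ps)) v = of_bool (v \<in> {1..length (block k ps)})"
        using distinct_count_atmost_1[of "block k ps"] by (metis count_mset_0_iff of_bool_def set_mset_mset)
    next
      assume "\<forall>v. count (mset (block k ps)) v = of_bool (v \<in> {1..length (block k ps)})"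
      moreover from this have s: "set (block k ps) = {1..length (block k ps)}"
        by (metis (no_types, lifting) count_mset_0_iff of_bool_eq_0_iff subsetI subset_antisym)
      ultimately show "distinct (block k ps)"
        unfolding distinct_count_atmost_1 by auto
      show "v \<in> {1..length (block k ps)}" if "v \<in> set (block k ps)" for v using s that by simp
      show "v \<in> set (block k ps)" if "v \<in> {1..length (block k ps)}" for v using s that by simp
    qed
    then show ?thesis by (simp add: count_block length_block)
  qed
  have "\<forall>v. count (mset ps) (k, v) = of_bool (1 \<le> v \<and> v \<le> count (image_mset fst (mset ps)) k)"
    if "k \<notin> fst ` set ps" for k
  proof
    fix v
    have "(k, v) \<notin> set ps" using that by force
    then have 1: "count (mset ps) (k, v) = 0" by (simp add: count_mset_0_iff)
    have "count (mset (map fst ps)) k = 0"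
      using that unfolding count_mset_0_iff by simp
    then show "count (mset ps) (k, v) = of_bool (1 \<le> v \<and> v \<le> count (image_mset fst (mset ps)) k)"
      unfolding 1 by simp
  qed
  then show ?thesis unfolding std_pairs_def * by blast
qed

lemma word_sgn_blocks:
  assumes "length s = length x"
  shows "word_sgn s x = (\<Prod>c\<in>set s. seq_sgn (block c (zip s x)))"
proof -
  have z: "zip s x = map (\<lambda>b. (s ! b, x ! b)) [0..<length s]"
    using assms by (intro nth_equalityI) auto
  show ?thesis
    unfolding word_sgn_def z by (simp add: block_def filter_map o_def)
qed

text \<open>In the lexicographic order two entries with different letters are inverted through their
  letters, two entries with the same letter through their values; the latter inversions are those
  inside the blocks.\<close>

lemma inv_count_pairs:
  assumes "finite S" "fst ` set ps \<subseteq> S"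
  shows "inv_count ps = inv_count (map fst ps) + (\<Sum>k\<in>S. inv_count (block k ps))"
  using assms(2)
proof (induction ps)
  case (Cons p ps)
  obtain k v where p: "p = (k, v)" by (cases p)
  have "length (filter (\<lambda>q. q < (k, v)) qs) =
      length (filter (\<lambda>y. y < k) (map fst qs)) + length (filter (\<lambda>y. y < v) (block k qs))" for qs
    by (induction qs) auto
  moreover have "(\<Sum>k'\<in>S. inv_count (block k' (p # ps))) =
      length (filter (\<lambda>y. y < v) (block k ps)) + (\<Sum>k'\<in>S. inv_count (block k' ps))"
  proof -
    have kS: "k \<in> S" using Cons.prems p by auto
    show ?thesis
      unfolding sum.remove[OF assms(1) kS, of "\<lambda>k'. inv_count (block k' (p # ps))"]
        sum.remove[OF assms(1) kS, of "\<lambda>k'. inv_count (block k' ps)"]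
      using p by (auto intro!: sum.cong)
  qed
  ultimately show ?case using Cons p by simp
qed simp

definition cw :: "nat list \<Rightarrow> nat list \<Rightarrow> complex" where
  "cw t x = word_sign t * word_sgn t x"

definition pairs_sgn :: "(nat \<times> nat) list \<Rightarrow> complex" where
  "pairs_sgn ps = (if std_pairs (mset ps) then (- 1) ^ inv_count ps else 0)"

text \<open>This is what the factor \<open>word_sign t\<close> achieves: together with the signs of
  the blocks it is the sign of sorting the pairs lexicographically, hence an alternating function of
  the pairs.\<close>

lemma cw_pairs_sgn:
  assumes "length t = length x"
  shows "cw t x = pairs_sgn (zip t x)"
proof -
  let ?ps = "zip t x"
  have f: "map fst ?ps = t" using assms by simp
  then have fs: "fst ` set ?ps = set t" by (metis set_map)
  show ?thesis
  proof (cases "std_pairs (mset ?ps)")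
    case True
    then have "word_sgn t x = (\<Prod>c\<in>set t. (- 1) ^ inv_count (block c ?ps))"
      unfolding word_sgn_blocks[OF assms] std_pairs_blocks fs
      by (intro prod.cong) (simp_all add: seq_sgn_inv_count)
    then show ?thesis
      using True inv_count_pairs[of "set t" ?ps] f fs
      by (simp add: pairs_sgn_def cw_def word_sign_inv_count power_add power_sum)
  next
    case False
    then obtain c where "c \<in> set t" "\<not> (distinct (block c ?ps) \<and> set (block c ?ps) = {1..length (block c ?ps)})"
      unfolding std_pairs_blocks fs by blast
    then have "c \<in> set t" "seq_sgn (block c ?ps) = 0" by (simp_all only: seq_sgn_def if_False)
    then have "word_sgn t x = 0"
      unfolding word_sgn_blocks[OF assms] by (meson List.finite_set prod_zero)
    then show ?thesis using False by (simp add: cw_def pairs_sgn_def)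
  qed
qed

lemma pairs_sgn_alternates: "alternates (- 1) pairs_sgn"
  unfolding pairs_sgn_def[abs_def] by (rule alternates_inv_count) (rule std_pairs_distinct)

lemma cw_nonzero_iff:
  "length t = length x \<Longrightarrow> cw t x \<noteq> 0 \<longleftrightarrow> std_pairs (mset (zip t x))"
  by (simp add: cw_pairs_sgn pairs_sgn_def)

lemma count_zip_std:
  assumes "std_pairs (mset (zip t x))" "length t = length x"
  shows "count (mset (zip t x)) (k, v) = of_bool (1 \<le> v \<and> v \<le> count_list t k)"
proof -
  have "image_mset fst (mset (zip t x)) = mset t" using assms(2) by (metis map_fst_zip mset_map)
  then show ?thesis using assms(1) by (simp add: std_pairs_def count_mset)
qed

lemma cw_permute_list:
  assumes "p permutes {..<m}" "length t = m" "length x = m"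
  shows "cw (permute_list p t) (permute_list p x) = perm_eps (- 1) m p * cw t x"
proof -
  have z: "permute_list p (zip t x) = zip (permute_list p t) (permute_list p x)"
    by (rule permute_list_zip[OF assms(1)]) (use assms in auto)
  have "cw (permute_list p t) (permute_list p x) = pairs_sgn (permute_list p (zip t x))"
    unfolding z by (rule cw_pairs_sgn) (use assms in simp)
  also have "\<dots> = perm_eps (- 1) (length (zip t x)) p * pairs_sgn (zip t x)"
    by (rule alternates_permute_list[OF pairs_sgn_alternates]) (use assms in simp)
  finally show ?thesis using assms(2,3) by (simp add: cw_pairs_sgn)
qed

section \<open>Highest weight functions on words\<close>

text \<open>
  On functions of words this is the raising operator exchanging a letter \<open>b\<close> for \<open>a\<close>, and \<open>repl b a\<close>
  is the matching lowering operator.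
\<close>

fun repl :: "nat \<Rightarrow> nat \<Rightarrow> (nat list \<Rightarrow> complex) \<Rightarrow> nat list \<Rightarrow> complex" where
  "repl a b h [] = 0"
| "repl a b h (k # y) = (if k = a then h (b # y) else 0) + repl a b (\<lambda>w. h (k # w)) y"

lemma repl_sum: "repl a b h y = (\<Sum>q | q < length y \<and> y ! q = a. h (y[q := b]))"
proof (induction y arbitrary: h)
  case (Cons k y)
  have eq: "{q. q < length (k # y) \<and> (k # y) ! q = a} =
      (if k = a then {0} else {}) \<union> Suc ` {q. q < length y \<and> y ! q = a}" (is "_ = ?A \<union> ?B")
    by (auto simp: image_iff less_Suc_eq_0_disj)
  have "(\<Sum>q\<in>?A \<union> ?B. h ((k # y)[q := b])) =
      (\<Sum>q\<in>?A. h ((k # y)[q := b])) + (\<Sum>q\<in>?B. h ((k # y)[q := b]))"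
    by (rule sum.union_disjoint) auto
  also have "(\<Sum>q\<in>?A. h ((k # y)[q := b])) = (if k = a then h (b # y) else 0)" by simp
  also have "(\<Sum>q\<in>?B. h ((k # y)[q := b])) = (\<Sum>q | q < length y \<and> y ! q = a. h (k # y[q := b]))"
    by (subst sum.reindex) auto
  finally show ?case using Cons eq by simp
qed simp

lemma repl_add: "repl a b (\<lambda>w. f w + g w) y = repl a b f y + repl a b g y"
  by (induction y arbitrary: f g) auto

lemma repl_mult: "repl a b (\<lambda>w. c * f w) y = c * repl a b f y"
  by (induction y arbitrary: f) (auto simp: algebra_simps)

lemma repl_zero [simp]: "repl a b (\<lambda>w. 0) y = 0"
  by (induction y) auto

text \<open>The commutator relation of \<open>sl2\<close>: raising and lowering commute up to the
  weight, the difference of the two multiplicities.\<close>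

lemma repl_commute:
  assumes "a \<noteq> b"
  shows "repl a b (repl b a h) w =
    repl b a (repl a b h) w + (of_nat (count_list w a) - of_nat (count_list w b)) * h w"
  using assms
proof (induction w arbitrary: h)
  case (Cons k w)
  show ?case
    using Cons.IH[OF assms, of "\<lambda>w. h (k # w)"] Cons.prems
    by (auto simp: repl_add algebra_simps cong: if_cong)
qed simp

lemma repl_count:
  assumes "repl b a h w \<noteq> 0" "a \<noteq> b" "\<And>w. h w \<noteq> 0 \<Longrightarrow> count_list w a = A \<and> count_list w b = B"
  shows "Suc (count_list w a) = A \<and> count_list w b = Suc B"
  using assms
proof (induction w arbitrary: h A B)
  case (Cons k w)
  show ?case
  proof (cases "k = b \<and> h (a # w) \<noteq> 0")
    case True
    then show ?thesis using Cons.prems(2) Cons.prems(3)[of "a # w"] by auto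
  next
    case False
    then have r: "repl b a (\<lambda>w. h (k # w)) w \<noteq> 0" using Cons.prems(1) by (auto split: if_splits)
    have "Suc (count_list w a) = A - of_bool (k = a) \<and> count_list w b = Suc (B - of_bool (k = b))"
    proof (rule Cons.IH[OF r Cons.prems(2)])
      fix w assume "h (k # w) \<noteq> 0"
      then show "count_list w a = A - of_bool (k = a) \<and> count_list w b = B - of_bool (k = b)"
        using Cons.prems(2) Cons.prems(3)[of "k # w"] by auto
    qed
    \<comment> \<open>A word in the support guarantees that the natural number subtractions above
      are not truncated.\<close>
    moreover have "\<exists>w'. h (k # w') \<noteq> 0"
    proof (rule ccontr)
      assume "\<nexists>w'. h (k # w') \<noteq> 0"
      then have "(\<lambda>w. h (k # w)) = (\<lambda>w. 0)" by auto
      then show False using r by simp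
    qed
    then obtain w' where "h (k # w') \<noteq> 0" by blast
    then have "of_bool (k = a) \<le> A" "of_bool (k = b) \<le> B"
      using Cons.prems(2) Cons.prems(3)[of "k # w'"] by auto
    ultimately show ?thesis using Cons.prems(2) by auto
  qed
qed simp

text \<open>
  The usual argument for \<open>sl\<^sub>2\<close>: a vector killed by the raising operator, of weight \<open>A - B < 0\<close>,
  vanishes, because the lowering operator is nilpotent and can be undone by the raising one.
\<close>

lemma repl_kernel_count_le:
  assumes ab: "a \<noteq> b" and supp: "\<And>w. h w \<noteq> 0 \<Longrightarrow> count_list w a = A \<and> count_list w b = B"
    and ker: "\<And>y. repl a b h y = 0" and nz: "h t \<noteq> 0"
  shows "B \<le> A"
proof (rule ccontr)
  assume "\<not> B \<le> A"
  define F where "F k = (repl b a ^^ k) h" for k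
  have F0: "F 0 = h" and FS: "F (Suc k) = repl b a (F k)" for k by (simp_all add: F_def)
  have supp_F: "F k w \<noteq> 0 \<Longrightarrow> count_list w a + k = A \<and> count_list w b = B + k" for k w
  proof (induction k arbitrary: w)
    case 0
    then show ?case using supp by (simp add: F0)
  next
    case (Suc k)
    have nz: "repl b a (F k) w \<noteq> 0" using Suc.prems by (simp add: FS)
    have "Suc (count_list w a) = A - k \<and> count_list w b = Suc (B + k)"
      by (rule repl_count[OF nz ab]) (use Suc.IH in force)
    then show ?case by auto
  qed
  \<comment> \<open>The usual coefficient of \<open>e f^k v\<close>. For \<open>k = 0\<close> the
    index \<open>k - 1\<close> is again 0, which is harmless because the coefficient
    vanishes.\<close>
  have E: "repl a b (F k) y = of_nat k * (of_nat A - of_nat B - of_nat k + 1) * F (k - 1) y" for k y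
  proof (induction k arbitrary: y)
    case 0
    then show ?case by (simp add: F0 ker)
  next
    case (Suc k)
    have IH: "repl a b (F k) = (\<lambda>y. of_nat k * (of_nat A - of_nat B - of_nat k + 1) * F (k - 1) y)"
      using Suc.IH by auto
    have "repl a b (F (Suc k)) y =
        repl b a (repl a b (F k)) y + (of_nat (count_list y a) - of_nat (count_list y b)) * F k y"
      by (simp add: FS repl_commute[OF ab])
    also have "repl b a (repl a b (F k)) y = of_nat k * (of_nat A - of_nat B - of_nat k + 1) * F k y"
      unfolding IH repl_mult by (cases k) (simp_all add: FS)
    also have "(of_nat (count_list y a) - of_nat (count_list y b)) * F k y =
        (of_nat A - of_nat B - 2 * of_nat k) * F k y"
    proof (cases "F k y = 0")
      case False
      then have "of_nat A = of_nat (count_list y a) + (of_nat k :: complex)"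
        "of_nat (count_list y b) = of_nat B + (of_nat k :: complex)"
        using supp_F[OF False] by (metis of_nat_add)+
      then show ?thesis by (simp add: algebra_simps)
    qed simp
    finally show ?case by (simp add: algebra_simps)
  qed
  have zero: "F k = (\<lambda>w. 0)" if "F (Suc k) = (\<lambda>w. 0)" for k
  proof
    fix w
    have "of_nat (Suc k) * (of_nat A - of_nat B - of_nat (Suc k) + 1) * F k w = 0"
      using E[of "Suc k" w] that by simp
    \<comment> \<open>Here \<open>A < B\<close> is used: a vanishing coefficient would mean
      \<open>A = B + k\<close>.\<close>
    moreover have "of_nat A - of_nat B - of_nat (Suc k) + 1 \<noteq> (0 :: complex)"
    proof
      assume "of_nat A - of_nat B - of_nat (Suc k) + 1 = (0 :: complex)"
      then have "of_nat A = (of_nat (B + k) :: complex)" by (simp add: algebra_simps)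
      then have "A = B + k" by (simp only: of_nat_eq_iff)
      then show False using \<open>\<not> B \<le> A\<close> by simp
    qed
    ultimately show "F k w = 0" by (simp del: of_nat_Suc)
  qed
  \<comment> \<open>Each step trades a letter \<open>a\<close> for a letter \<open>b\<close>, so no
    word survives more than \<open>A\<close> steps.\<close>
  have F_top: "F (Suc A) = (\<lambda>w. 0)"
  proof
    fix w show "F (Suc A) w = 0" using supp_F[of "Suc A" w] by auto
  qed
  have "F k = (\<lambda>w. 0)" if "k \<le> Suc A" for k
    using that
  proof (induction rule: inc_induct)
    case base
    show ?case by (rule F_top)
  next
    case (step k)
    then show ?case using zero by blast
  qed
  then have "F 0 = (\<lambda>w. 0)" by blast
  then show False using nz by (simp add: F0)
qed

section \<open>Lattice words as leading words\<close>

definition dominant :: "nat list \<Rightarrow> bool" where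
  "dominant w \<longleftrightarrow> (\<forall>a b. 1 \<le> a \<longrightarrow> a < b \<longrightarrow> count_list w b \<le> count_list w a)"

text \<open>Lattice words are read from the right: every suffix has dominant content.\<close>

fun yamanouchi :: "nat list \<Rightarrow> bool" where
  "yamanouchi [] \<longleftrightarrow> True"
| "yamanouchi (k # w) \<longleftrightarrow> dominant (k # w) \<and> yamanouchi w"

lemma yamanouchi_dominant: "yamanouchi w \<Longrightarrow> dominant w"
  by (cases w) (auto simp: dominant_def)

text \<open>Fixing the first letter \<open>k\<close> of the leading word keeps the hypotheses for
  the tails: the one extra term of the operator changes \<open>k\<close> into a larger letter, and
  \<open>h\<close> vanishes on words above the leading one. Dominance of each suffix is then the
  statement for \<open>sl2\<close>.\<close>

lemma leading_word_yamanouchi: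
  assumes "\<And>a b y. 1 \<le> a \<Longrightarrow> a < b \<Longrightarrow> repl a b h y = 0"
    and "\<And>w. h w \<noteq> 0 \<Longrightarrow> mset w = A"
    and "h t \<noteq> 0" and "\<And>w. h w \<noteq> 0 \<Longrightarrow> w \<le> t"
  shows "yamanouchi t"
  using assms
proof (induction t arbitrary: h A)
  case (Cons k t)
  have "dominant (k # t)"
    unfolding dominant_def
  proof (intro allI impI)
    fix a b :: nat assume ab: "1 \<le> a" "a < b"
    have "count A b \<le> count A a"
      by (rule repl_kernel_count_le[where h = h and a = a and b = b and t = "k # t"])
        (use ab Cons.prems in \<open>auto simp flip: count_mset\<close>)
    then show "count_list (k # t) b \<le> count_list (k # t) a"
      unfolding Cons.prems(2)[OF Cons.prems(3), symmetric] count_mset .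
  qed
  moreover have "yamanouchi t"
  proof (rule Cons.IH)
    fix a b :: nat and y assume ab: "1 \<le> a" "a < b"
    have "h (b # y) = 0" if "k = a"
      using Cons.prems(4)[of "b # y"] ab that by auto
    then show "repl a b (\<lambda>w. h (k # w)) y = 0" using Cons.prems(1)[OF ab, of "k # y"]
      by (simp split: if_splits)
  next
    fix w assume "h (k # w) \<noteq> 0"
    then show "mset w = A - {#k#}" "w \<le> t" using Cons.prems(2)[of "k # w"] Cons.prems(4)[of "k # w"] by auto
  qed (use Cons.prems in auto)
  ultimately show ?case by simp
qed simp

text \<open>Equal letters are numbered from right to left, because the suffixes are the parts of a
  lattice word that are dominant.\<close>

fun ranks :: "nat list \<Rightarrow> nat list" where
  "ranks [] = []"
| "ranks (k # w) = count_list (k # w) k # ranks w"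

lemma length_ranks [simp]: "length (ranks w) = length w"
  by (induction w) auto

lemma count_zip_ranks:
  "count (mset (zip w (ranks w))) (k, v) = of_bool (1 \<le> v \<and> v \<le> count_list w k)"
  by (induction w) auto

lemma std_pairs_ranks: "std_pairs (mset (zip w (ranks w)))"
proof -
  have "image_mset fst (mset (zip w (ranks w))) = mset w" by (metis length_ranks map_fst_zip mset_map)
  then show ?thesis unfolding std_pairs_def count_zip_ranks by (simp add: count_mset)
qed

text \<open>The first letter \<open>k\<close> has rank \<open>Suc (count_list t k)\<close>. Another
  letter \<open>k'\<close> in its place must own this rank in the tail \<open>t\<close>, hence occur
  there more often than \<open>k\<close>, and a dominant tail allows this only for
  \<open>k' < k\<close>.\<close>

lemma yamanouchi_max:
  assumes "yamanouchi t" "0 \<notin> set t" "mset (zip t' (ranks t)) = mset (zip t (ranks t))"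
    "length t' = length t"
  shows "t' \<le> t"
  using assms
proof (induction t arbitrary: t')
  case (Cons k t)
  obtain k' s where t': "t' = k' # s" using Cons.prems(4) by (cases t') auto
  let ?v = "Suc (count_list t k)"
  show ?case
  proof (cases "k' = k")
    case True
    then show ?thesis using Cons t' by auto
  next
    case False
    have "(k', ?v) \<in># mset (zip (k # t) (ranks (k # t)))"
      unfolding Cons.prems(3)[symmetric] t' by simp
    then have "(k', ?v) \<in> set (zip t (ranks t))" using False by auto
    then have "count (mset (zip t (ranks t))) (k', ?v) \<noteq> 0" by (simp add: count_mset_0_iff)
    then have c: "?v \<le> count_list t k'" unfolding count_zip_ranks by (auto split: if_splits)
    have "k < k' \<Longrightarrow> count_list t k' \<le> count_list t k"
      using yamanouchi_dominant[of t] Cons.prems(1,2) by (auto simp: dominant_def)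
    then have "k' < k" using c False by (metis Suc_n_not_le_n le_trans linorder_cases)
    then show ?thesis using t' by simp
  qed
qed simp

text \<open>A nonzero coefficient makes the pairs standard, and the multiset of standard pairs
  depends only on the content of the word; so \<open>t'\<close> and \<open>t\<close> form the same
  pairs with the ranks.\<close>

lemma cw_ranks_leading:
  assumes "yamanouchi t" "0 \<notin> set t" "mset t' = mset t" "cw t' (ranks t) \<noteq> 0"
  shows "t' \<le> t"
proof (rule yamanouchi_max[OF assms(1,2)])
  show l: "length t' = length t" using assms(3) by (metis size_mset)
  have "std_pairs (mset (zip t' (ranks t)))" using assms(4) l cw_nonzero_iff[of t' "ranks t"] by simp
  then show "mset (zip t' (ranks t)) = mset (zip t (ranks t))"
    using count_zip_std[of t' "ranks t"] l assms(3) count_mset[of t] count_mset[of t']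
    by (intro multiset_eqI) (auto simp: count_zip_ranks)
qed

lemma cw_ranks_nonzero: "cw t (ranks t) \<noteq> 0"
  by (simp add: cw_nonzero_iff std_pairs_ranks)

text \<open>A nonzero term has a pair \<open>(b, v)\<close> at some position \<open>q\<close>. As
  \<open>a\<close> is at least as frequent as \<open>b\<close>, the value \<open>v\<close> also
  stands under some \<open>a\<close>, at \<open>r\<close>. Replacing at \<open>r\<close> instead of
  \<open>q\<close> gives the opposite term, and replacing anywhere else leaves the pair
  \<open>(a, v)\<close> twice, hence gives 0.\<close>

lemma cw_repl:
  assumes ab: "a \<noteq> b" and le: "count A b \<le> count A a" and len: "size A = length x"
  shows "repl a b (\<lambda>t. if mset t = A then cw t x else 0) y = 0"
proof -
  define h where "h t = (if mset t = A then cw t x else 0)" for t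
  let ?S = "{q. q < length y \<and> y ! q = a}"
  have "(\<Sum>q\<in>?S. h (y[q := b])) = 0"
  proof (cases "\<exists>q\<in>?S. h (y[q := b]) \<noteq> 0")
    case False
    then show ?thesis by (intro sum.neutral) auto
  next
    case True
    then obtain q where q: "q < length y" "y ! q = a" and nz: "h (y[q := b]) \<noteq> 0" by blast
    define t where "t = y[q := b]"
    have A: "mset t = A" and c: "cw t x \<noteq> 0" using nz by (auto simp: h_def t_def split: if_splits)
    have lt: "length t = length y" by (simp add: t_def)
    have lx: "length t = length x" using A len by (metis size_mset)
    have std: "std_pairs (mset (zip t x))" using c lx cw_nonzero_iff by blast
    define v where "v = x ! q"
    have "(b, v) \<in> set (zip t x)"
      unfolding in_set_zip using q lx lt by (intro exI[of _ q]) (simp add: t_def v_def)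
    then have "count (mset (zip t x)) (b, v) \<noteq> 0" by (simp add: count_mset_0_iff)
    then have v: "1 \<le> v" "v \<le> count_list t b" using count_zip_std[OF std lx] by (auto split: if_splits)
    have "count_list t b \<le> count_list t a" using le unfolding A[symmetric] count_mset .
    then have "count (mset (zip t x)) (a, v) = 1" using v count_zip_std[OF std lx] by simp
    then have "(a, v) \<in> set (zip t x)" by (metis count_mset_0_iff zero_neq_one)
    then obtain r where r: "r < length t" "t ! r = a" "x ! r = v" unfolding in_set_zip by auto
    have qr: "q \<noteq> r" using r q ab lt by (auto simp: t_def)
    have yr: "y ! r = a" using r qr by (simp add: t_def)
    have other: "h (y[p := b]) = 0" if "p \<in> ?S" "p \<noteq> q" "p \<noteq> r" for p
    proof (rule ccontr)
      assume "h (y[p := b]) \<noteq> 0"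
      then have "cw (y[p := b]) x \<noteq> 0" by (auto simp: h_def split: if_splits)
      then have "distinct (zip (y[p := b]) x)"
        using cw_nonzero_iff[of "y[p := b]" x] lx lt std_pairs_distinct by simp
      moreover have "zip (y[p := b]) x ! q = zip (y[p := b]) x ! r"
        using that q r qr yr lt lx by (simp add: v_def)
      ultimately show False
        using nth_eq_iff_index_eq[of "zip (y[p := b]) x" q r] qr q r lt lx by simp
    qed
    have "zip (y[r := b]) x = (zip t x)[q := zip t x ! r, r := zip t x ! q]"
    proof (rule nth_equalityI)
      fix i assume "i < length (zip (y[r := b]) x)"
      then show "zip (y[r := b]) x ! i = (zip t x)[q := zip t x ! r, r := zip t x ! q] ! i"
        using q r qr yr lt lx
        by (cases "i = q"; cases "i = r") (auto simp: t_def v_def nth_list_update)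
    qed (use lt lx in simp)
    then have "cw (y[r := b]) x = - cw t x"
      using alternates_swap_neq[OF pairs_sgn_alternates _ qr, of "zip t x"] q r lt lx
      by (simp add: cw_pairs_sgn)
    moreover have "mset (y[r := b]) = A"
    proof -
      have "mset (y[r := b]) = mset (y[q := b])"
        using q r yr lt by (simp add: mset_update)
      then show ?thesis using A by (simp add: t_def)
    qed
    ultimately have hr: "h (y[r := b]) = - h (y[q := b])" using A by (simp add: h_def t_def)
    have "(\<Sum>p\<in>?S. h (y[p := b])) = (\<Sum>p\<in>{q, r}. h (y[p := b]))"
      using q r yr lt other by (intro sum.mono_neutral_right) auto
    then show ?thesis using qr hr by simp
  qed
  then show ?thesis by (simp add: repl_sum h_def[abs_def])
qed

section \<open>Highest weight functions on tables\<close>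

text \<open>The coefficient of \<open>X\<close> in the vector attached to \<open>T\<close>, cleared
  of the denominator \<open>table_norm T\<close>.\<close>

definition CT :: "table \<Rightarrow> table \<Rightarrow> complex" where
  "CT T X = table_sign T * table_sgn T X"

lemma CT_prod_list: "length T = length X \<Longrightarrow> CT T X = prod_list (map2 cw T X)"
  unfolding CT_def table_sign_def table_sgn_def
  by (induction T X rule: list_induct2) (auto simp: cw_def algebra_simps)

lemma prod_list_nth: "prod_list (map2 f T X) = (\<Prod>l<length T. f (T ! l) (X ! l))"
  if "length T = length X" for f :: "'a \<Rightarrow> 'b \<Rightarrow> complex"
  using that
proof (induction T X rule: list_induct2)
  case (Cons x xs y ys)
  then show ?case by (simp add: lessThan_Suc_eq_insert_0 prod.reindex)
qed simp

lemma CT_prod: "length T = d \<Longrightarrow> length X = d \<Longrightarrow> CT T X = (\<Prod>l<d. cw (T ! l) (X ! l))"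
  by (simp add: CT_prod_list prod_list_nth)

lemma list_update_le_imp: "T[l := w] \<le> T \<Longrightarrow> l < length T \<Longrightarrow> w \<le> T ! l" for T :: "'a::linorder list"
proof (induction T arbitrary: l)
  case (Cons t T)
  then show ?case by (cases l) auto
qed simp

lemma pointwise_le_imp_le:
  fixes T T' :: "'a::linorder list"
  assumes "length T' = length T" "\<And>l. l < length T \<Longrightarrow> T' ! l \<le> T ! l"
  shows "T' \<le> T"
  using assms
proof (induction T' T rule: list_induct2)
  case (Cons x xs y ys)
  have "x \<le> y" using Cons.prems[of 0] by simp
  moreover have "xs \<le> ys" using Cons.prems[of "Suc _"] by (intro Cons.IH) auto
  ultimately show ?case by auto
qed simp

text \<open>Triangular elimination. The largest table \<open>T0\<close> of the support has lattice
  rows, and the column indexed by \<open>map ranks T0\<close> has the same largest table, so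
  subtracting a multiple removes \<open>T0\<close> and adds nothing above it. Dominance of
  \<open>A l\<close>, read off from the rows of \<open>T0\<close>, makes this column itself a
  highest weight function, so the difference is one again.\<close>

lemma hw_function_span:
  fixes h :: "table \<Rightarrow> complex" and A :: "nat \<Rightarrow> nat multiset" and d :: nat
  defines "W \<equiv> {T. length T = d \<and> (\<forall>l<d. mset (T ! l) = A l)}"
  assumes "\<And>T. h T \<noteq> 0 \<Longrightarrow> T \<in> W"
    and pos: "\<And>l. l < d \<Longrightarrow> 0 \<notin># A l"
    and "\<And>l T a b y. l < d \<Longrightarrow> length T = d \<Longrightarrow> 1 \<le> a \<Longrightarrow> a < b \<Longrightarrow>
      repl a b (\<lambda>w. h (T[l := w])) y = 0"
    and XS: "finite XS" "map ranks ` W \<subseteq> XS"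
  shows "\<exists>g. \<forall>T. h T = (\<Sum>X\<in>XS. g X * (if T \<in> W then CT T X else 0))"
proof -
  have finW: "finite W"
  proof -
    have fin: "finite {w. mset w = A l}" for l
    proof (cases "\<exists>x. mset x = A l")
      case True
      then show ?thesis using mset_eq_finite by metis
    qed simp
    have "W \<subseteq> {T. set T \<subseteq> (\<Union>l<d. {w. mset w = A l}) \<and> length T = d}"
      by (fastforce simp: W_def in_set_conv_nth)
    moreover have "finite \<dots>" by (rule finite_lists_length_eq) (use fin in auto)
    ultimately show ?thesis by (rule finite_subset)
  qed
  \<comment> \<open>The number of tables at or below the support. It drops because after the
    subtraction the support lies strictly below \<open>T0\<close>, so that \<open>T0\<close> itself
    is no longer counted.\<close>
  define M where "M h = card {T\<in>W. \<exists>T'. h T' \<noteq> (0::complex) \<and> T \<le> T'}" for h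
  show ?thesis
    using assms(2,4)
  proof (induction "M h" arbitrary: h rule: less_induct)
    case less
    show ?case
    proof (cases "\<exists>T. h T \<noteq> 0")
      case False
      then show ?thesis by (intro exI[of _ "\<lambda>X. 0"]) auto
    next
      case True
      let ?S = "{T. h T \<noteq> 0}"
      have finS: "finite ?S" using less.prems(1) by (intro finite_subset[OF _ finW]) auto
      define T0 where "T0 = Max ?S"
      have T0: "h T0 \<noteq> 0" using Max_in[OF finS] True by (auto simp: T0_def)
      have T0_max: "T \<le> T0" if "h T \<noteq> 0" for T using Max_ge[OF finS] that by (auto simp: T0_def)
      have T0W: "T0 \<in> W" using less.prems(1) T0 by blast
      then have len0: "length T0 = d" and mset0: "\<And>l. l < d \<Longrightarrow> mset (T0 ! l) = A l"
        by (auto simp: W_def)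
      have yam: "yamanouchi (T0 ! l)" if l: "l < d" for l
      proof (rule leading_word_yamanouchi[where h = "\<lambda>w. h (T0[l := w])" and A = "A l"])
        show "repl a b (\<lambda>w. h (T0[l := w])) y = 0" if "1 \<le> a" "a < b" for a b y
          using less.prems(2)[OF l len0 that] .
        show "mset w = A l" if "h (T0[l := w]) \<noteq> 0" for w
          using less.prems(1)[OF that] l len0 by (auto simp: W_def)
        show "h (T0[l := T0 ! l]) \<noteq> 0" using T0 by simp
        show "w \<le> T0 ! l" if "h (T0[l := w]) \<noteq> 0" for w
          using list_update_le_imp[OF T0_max[OF that]] l len0 by simp
      qed
      define X0 where "X0 = map ranks T0"
      define K where "K X T = (if T \<in> W then CT T X else 0)" for X T
      have X0: "X0 \<in> XS" using XS T0W by (auto simp: X0_def)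
      have lenX0: "length X0 = d" using len0 by (simp add: X0_def)
      have X0_nth: "X0 ! l = ranks (T0 ! l)" if "l < d" for l using that len0 by (simp add: X0_def)
      have c0: "K X0 T0 \<noteq> 0"
        using T0W CT_prod[OF len0 lenX0] X0_nth cw_ranks_nonzero by (simp add: K_def)
      define h' where "h' T = h T + (- h T0 / K X0 T0) * K X0 T" for T
      have K_supp: "T \<le> T0" if "K X0 T \<noteq> 0" for T
      proof (rule pointwise_le_imp_le)
        have W: "T \<in> W" and nz: "CT T X0 \<noteq> 0" using that by (auto simp: K_def split: if_splits)
        show len: "length T = length T0" using W len0 by (simp add: W_def)
        fix l assume "l < length T0"
        then have l: "l < d" using len0 by simp
        have "cw (T ! l) (ranks (T0 ! l)) \<noteq> 0"
          using nz CT_prod[of T d X0] len len0 lenX0 l X0_nth by auto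
        then show "T ! l \<le> T0 ! l"
          using cw_ranks_leading[OF yam[OF l]] pos[OF l] mset0[OF l] W l
          by (metis (mono_tags, lifting) W_def mem_Collect_eq set_mset_mset)
      qed
      have K_hw: "repl a b (\<lambda>w. K X0 (T[l := w])) y = 0"
        if l: "l < d" and T: "length T = d" and ab: "1 \<le> a" "a < b" for l T a b y
      proof -
        \<comment> \<open>Only row \<open>l\<close> varies; the other rows contribute a constant,
          which is 0 if one of them has the wrong content.\<close>
        define C where "C = (if \<forall>l'<d. l' \<noteq> l \<longrightarrow> mset (T ! l') = A l'
          then \<Prod>l'\<in>{..<d} - {l}. cw (T ! l') (X0 ! l') else 0)"
        have "K X0 (T[l := w]) = C * (if mset w = A l then cw w (X0 ! l) else 0)" for w
        proof -
          have W_iff: "T[l := w] \<in> W \<longleftrightarrow> mset w = A l \<and> (\<forall>l'<d. l' \<noteq> l \<longrightarrow> mset (T ! l') = A l')"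
            using l T by (auto simp: W_def nth_list_update)
          have "CT (T[l := w]) X0 = (\<Prod>l'<d. cw (T[l := w] ! l') (X0 ! l'))"
            by (rule CT_prod) (use T lenX0 in auto)
          also have "\<dots> = cw w (X0 ! l) * (\<Prod>l'\<in>{..<d} - {l}. cw (T ! l') (X0 ! l'))"
            using l T by (subst prod.remove[of _ l]) (auto intro!: prod.cong)
          finally show ?thesis using W_iff by (auto simp: K_def C_def)
        qed
        moreover have "repl a b (\<lambda>w. if mset w = A l then cw w (X0 ! l) else 0) y = 0"
        proof (rule cw_repl)
          show "count (A l) b \<le> count (A l) a"
            using yamanouchi_dominant[OF yam[OF l]] ab mset0[OF l]
            unfolding dominant_def by (metis count_mset)
          show "size (A l) = length (X0 ! l)" using mset0[OF l] X0_nth[OF l] by (metis length_ranks size_mset)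
        qed (use ab in auto)
        ultimately show ?thesis by (simp add: repl_mult)
      qed
      have h'_supp: "T \<in> W" if "h' T \<noteq> 0" for T
      proof (rule ccontr)
        assume "T \<notin> W"
        then have "h T = 0" "K X0 T = 0" using less.prems(1) by (auto simp: K_def)
        then show False using that by (simp add: h'_def)
      qed
      have h'_le: "T < T0" if "h' T \<noteq> 0" for T
      proof -
        have "T \<noteq> T0" using that c0 by (auto simp: h'_def)
        moreover have "T \<le> T0" using that T0_max K_supp by (cases "h T = 0") (auto simp: h'_def)
        ultimately show ?thesis by simp
      qed
      have "M h' < M h"
        unfolding M_def
      proof (rule psubset_card_mono)
        show "{T\<in>W. \<exists>T'. h' T' \<noteq> 0 \<and> T \<le> T'} \<subset> {T\<in>W. \<exists>T'. h T' \<noteq> 0 \<and> T \<le> T'}"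
        proof
          show "{T\<in>W. \<exists>T'. h' T' \<noteq> 0 \<and> T \<le> T'} \<subseteq> {T\<in>W. \<exists>T'. h T' \<noteq> 0 \<and> T \<le> T'}"
            using h'_le T0 by (auto intro!: exI[of _ T0] dest: le_less_trans less_imp_le)
          have "T0 \<in> {T\<in>W. \<exists>T'. h T' \<noteq> 0 \<and> T \<le> T'}" using T0 T0W by auto
          moreover have "T0 \<notin> {T\<in>W. \<exists>T'. h' T' \<noteq> 0 \<and> T \<le> T'}" using h'_le by fastforce
          ultimately show "{T\<in>W. \<exists>T'. h' T' \<noteq> 0 \<and> T \<le> T'} \<noteq> {T\<in>W. \<exists>T'. h T' \<noteq> 0 \<and> T \<le> T'}"
            by blast
        qed
      qed (use finW in simp)
      then obtain g where g: "h' T = (\<Sum>X\<in>XS. g X * (if T \<in> W then CT T X else 0))" for T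
      proof (rule less.hyps[THEN exE])
        show "repl a b (\<lambda>w. h' (T[l := w])) y = 0"
          if "l < d" "length T = d" "1 \<le> a" "a < b" for l T a b y
          unfolding h'_def repl_add repl_mult using less.prems(2)[OF that] K_hw[OF that] by simp
      qed (use h'_supp in blast)+
      define g' where "g' X = g X + (if X = X0 then h T0 / K X0 T0 else 0)" for X
      have "h T = (\<Sum>X\<in>XS. g' X * K X T)" for T
      proof -
        have "h T = h' T + h T0 / K X0 T0 * K X0 T" by (simp add: h'_def)
        also have "\<dots> = (\<Sum>X\<in>XS. g X * K X T) + (\<Sum>X\<in>XS. (if X = X0 then h T0 / K X0 T0 else 0) * K X T)"
          using X0 XS(1) unfolding g K_def[symmetric] by (simp add: if_distrib[of "\<lambda>x. x * _"] cong: if_cong)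
        finally show ?thesis by (simp add: g'_def distrib_right sum.distrib)
      qed
      then show ?thesis unfolding K_def by blast
    qed
  qed
qed

section \<open>Column permutations\<close>

lemma perm_eps_eq:
  assumes "p permutes {..<m}"
  shows "perm_eps (- 1) m p = (if distinct (permute_list p [0..<m]) then (- 1) ^ inv_count (permute_list p [0..<m]) else 0)"
proof -
  have "p i < m" if "i < m" for i using permutes_in_image[OF assms, of i] that by simp
  then have "permute_list p [0..<m] = map p [0..<m]" by (auto simp: permute_list_def)
  moreover have "distinct (permute_list p [0..<m])" using assms by simp
  ultimately show ?thesis by (simp add: perm_eps_def)
qed

definition lsgn :: "'a::linorder list \<Rightarrow> complex" where
  "lsgn xs = (if distinct xs then (- 1) ^ inv_count xs else 0)"

lemma lsgn_alternates: "alternates (- 1) lsgn"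
proof -
  have *: "distinct xs \<longleftrightarrow> (\<forall>a. count (mset xs) a \<le> 1)" for xs :: "'a list"
  proof -
    have "(count (mset xs) a = (if a \<in> set xs then 1 else 0)) \<longleftrightarrow> count (mset xs) a \<le> 1" for a
    proof (cases "a \<in> set xs")
      case True
      then have "count (mset xs) a \<noteq> 0" by (metis count_mset_0_iff)
      with True show ?thesis by (simp only: if_True) presburger
    next
      case False
      then have z: "count (mset xs) a = 0" by (metis count_mset_0_iff)
      show ?thesis unfolding z using False by simp
    qed
    then show ?thesis unfolding distinct_count_atmost_1 by simp
  qed
  show ?thesis
    unfolding lsgn_def[abs_def] *
    by (rule alternates_inv_count[of "\<lambda>M. \<forall>a. count M a \<le> 1"]) (rule iffD2[OF *])
qed

lemma inv_count_sorted: "sorted xs \<Longrightarrow> inv_count xs = 0"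
  by (induction xs) (auto simp: filter_empty_conv)

lemma lsgn_sorted: "sorted xs \<Longrightarrow> distinct xs \<Longrightarrow> lsgn xs = 1"
  by (simp add: lsgn_def inv_count_sorted)

lemma perm_eps_lsgn: "p permutes {..<m} \<Longrightarrow> perm_eps (- 1) m p = lsgn (permute_list p [0..<m])"
  by (simp add: perm_eps_eq lsgn_def)

text \<open>Multiplicativity of the sign comes from alternation of \<open>lsgn\<close>, applied to
  the list of values of \<open>p\<close>.\<close>

lemma perm_eps_compose:
  assumes "s = 1 \<or> s = - 1" "p permutes {..<m}" "q permutes {..<m}"
  shows "perm_eps s m (p \<circ> q) = perm_eps s m p * perm_eps s m q"
proof (cases "s = 1")
  case False
  then have s: "s = - 1" using assms(1) by simp
  have "perm_eps (- 1) m (p \<circ> q) = lsgn (permute_list q (permute_list p [0..<m]))"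
    using assms by (subst perm_eps_lsgn) (auto intro: permutes_compose simp: permute_list_compose)
  also have "\<dots> = perm_eps (- 1) (length (permute_list p [0..<m])) q * lsgn (permute_list p [0..<m])"
    by (rule alternates_permute_list[OF lsgn_alternates]) (use assms in simp)
  finally show ?thesis using assms(2) by (simp add: s perm_eps_lsgn)
qed simp

lemma perm_eps_id [simp]: "perm_eps s m id = 1"
  by (simp add: perm_eps_def inv_count_sorted)

lemma perm_eps_sq: "s = 1 \<or> s = - 1 \<Longrightarrow> perm_eps s m p * perm_eps s m p = 1"
  by (auto simp: perm_eps_def power_mult_distrib[symmetric])

lemma permute_list_transpose:
  assumes "i < length xs" "j < length xs"
  shows "permute_list (swap i j) xs = xs[i := xs ! j, j := xs ! i]"
  using assms
  by (intro nth_equalityI) (auto simp: permute_list_def nth_list_update Transposition.transpose_def)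

lemma perm_eps_transpose:
  assumes "s = 1 \<or> s = - 1" "i \<noteq> j" "i < m" "j < m"
  shows "perm_eps s m (swap i j) = s"
proof (cases "s = 1")
  case False
  then have s: "s = - 1" using assms(1) by simp
  have p: "swap i j permutes {..<m}" using assms by (intro permutes_swap_id) auto
  have "perm_eps (- 1) m (swap i j) = lsgn ([0..<m][i := [0..<m] ! j, j := [0..<m] ! i])"
    unfolding perm_eps_lsgn[OF p] using assms by (subst permute_list_transpose) auto
  also have "\<dots> = - 1 * lsgn [0..<m]"
    by (rule alternates_swap_neq[OF lsgn_alternates]) (use assms in auto)
  finally show ?thesis by (simp add: s lsgn_sorted)
qed simp

lemma alternatesI_permute:
  fixes G :: "'a list \<Rightarrow> complex"
  assumes s: "s = 1 \<or> s = - 1"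
    and G: "\<And>p xs. p permutes {..<length xs} \<Longrightarrow> G (permute_list p xs) = perm_eps s (length xs) p * G xs"
  shows "alternates s G"
  unfolding alternates_def
proof (intro allI)
  fix xs ys :: "'a list" and a b
  let ?l = "xs @ b # a # ys" and ?t = "swap (length xs) (Suc (length xs))"
  have p: "?t permutes {..<length ?l}" by (intro permutes_swap_id) auto
  have "permute_list ?t ?l = xs @ a # b # ys"
    by (subst permute_list_transpose) (auto simp: nth_append list_update_append)
  moreover have "perm_eps s (length ?l) ?t = s" by (rule perm_eps_transpose[OF s]) auto
  ultimately show "G (xs @ a # b # ys) = s * G (xs @ b # a # ys)" using G[OF p] by simp
qed

definition rect :: "nat \<Rightarrow> nat \<Rightarrow> 'a list list \<Rightarrow> bool" where
  "rect d m T \<longleftrightarrow> length T = d \<and> (\<forall>r\<in>set T. length r = m)"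

abbreviation pcol :: "(nat \<Rightarrow> nat) \<Rightarrow> 'a list list \<Rightarrow> 'a list list" where
  "pcol p T \<equiv> map (permute_list p) T"

lemma rect_pcol [simp]: "rect d m (pcol p T) \<longleftrightarrow> rect d m T"
  by (auto simp: rect_def)

text \<open>Each of the \<open>d\<close> rows contributes the sign of \<open>p\<close> once.\<close>

lemma CT_pcol:
  assumes "p permutes {..<m}" "rect d m T" "rect d m X"
  shows "CT (pcol p T) (pcol p X) = perm_eps ((- 1) ^ d) m p * CT T X"
proof -
  have "CT (pcol p T) (pcol p X) = (\<Prod>l<d. cw (pcol p T ! l) (pcol p X ! l))"
    using assms by (intro CT_prod) (auto simp: rect_def)
  also have "\<dots> = (\<Prod>l<d. perm_eps (- 1) m p * cw (T ! l) (X ! l))"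
    using assms by (intro prod.cong refl) (auto simp: rect_def cw_permute_list)
  also have "\<dots> = perm_eps ((- 1) ^ d) m p * CT T X"
    using assms by (simp add: CT_prod[of T d X] rect_def prod.distrib perm_eps_power)
  finally show ?thesis .
qed

lemma pcol_compose:
  assumes "q permutes {..<m}" "rect d m X"
  shows "pcol q (pcol p X) = pcol (p \<circ> q) X"
  using assms by (auto simp: rect_def permute_list_compose)

lemma pcol_id: "rect d m X \<Longrightarrow> pcol id X = X"
  by (simp add: map_idI)

text \<open>\<open>G\<close> is the average of \<open>g\<close> over the column permutations against
  the character of \<open>s2\<close>. It still represents \<open>h\<close>: permuting
  \<open>T\<close> and \<open>X\<close> together changes \<open>CT\<close> by the character of
  \<open>(- 1) ^ d = s1 * s2\<close>, while \<open>h\<close> changes by that of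
  \<open>s1\<close>.\<close>

lemma symmetrize:
  assumes s: "s1 = 1 \<or> s1 = - 1" "s2 = 1 \<or> s2 = - 1" "s1 * s2 = (- 1) ^ d"
    and XS: "finite XS" "\<And>X. X \<in> XS \<Longrightarrow> rect d m X"
      "\<And>X p. X \<in> XS \<Longrightarrow> p permutes {..<m} \<Longrightarrow> pcol p X \<in> XS"
    and W: "\<And>T. T \<in> W \<Longrightarrow> rect d m T" "\<And>T p. T \<in> W \<Longrightarrow> p permutes {..<m} \<Longrightarrow> pcol p T \<in> W"
    and h: "\<And>T. T \<in> W \<Longrightarrow> h T = (\<Sum>X\<in>XS. g X * CT T X)"
      "\<And>T p. T \<in> W \<Longrightarrow> p permutes {..<m} \<Longrightarrow> h (pcol p T) = perm_eps s1 m p * h T"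
  obtains G where "\<And>X p. rect d m X \<Longrightarrow> p permutes {..<m} \<Longrightarrow> G (pcol p X) = perm_eps s2 m p * G X"
    and "\<And>T. T \<in> W \<Longrightarrow> h T = (\<Sum>X\<in>XS. G X * CT T X)"
proof
  let ?P = "{p. p permutes {..<m}}"
  define G where "G X = (\<Sum>p\<in>?P. perm_eps s2 m p * g (pcol p X)) / of_nat (fact m)" for X
  have finP: "finite ?P" by (simp add: finite_permutations)
  have cardP: "card ?P = fact m" by (simp add: card_permutations[of "{..<m}" m])
  show "G (pcol q X) = perm_eps s2 m q * G X" if X: "rect d m X" and q: "q permutes {..<m}" for X q
  proof -
    have "(\<Sum>p\<in>?P. perm_eps s2 m p * g (pcol p (pcol q X))) =
        (\<Sum>p\<in>?P. perm_eps s2 m q * (perm_eps s2 m (q \<circ> p) * g (pcol (q \<circ> p) X)))"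
    proof (rule sum.cong[OF refl])
      fix p assume "p \<in> ?P"
      then have p: "p permutes {..<m}" by simp
      have "perm_eps s2 m p = perm_eps s2 m q * perm_eps s2 m (q \<circ> p)"
        unfolding perm_eps_compose[OF s(2) q p] mult.assoc[symmetric] perm_eps_sq[OF s(2)] by simp
      then show "perm_eps s2 m p * g (pcol p (pcol q X)) =
          perm_eps s2 m q * (perm_eps s2 m (q \<circ> p) * g (pcol (q \<circ> p) X))"
        unfolding pcol_compose[OF p X] by simp
    qed
    also have "\<dots> = perm_eps s2 m q * (\<Sum>p\<in>?P. perm_eps s2 m (q \<circ> p) * g (pcol (q \<circ> p) X))"
      by (rule sum_distrib_left[symmetric])
    also have "(\<Sum>p\<in>?P. perm_eps s2 m (q \<circ> p) * g (pcol (q \<circ> p) X)) = (\<Sum>p\<in>?P. perm_eps s2 m p * g (pcol p X))"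
      by (rule setum_permutations_compose_left[OF q, symmetric])
    finally show ?thesis by (simp add: G_def)
  qed
  show "h T = (\<Sum>X\<in>XS. G X * CT T X)" if T: "T \<in> W" for T
  proof -
    have "of_nat (fact m) * h T = (\<Sum>p\<in>?P. h T)" using cardP by simp
    also have "\<dots> = (\<Sum>p\<in>?P. \<Sum>X\<in>XS. perm_eps s2 m p * g (pcol p X) * CT T X)"
    proof (rule sum.cong[OF refl])
      fix p assume "p \<in> ?P"
      then have p: "p permutes {..<m}" by simp
      have e: "perm_eps s1 m p * perm_eps ((- 1) ^ d) m p = perm_eps s2 m p"
        unfolding s(3)[symmetric] perm_eps_mult mult.assoc[symmetric] perm_eps_sq[OF s(1)] by simp
      have "h T = perm_eps s1 m p * h (pcol p T)"
        unfolding h(2)[OF T p] mult.assoc[symmetric] perm_eps_sq[OF s(1)] by simp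
      also have "h (pcol p T) = (\<Sum>X\<in>XS. g X * CT (pcol p T) X)" by (rule h(1)[OF W(2)[OF T p]])
      also have "\<dots> = (\<Sum>X\<in>XS. g (pcol p X) * CT (pcol p T) (pcol p X))"
      proof (rule sum.reindex_bij_witness[of _ "pcol p" "pcol (inv p)"])
        fix X assume X: "X \<in> XS"
        have ip: "inv p permutes {..<m}" by (rule permutes_inv[OF p])
        show "pcol p (pcol (inv p) X) = X"
          by (simp only: pcol_compose[OF p XS(2)[OF X]] permutes_inv_o[OF p] pcol_id[OF XS(2)[OF X]])
        show "pcol (inv p) (pcol p X) = X"
          by (simp only: pcol_compose[OF ip XS(2)[OF X]] permutes_inv_o[OF p] pcol_id[OF XS(2)[OF X]])
        show "pcol (inv p) X \<in> XS" "pcol p X \<in> XS" using XS(3)[OF X] p ip by auto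
        show "g (pcol p (pcol (inv p) X)) * CT (pcol p T) (pcol p (pcol (inv p) X)) =
          g X * CT (pcol p T) X"
          by (simp only: pcol_compose[OF p XS(2)[OF X]] permutes_inv_o[OF p] pcol_id[OF XS(2)[OF X]])
      qed
      also have "\<dots> = (\<Sum>X\<in>XS. g (pcol p X) * (perm_eps ((- 1) ^ d) m p * CT T X))"
        using CT_pcol[OF p W(1)[OF T] XS(2)] by (intro sum.cong) auto
      finally show "h T = (\<Sum>X\<in>XS. perm_eps s2 m p * g (pcol p X) * CT T X)"
        unfolding e[symmetric] by (simp add: sum_distrib_left ac_simps)
    qed
    also have "\<dots> = (\<Sum>X\<in>XS. \<Sum>p\<in>?P. perm_eps s2 m p * g (pcol p X) * CT T X)" by (rule sum.swap)
    also have "\<dots> = of_nat (fact m) * (\<Sum>X\<in>XS. G X * CT T X)"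
    proof -
      have "(\<Sum>p\<in>?P. perm_eps s2 m p * g (pcol p X) * CT T X) = of_nat (fact m) * (G X * CT T X)" for X
        by (simp add: G_def sum_distrib_right)
      then show ?thesis by (simp add: sum_distrib_left)
    qed
    finally show ?thesis by simp
  qed
qed

section \<open>Rows and columns\<close>

text \<open>The inverse of forming columns. The number of rows is an argument because an empty list
  of columns does not reveal it.\<close>

definition tab :: "nat \<Rightarrow> 'a list list \<Rightarrow> 'a list list" where
  "tab d cs = map (\<lambda>l. map (\<lambda>c. c ! l) cs) [0..<d]"

lemma rect_tab: "rect d (length cs) (tab d cs)"
  by (auto simp: rect_def tab_def)

lemma rect_nth: "rect d m T \<Longrightarrow> l < d \<Longrightarrow> length (T ! l) = m"
  by (auto simp: rect_def)

lemma rect_length: "rect d m T \<Longrightarrow> length T = d"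
  by (simp add: rect_def)

lemma transpose_rect:
  assumes "rect d m T" "1 \<le> d"
  shows "cols T = map (\<lambda>q. map (\<lambda>r. r ! q) T) [0..<m]"
proof -
  have "cols T = map (\<lambda>i. map (\<lambda>j. T ! j ! i) [0..<length T]) [0..<m]"
    using assms by (intro transpose_rectangle) (auto simp: rect_def)
  moreover have "map (\<lambda>j. T ! j ! i) [0..<length T] = map (\<lambda>r. r ! i) T" for i
    by (intro nth_equalityI) auto
  ultimately show ?thesis by simp
qed

lemma length_transpose_rect: "rect d m T \<Longrightarrow> 1 \<le> d \<Longrightarrow> length (cols T) = m"
  by (simp add: transpose_rect)

lemma transpose_nth_nth:
  "rect d m T \<Longrightarrow> 1 \<le> d \<Longrightarrow> q < m \<Longrightarrow> l < d \<Longrightarrow> cols T ! q ! l = T ! l ! q"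
  by (simp add: transpose_rect rect_length)

lemma length_column: "rect d m T \<Longrightarrow> 1 \<le> d \<Longrightarrow> c \<in> set (cols T) \<Longrightarrow> length c = d"
  by (auto simp: transpose_rect rect_length)

lemma tab_transpose: "rect d m T \<Longrightarrow> 1 \<le> d \<Longrightarrow> tab d (cols T) = T"
  by (intro nth_equalityI) (auto simp: tab_def transpose_rect rect_length rect_nth)

lemma transpose_tab:
  assumes "\<And>c. c \<in> set cs \<Longrightarrow> length c = d" "1 \<le> d"
  shows "cols (tab d cs) = cs"
  unfolding transpose_rect[OF rect_tab assms(2)] using assms(1)
  by (intro nth_equalityI) (auto simp: tab_def intro!: nth_equalityI)

lemma transpose_pcol:
  assumes "rect d m T" "1 \<le> d" "p permutes {..<m}"
  shows "cols (pcol p T) = permute_list p (cols T)"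
proof -
  have pm: "p i < m" if "i < m" for i using permutes_in_image[OF assms(3), of i] that by simp
  have "rect d m (pcol p T)" using assms by simp
  then show ?thesis
    using assms(1,2) pm
    by (intro nth_equalityI)
      (auto simp: transpose_rect rect_length rect_nth permute_list_def)
qed

lemma tab_permute_list:
  assumes "p permutes {..<length cs}"
  shows "tab d (permute_list p cs) = pcol p (tab d cs)"
  unfolding tab_def map_map o_def permute_list_map[OF assms] ..

definition row_tables :: "nat \<Rightarrow> nat \<Rightarrow> nat \<Rightarrow> table set" where
  "row_tables n d m = {X. length X = d \<and> set X \<subseteq> indices n m}"

lemma row_tables_rect: "X \<in> row_tables n d m \<Longrightarrow> rect d m X"
  by (auto simp: row_tables_def rect_def indices_def)

lemma finite_indices: "finite (indices n d)"
proof -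
  have "indices n d = {c. set c \<subseteq> {1..n} \<and> length c = d}" by (auto simp: indices_def)
  then show ?thesis by (simp add: finite_lists_length_eq)
qed

lemma finite_row_tables: "finite (row_tables n d m)"
proof -
  have "row_tables n d m = {X. set X \<subseteq> indices n m \<and> length X = d}" by (auto simp: row_tables_def)
  then show ?thesis by (simp add: finite_lists_length_eq finite_indices)
qed

lemma listset_nth: "listset As = {xs. length xs = length As \<and> (\<forall>i<length As. xs ! i \<in> As ! i)}"
proof (induction As)
  case (Cons A As)
  show ?case
    unfolding listset.simps set_Cons_def Cons
    by (auto simp: All_less_Suc2 length_Suc_conv)
qed auto

lemma same_shape_rect: "rect d m T \<Longrightarrow> same_shape n T = row_tables n d m"
  unfolding same_shape_def listset_nth row_tables_def
  by (auto simp: rect_length rect_nth in_set_conv_nth subset_iff)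

lemma pcol_row_tables:
  "X \<in> row_tables n d m \<Longrightarrow> p permutes {..<m} \<Longrightarrow> pcol p X \<in> row_tables n d m"
  by (auto simp: row_tables_def indices_def subset_iff)

lemma row_tables_reindex:
  assumes p: "p permutes {..<m}"
  shows "(\<Sum>X\<in>row_tables n d m. f (pcol p X)) = (\<Sum>X\<in>row_tables n d m. f X)"
proof (rule sum.reindex_bij_witness[of _ "pcol (inv p)" "pcol p"])
  fix X assume X: "X \<in> row_tables n d m"
  note r = row_tables_rect[OF X]
  have ip: "inv p permutes {..<m}" by (rule permutes_inv[OF p])
  show "pcol p (pcol (inv p) X) = X"
    by (simp only: pcol_compose[OF p r] permutes_inv_o[OF p] pcol_id[OF r])
  show "pcol (inv p) (pcol p X) = X"
    by (simp only: pcol_compose[OF ip r] permutes_inv_o[OF p] pcol_id[OF r])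
  show "pcol (inv p) X \<in> row_tables n d m" "pcol p X \<in> row_tables n d m"
    using pcol_row_tables[OF X] p ip by auto
  show "f (pcol p X) = f (pcol p X)" ..
qed

text \<open>Coefficients are products over rows, whereas products in the algebras run over columns;
  this bijection passes between the two descriptions.\<close>

lemma transpose_row_tables:
  assumes "1 \<le> d"
  shows "bij_betw cols (row_tables n d m) {cs. length cs = m \<and> set cs \<subseteq> indices n d}"
proof (rule bij_betw_byWitness[where f' = "tab d"])
  show "\<forall>X\<in>row_tables n d m. tab d (cols X) = X"
    using tab_transpose[OF row_tables_rect assms] by blast
  show "\<forall>cs\<in>{cs. length cs = m \<and> set cs \<subseteq> indices n d}. cols (tab d cs) = cs"
    using transpose_tab[OF _ assms] by (auto simp: indices_def)
  show "cols ` row_tables n d m \<subseteq> {cs. length cs = m \<and> set cs \<subseteq> indices n d}"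
  proof safe
    fix X assume X: "X \<in> row_tables n d m"
    note r = row_tables_rect[OF X]
    show "length (cols X) = m" by (rule length_transpose_rect[OF r assms])
    fix c assume c: "c \<in> set (cols X)"
    then obtain q where q: "q < m" "c = map (\<lambda>r. r ! q) X"
      unfolding transpose_rect[OF r assms] by auto
    have "r ! q \<in> {1..n}" if "r \<in> set X" for r
    proof -
      have "length r = m" "set r \<subseteq> {1..n}" using X that by (auto simp: row_tables_def indices_def)
      then show ?thesis using q nth_mem by blast
    qed
    then show "c \<in> indices n d" using q r by (auto simp: indices_def rect_def)
  qed
  show "tab d ` {cs. length cs = m \<and> set cs \<subseteq> indices n d} \<subseteq> row_tables n d m"
  proof (clarsimp simp: row_tables_def tab_def indices_def, intro conjI)
    fix cs :: "nat list list" and l i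
    assume cs: "set cs \<subseteq> {c. length c = d \<and> set c \<subseteq> {Suc 0..n}}" and l: "l < d"
    fix c assume "c \<in> set cs"
    then have "length c = d" "set c \<subseteq> {Suc 0..n}" using cs by auto
    then have "c ! l \<in> {Suc 0..n}" using l nth_mem by blast
    then show "Suc 0 \<le> c ! l" "c ! l \<le> n" by auto
  qed
qed

section \<open>Linear functionals on finitely supported functions\<close>

definition fn :: "('k \<Rightarrow> complex) \<Rightarrow> ('k \<Rightarrow>\<^sub>0 complex) \<Rightarrow> complex" where
  "fn \<theta> p = (\<Sum>K\<in>keys p. lookup p K * \<theta> K)"

lemma fn_superset:
  "finite S \<Longrightarrow> keys p \<subseteq> S \<Longrightarrow> fn \<theta> p = (\<Sum>K\<in>S. lookup p K * \<theta> K)"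
  unfolding fn_def by (rule sum.mono_neutral_left) (auto simp: in_keys_iff)

lemma fn_add: "fn \<theta> (p + q) = fn \<theta> p + fn \<theta> q"
proof -
  let ?S = "keys p \<union> keys q"
  have "keys (p + q) \<subseteq> ?S" by (rule Poly_Mapping.keys_add)
  then show ?thesis
    by (simp add: fn_superset[of ?S] lookup_add distrib_right sum.distrib)
qed

lemma fn_scale: "fn \<theta> (cscale c p) = c * fn \<theta> p"
proof -
  have "keys (cscale c p) \<subseteq> keys p" by (auto simp: in_keys_iff)
  then show ?thesis
    by (simp add: fn_superset[of "keys p"] sum_distrib_left mult.assoc)
qed

lemma fn_zero [simp]: "fn \<theta> 0 = 0"
  by (simp add: fn_def)

lemma fn_sum: "fn \<theta> (\<Sum>i\<in>I. p i) = (\<Sum>i\<in>I. fn \<theta> (p i))"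
  by (induction I rule: infinite_finite_induct) (auto simp: fn_add)

lemma fn_single: "fn \<theta> (single K c) = c * \<theta> K"
  by (simp add: fn_superset[of "{K}"])

definition lin :: "('k \<Rightarrow> ('h \<Rightarrow>\<^sub>0 complex)) \<Rightarrow> ('k \<Rightarrow>\<^sub>0 complex) \<Rightarrow> ('h \<Rightarrow>\<^sub>0 complex)" where
  "lin \<theta> p = (\<Sum>K\<in>keys p. cscale (lookup p K) (\<theta> K))"

lemma lookup_lin: "lookup (lin \<theta> p) L = fn (\<lambda>K. lookup (\<theta> K) L) p"
  by (simp add: lin_def fn_def lookup_sum)

lemma linearI_cscale:
  assumes "\<And>p q. D (p + q) = D p + D q" "\<And>c p. D (cscale c p) = cscale c (D p)"
  shows "Vector_Spaces.linear cscale cscale D"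
  by unfold_locales (use assms in auto)

lemma lin_linear: "Vector_Spaces.linear cscale cscale (lin \<theta>)"
  by (rule linearI_cscale)
    (auto intro!: poly_mapping_eqI simp: lookup_lin fn_add fn_scale lookup_add)

lemma lin_single: "lin \<theta> (single K c) = cscale c (\<theta> K)"
  by (rule poly_mapping_eqI) (simp add: lookup_lin fn_single)

lemma linear_cscale_sum:
  "Vector_Spaces.linear cscale cscale D \<Longrightarrow> D (\<Sum>i\<in>I. p i) = (\<Sum>i\<in>I. D (p i))"
  unfolding Vector_Spaces.linear_def by (blast intro: module_hom.sum)

lemma linear_cscale_scale:
  "Vector_Spaces.linear cscale cscale D \<Longrightarrow> D (cscale c p) = cscale c (D p)"
  unfolding Vector_Spaces.linear_def by (blast intro: module_hom.scale)

lemma poly_mapping_sum_single: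
  "p = (\<Sum>K\<in>keys p. cscale (lookup p K) (single K 1))"
  by (rule poly_mapping_eqI)
    (auto simp: lookup_sum lookup_single when_def in_keys_iff if_distrib[of "(*) _"] cong: if_cong)

text \<open>A basis of the span together with \<open>v\<close> is independent, so a functional can
  be prescribed as 1 at \<open>v\<close> and 0 on the basis. On finitely supported functions it is
  the pairing with its values at the unit vectors.\<close>

lemma separating_functional:
  assumes "v \<notin> cvec.span (R :: ('k \<Rightarrow>\<^sub>0 complex) set)"
  obtains \<theta> where "fn \<theta> v \<noteq> 0" "\<And>r. r \<in> R \<Longrightarrow> fn \<theta> r = 0"
proof -
  obtain B where B: "B \<subseteq> R" "cvec.independent B" "R \<subseteq> cvec.span B"
    using cvec.maximal_independent_subset by metis
  have sB: "cvec.span B = cvec.span R"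
    using B by (metis cvec.span_eq cvec.span_superset order_trans)
  then have ind: "cvec.independent (insert v B)"
    using B(2) assms by (simp add: cvec.independent_insertI)
  interpret vp: vector_space_pair "cscale :: complex \<Rightarrow> ('k \<Rightarrow>\<^sub>0 complex) \<Rightarrow> _" "(*) :: complex \<Rightarrow> complex \<Rightarrow> complex"
    by unfold_locales (auto simp: algebra_simps)
  obtain f where f: "Vector_Spaces.linear cscale (*) f" "\<forall>x\<in>insert v B. f x = (if x = v then 1 else 0)"
    using vp.linear_independent_extend[OF ind, of "\<lambda>x. if x = v then 1 else 0"] by blast
  then interpret f: module_hom cscale "(*)" f by (simp add: Vector_Spaces.linear_def)
  define \<theta> where "\<theta> K = f (single K 1)" for K
  have fn_eq: "f p = fn \<theta> p" for p
  proof -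
    have "f p = f (\<Sum>K\<in>keys p. cscale (lookup p K) (single K 1))"
      using poly_mapping_sum_single[of p] by simp
    also have "\<dots> = fn \<theta> p"
      by (simp add: f.sum f.scale fn_def \<theta>_def)
    finally show ?thesis .
  qed
  show ?thesis
  proof
    show "fn \<theta> v \<noteq> 0" using f(2) fn_eq by (metis insertI1 zero_neq_one)
    fix r assume "r \<in> R"
    then have "r \<in> cvec.span B" using B(3) by blast
    then have "f r = 0"
    proof (induction rule: cvec.span_induct_alt)
      case base
      show ?case by (rule f.zero)
    next
      case (step c x y)
      have "x \<noteq> v" using step(1) assms B(1) cvec.span_base by blast
      then have "f x = 0" using f(2) step(1) by auto
      then show ?case using step by (simp add: f.add f.scale)
    qed
    then show "fn \<theta> r = 0" by (simp add: fn_eq)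
  qed
qed

section \<open>Symmetric and exterior algebra in parallel\<close>

text \<open>The factor picked up when a product of basis vectors is sorted: always 1 in the
  symmetric algebra, a sign or 0 in the exterior algebra.\<close>

definition scoef :: "complex \<Rightarrow> 'a::linorder list \<Rightarrow> complex" where
  "scoef s cs = (if s = 1 \<or> distinct cs then s ^ inv_count cs else 0)"

lemma scoef_alternates:
  assumes "s = 1 \<or> s = - 1"
  shows "alternates s (scoef s :: 'a::linorder list \<Rightarrow> complex)"
proof (cases "s = 1")
  case True
  then show ?thesis by (simp add: alternates_def scoef_def)
next
  case False
  then have s: "s = - 1" using assms by simp
  then have "scoef s = (lsgn :: 'a list \<Rightarrow> complex)" by (auto simp: scoef_def lsgn_def fun_eq_iff)
  then show ?thesis using lsgn_alternates s by simp
qed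

lemma sort_swap: "sort (xs @ a # b # ys) = sort (xs @ b # a # ys)"
  by (intro properties_for_sort) auto

text \<open>
  The basis vector with key \<open>K\<close> is the product of the elements of the sorted list \<open>repr K\<close>; a
  transposition of adjacent factors multiplies a product by \<open>s\<close>. The symmetric algebra is the case
  \<open>s = 1\<close>, the exterior algebra the case \<open>s = - 1\<close>.
\<close>

locale power_algebra =
  fixes s :: complex
    and key :: "nat list list \<Rightarrow> 'k"
    and repr :: "'k \<Rightarrow> nat list list"
    and prd :: "('k \<Rightarrow>\<^sub>0 complex) \<Rightarrow> ('k \<Rightarrow>\<^sub>0 complex) \<Rightarrow> ('k \<Rightarrow>\<^sub>0 complex)"
  assumes s_cases: "s = 1 \<or> s = - 1"
    and repr_sorted: "sorted (repr K)"
    and repr_ok: "s = 1 \<or> distinct (repr K)"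
    and key_repr: "key (repr K) = K"
    and repr_key: "s = 1 \<or> distinct cs \<Longrightarrow> repr (key cs) = sort cs"
    and prd_linear1: "Vector_Spaces.linear cscale cscale (\<lambda>p. prd p q)"
    and prd_linear2: "Vector_Spaces.linear cscale cscale (prd p)"
    and prd_key: "prd (single (key xs) (scoef s xs)) (single (key ys) (scoef s ys)) =
      single (key (xs @ ys)) (scoef s (xs @ ys))"
begin

definition E :: "nat list list \<Rightarrow> ('k \<Rightarrow>\<^sub>0 complex)" where
  "E cs = single (key cs) (scoef s cs)"

lemma s_sq: "s * s = 1"
  using s_cases by auto

lemma E_not_ok: "\<not> (s = 1 \<or> distinct cs) \<Longrightarrow> E cs = 0"
  by (simp add: E_def scoef_def)

lemma key_sort: "s = 1 \<or> distinct cs \<Longrightarrow> key (sort cs) = key cs"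
  using key_repr[of "key cs"] repr_key by metis

lemma E_alternates: "alternates s (\<lambda>cs. lookup (E cs) K)"
proof -
  have *: "lookup (E cs) K = scoef s cs * of_bool (key (sort cs) = K)" for cs
    using key_sort[of cs] by (auto simp: E_def lookup_single when_def scoef_def)
  show ?thesis
    unfolding alternates_def *
  proof (intro allI)
    fix xs ys :: "nat list list" and a b
    have "scoef s (xs @ a # b # ys) = s * scoef s (xs @ b # a # ys)"
      by (rule alternatesD[OF scoef_alternates[OF s_cases]])
    then show "scoef s (xs @ a # b # ys) * of_bool (key (sort (xs @ a # b # ys)) = K) =
        s * (scoef s (xs @ b # a # ys) * of_bool (key (sort (xs @ b # a # ys)) = K))"
      unfolding sort_swap[of xs a b ys] by (simp only: mult.assoc)
  qed
qed

lemma E_permute_list: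
  assumes "p permutes {..<length cs}"
  shows "E (permute_list p cs) = cscale (perm_eps s (length cs) p) (E cs)"
  by (rule poly_mapping_eqI) (simp add: alternates_permute_list[OF E_alternates assms])

text \<open>Every \<open>s\<close>-alternating function of lists of columns comes from a functional
  on the algebra, the one given by its values at sorted lists. This is how a function of tables
  becomes a functional.\<close>

lemma fn_E:
  assumes "alternates s G"
  shows "fn (\<lambda>K. G (repr K)) (E cs) = G cs"
proof (cases "s = 1 \<or> distinct cs")
  case True
  then show ?thesis
    unfolding E_def fn_single repr_key[OF True] using alternates_sort[OF assms, of cs]
    by (simp add: scoef_def)
next
  case False
  then have "s = - 1" "\<not> distinct cs" using s_cases by auto
  then show ?thesis using alternates_not_distinct[of G cs] assms E_not_ok[OF False] by simp
qed

lemma E_repr: "E (repr K) = single K 1"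
  using repr_ok[of K] by (simp add: E_def key_repr scoef_def inv_count_sorted repr_sorted)

lemma E_Cons: "prd (E [c]) (E cs) = E (c # cs)"
  using prd_key[of "[c]" cs] by (simp add: E_def)

lemma E_append: "prd (E xs) (E ys) = E (xs @ ys)"
  using prd_key[of xs ys] by (simp add: E_def)

definition prds :: "('k \<Rightarrow>\<^sub>0 complex) list \<Rightarrow> ('k \<Rightarrow>\<^sub>0 complex)" where
  "prds ps = foldr prd ps (E [])"

lemma prd_sum_sum:
  "prd (\<Sum>i\<in>I. cscale (a i) (p i)) (\<Sum>j\<in>J. cscale (b j) (q j)) =
     (\<Sum>i\<in>I. \<Sum>j\<in>J. cscale (a i * b j) (prd (p i) (q j)))"
  by (simp add: linear_cscale_sum[OF prd_linear1] linear_cscale_sum[OF prd_linear2]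
      linear_cscale_scale[OF prd_linear1] linear_cscale_scale[OF prd_linear2] cvec.scale_sum_right)
    (subst sum.swap, simp add: mult.commute)

lemma prds_expand:
  "prds (map (\<lambda>c. \<Sum>b\<in>B c. cscale (f b c) (E [b])) cs) =
     (\<Sum>bs\<in>listset (map B cs). cscale (\<Prod>q<length cs. f (bs ! q) (cs ! q)) (E bs))"
proof (induction cs)
  case Nil
  show ?case by (simp add: prds_def)
next
  case (Cons c cs)
  have ls: "listset (map B (c # cs)) = (\<lambda>(b, bs). b # bs) ` (B c \<times> listset (map B cs))"
    by (auto simp: set_Cons_def)
  have "prds (map (\<lambda>c. \<Sum>b\<in>B c. cscale (f b c) (E [b])) (c # cs)) =
      prd (\<Sum>b\<in>B c. cscale (f b c) (E [b]))
        (\<Sum>bs\<in>listset (map B cs). cscale (\<Prod>q<length cs. f (bs ! q) (cs ! q)) (E bs))"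
    using Cons by (simp add: prds_def)
  also have "\<dots> = (\<Sum>b\<in>B c. \<Sum>bs\<in>listset (map B cs).
      cscale (\<Prod>q<length (c # cs). f ((b # bs) ! q) ((c # cs) ! q)) (E (b # bs)))"
    unfolding prd_sum_sum E_Cons
    by (simp add: lessThan_Suc_eq_insert_0 prod.reindex)
  finally show ?case
    unfolding ls by (simp add: sum.reindex inj_on_def sum.cartesian_product case_prod_unfold)
qed

definition act :: "nat \<Rightarrow> mats \<Rightarrow> ('k \<Rightarrow>\<^sub>0 complex) \<Rightarrow> ('k \<Rightarrow>\<^sub>0 complex)" where
  "act n g = lin (\<lambda>K. prds (map (\<lambda>c. \<Sum>b\<in>indices n (length c). cscale (tensor_coeff g b c) (E [b])) (repr K)))"

lemma act_linear: "Vector_Spaces.linear cscale cscale (act n g)"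
  unfolding act_def by (rule lin_linear)

definition act_cols :: "nat \<Rightarrow> mats \<Rightarrow> nat list list \<Rightarrow> ('k \<Rightarrow>\<^sub>0 complex)" where
  "act_cols n g cs = (\<Sum>bs\<in>listset (map (\<lambda>c. indices n (length c)) cs).
     cscale (\<Prod>q<length cs. tensor_coeff g (bs ! q) (cs ! q)) (E bs))"

text \<open>The action is defined through sorted products. Since the expansion alternates in the
  factors, the same formula holds for the factors in any order.\<close>

lemma act_cols_alternates: "alternates s (\<lambda>cs. lookup (act_cols n g cs) K)"
proof (rule alternatesI_permute[OF s_cases])
  fix p and cs :: "nat list list"
  assume p: "p permutes {..<length cs}"
  let ?L = "\<lambda>cs. listset (map (\<lambda>c. indices n (length c)) cs)"
  let ?m = "length cs"
  have ip: "inv p permutes {..<?m}" by (rule permutes_inv[OF p])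
  have pm: "p i < ?m" "inv p i < ?m" if "i < ?m" for i
    using permutes_in_image[OF p, of i] permutes_in_image[OF ip, of i] that by simp_all
  have "act_cols n g (permute_list p cs) = (\<Sum>bs\<in>?L cs.
      cscale (\<Prod>q<?m. tensor_coeff g (bs ! q) (cs ! q)) (E (permute_list p bs)))"
    unfolding act_cols_def
  proof (rule sum.reindex_bij_witness[of _ "permute_list p" "permute_list (inv p)"])
    fix bs assume bs: "bs \<in> ?L (permute_list p cs)"
    then have len: "length bs = ?m" by (simp add: listset_nth)
    show "permute_list p (permute_list (inv p) bs) = bs"
      using permute_list_compose[of p bs "inv p"] p len permutes_inv_o[OF p] by simp
    show "permute_list (inv p) bs \<in> ?L cs"
      unfolding listset_nth
    proof (safe, goal_cases)
      case 1
      then show ?case using len by simp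
    next
      case (2 i)
      then have i: "i < ?m" by simp
      have "bs ! inv p i \<in> indices n (length (permute_list p cs ! inv p i))"
        using bs pm[OF i] by (simp add: listset_nth)
      then show ?case
        using i pm[OF i] len by (simp add: permute_list_def permutes_inverses[OF p])
    qed
    have "(\<Prod>q<?m. tensor_coeff g (permute_list (inv p) bs ! q) (cs ! q)) =
        (\<Prod>q<?m. tensor_coeff g (permute_list (inv p) bs ! p q) (cs ! p q))"
      using prod.permute[OF p, of "\<lambda>q. tensor_coeff g (permute_list (inv p) bs ! q) (cs ! q)"]
      by (simp add: o_def)
    also have "\<dots> = (\<Prod>q<length (permute_list p cs). tensor_coeff g (bs ! q) (permute_list p cs ! q))"
      using pm len by (intro prod.cong) (auto simp: permute_list_def permutes_inverses[OF p])
    finally show "cscale (\<Prod>q<?m. tensor_coeff g (permute_list (inv p) bs ! q) (cs ! q))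
        (E (permute_list p (permute_list (inv p) bs))) =
      cscale (\<Prod>q<length (permute_list p cs). tensor_coeff g (bs ! q) (permute_list p cs ! q)) (E bs)"
      using \<open>permute_list p (permute_list (inv p) bs) = bs\<close> by simp
  next
    fix bs assume bs: "bs \<in> ?L cs"
    then have len: "length bs = ?m" by (simp add: listset_nth)
    show "permute_list (inv p) (permute_list p bs) = bs"
      using permute_list_compose[of "inv p" bs p] ip len permutes_inv_o[OF p] by simp
    show "permute_list p bs \<in> ?L (permute_list p cs)"
      using bs pm len by (auto simp: listset_nth permute_list_def)
  qed
  also have "\<dots> = (\<Sum>bs\<in>?L cs. cscale (\<Prod>q<?m. tensor_coeff g (bs ! q) (cs ! q))
      (cscale (perm_eps s ?m p) (E bs)))"
  proof (rule sum.cong[OF refl])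
    fix bs assume "bs \<in> ?L cs"
    then have "length bs = ?m" by (simp add: listset_nth)
    then show "cscale (\<Prod>q<?m. tensor_coeff g (bs ! q) (cs ! q)) (E (permute_list p bs)) =
        cscale (\<Prod>q<?m. tensor_coeff g (bs ! q) (cs ! q)) (cscale (perm_eps s ?m p) (E bs))"
      using E_permute_list[of p bs] p by simp
  qed
  finally show "lookup (act_cols n g (permute_list p cs)) K =
      perm_eps s (length cs) p * lookup (act_cols n g cs) K"
    by (simp add: act_cols_def lookup_sum sum_distrib_left ac_simps)
qed

lemma act_E: "act n g (E cs) = act_cols n g cs"
proof (rule poly_mapping_eqI)
  fix K
  have r: "lookup (prds (map (\<lambda>c. \<Sum>b\<in>indices n (length c). cscale (tensor_coeff g b c) (E [b])) (repr L))) K =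
    lookup (act_cols n g (repr L)) K" for L
    by (simp add: prds_expand act_cols_def)
  show "lookup (act n g (E cs)) K = lookup (act_cols n g cs) K"
    unfolding act_def lookup_lin r
    by (rule fn_E[OF act_cols_alternates[of n g K]])
qed

text \<open>In terms of tables the coefficients of the action factor over the rows, so that weights
  and invariance can be checked one row at a time.\<close>

lemma act_E_table:
  assumes X: "rect d m X" and d: "1 \<le> d"
  shows "act n g (E (cols X)) = (\<Sum>Y\<in>row_tables n d m.
    cscale (\<Prod>l<d. \<Prod>q<m. g l (Y ! l ! q) (X ! l ! q)) (E (cols Y)))"
proof -
  have len: "length (cols X) = m" by (rule length_transpose_rect[OF X d])
  have lenc: "length (cols X ! i) = d" if "i < m" for i
    using that len length_column[OF X d] by simp
  have ls: "listset (map (\<lambda>c. indices n (length c)) (cols X)) =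
      {cs. length cs = m \<and> set cs \<subseteq> indices n d}"
    unfolding listset_nth using len lenc by (auto simp: in_set_conv_nth subset_iff) blast
  have "act n g (E (cols X)) = (\<Sum>Y\<in>row_tables n d m.
      cscale (\<Prod>q<m. tensor_coeff g (cols Y ! q) (cols X ! q)) (E (cols Y)))"
    unfolding act_E act_cols_def ls len
    by (rule sum.reindex_bij_betw[OF transpose_row_tables[OF d], symmetric])
  also have "\<dots> = (\<Sum>Y\<in>row_tables n d m.
    cscale (\<Prod>l<d. \<Prod>q<m. g l (Y ! l ! q) (X ! l ! q)) (E (cols Y)))"
  proof (rule sum.cong[OF refl])
    fix Y assume "Y \<in> row_tables n d m"
    then have Y: "rect d m Y" by (rule row_tables_rect)
    have "(\<Prod>q<m. tensor_coeff g (cols Y ! q) (cols X ! q)) =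
        (\<Prod>q<m. \<Prod>l<d. g l (Y ! l ! q) (X ! l ! q))"
      unfolding tensor_coeff_def using lenc
      by (intro prod.cong) (auto simp: transpose_nth_nth[OF X d] transpose_nth_nth[OF Y d])
    also have "\<dots> = (\<Prod>l<d. \<Prod>q<m. g l (Y ! l ! q) (X ! l ! q))" by (rule prod.swap)
    finally show "cscale (\<Prod>q<m. tensor_coeff g (cols Y ! q) (cols X ! q)) (E (cols Y)) =
      cscale (\<Prod>l<d. \<Prod>q<m. g l (Y ! l ! q) (X ! l ! q)) (E (cols Y))" by simp
  qed
  finally show ?thesis .
qed

definition Alg :: "nat \<Rightarrow> nat \<Rightarrow> ('k \<Rightarrow>\<^sub>0 complex) set" where
  "Alg n d = {p. \<forall>K\<in>keys p. set (repr K) \<subseteq> indices n d}"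

definition WV :: "nat \<Rightarrow> nat list list \<Rightarrow> ('k \<Rightarrow>\<^sub>0 complex) set" where
  "WV n al = {p \<in> Alg n (length al).
     \<forall>g\<in>torus n (length al). act n g p = cscale (weight_char n al g) p}"

definition HWV :: "nat \<Rightarrow> nat list list \<Rightarrow> ('k \<Rightarrow>\<^sub>0 complex) set" where
  "HWV n al = {p \<in> WV n al. \<forall>u\<in>unitriangular n (length al). act n u p = p}"

lemma fn_combination: "fn \<theta> (\<Sum>i\<in>I. cscale (c i) (p i)) = (\<Sum>i\<in>I. c i * fn \<theta> (p i))"
  by (simp add: fn_sum fn_scale)

text \<open>The vector \<open>Del n T\<close> multiplied by \<open>table_norm T\<close>; in this
  form boundary sums vanish without weights.\<close>

definition Phi :: "nat \<Rightarrow> nat \<Rightarrow> nat \<Rightarrow> table \<Rightarrow> ('k \<Rightarrow>\<^sub>0 complex)" where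
  "Phi n d m T = (\<Sum>X\<in>row_tables n d m. cscale (CT T X) (E (cols X)))"

definition Del :: "nat \<Rightarrow> table \<Rightarrow> ('k \<Rightarrow>\<^sub>0 complex)" where
  "Del n T = cscale (table_sign T / table_norm T)
     (\<Sum>X\<in>same_shape n T. cscale (table_sgn T X) (E (cols X)))"

lemma Del_Phi: "rect d m T \<Longrightarrow> Del n T = cscale (1 / table_norm T) (Phi n d m T)"
  by (simp add: Del_def Phi_def same_shape_rect CT_def cvec.scale_sum_right)

text \<open>For a transposition, reordering the product gives one factor \<open>s\<close>, and the
  coefficients give one sign per row.\<close>

lemma Phi_pcol:
  assumes T: "rect d m T" and d: "1 \<le> d" and p: "p permutes {..<m}"
  shows "Phi n d m (pcol p T) = cscale (perm_eps (s * (- 1) ^ d) m p) (Phi n d m T)"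
proof -
  have "Phi n d m (pcol p T) =
      (\<Sum>X\<in>row_tables n d m. cscale (CT (pcol p T) (pcol p X)) (E (cols (pcol p X))))"
    unfolding Phi_def by (rule row_tables_reindex[OF p, symmetric])
  also have "\<dots> = (\<Sum>X\<in>row_tables n d m. cscale (perm_eps (s * (- 1) ^ d) m p) (cscale (CT T X) (E (cols X))))"
  proof (rule sum.cong[OF refl])
    fix X assume "X \<in> row_tables n d m"
    then have X: "rect d m X" by (rule row_tables_rect)
    have "E (cols (pcol p X)) = cscale (perm_eps s m p) (E (cols X))"
      unfolding transpose_pcol[OF X d p]
      using E_permute_list[of p "cols X"] p length_transpose_rect[OF X d] by simp
    then show "cscale (CT (pcol p T) (pcol p X)) (E (cols (pcol p X))) =
        cscale (perm_eps (s * (- 1) ^ d) m p) (cscale (CT T X) (E (cols X)))"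
      by (simp add: CT_pcol[OF p T X] perm_eps_mult ac_simps)
  qed
  finally show ?thesis by (simp add: Phi_def cvec.scale_sum_right)
qed

end

section \<open>Words of given content and conjugate partitions\<close>

definition content :: "nat list \<Rightarrow> nat multiset" where
  "content a = (\<Sum>i\<in>{1..length a}. replicate_mset (entry a i) i)"

lemma count_content: "count (content a) k = entry a k"
proof -
  have "count (content a) k = (\<Sum>i\<in>{1..length a}. if i = k then entry a i else 0)"
    unfolding content_def count_sum by (intro sum.cong) auto
  also have "\<dots> = (if k \<in> {1..length a} then entry a k else 0)" by (subst sum.delta) auto
  also have "\<dots> = entry a k" by (simp add: entry_def)
  finally show ?thesis .
qed

lemma words_count: "w \<in> words a \<longleftrightarrow> (\<forall>i. count_list w i = entry a i)"
proof
  assume w: "w \<in> words a"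
  show "\<forall>i. count_list w i = entry a i"
  proof
    fix i
    show "count_list w i = entry a i"
    proof (cases "i \<in> {1..length a}")
      case True
      then show ?thesis using w by (auto simp: words_def entry_def)
    next
      case False
      then have "i \<notin> set w" using w by (auto simp: words_def)
      then show ?thesis using False by (auto simp: entry_def)
    qed
  qed
next
  assume *: "\<forall>i. count_list w i = entry a i"
  have "set w \<subseteq> {1..length a}"
  proof
    fix i assume "i \<in> set w"
    then have "entry a i \<noteq> 0" using * by (metis count_list_0_iff)
    then show "i \<in> {1..length a}" by (auto simp: entry_def split: if_splits)
  qed
  then show "w \<in> words a" using * by (auto simp: words_def entry_def)
qed

lemma words_content: "w \<in> words a \<longleftrightarrow> mset w = content a"
  by (simp add: words_count multiset_eq_iff count_content count_mset)

lemma size_content: "size (content a) = sum_list a"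
proof -
  have "size (content a) = (\<Sum>i\<in>{1..length a}. entry a i)" by (simp add: content_def)
  also have "\<dots> = (\<Sum>i<length a. a ! i)"
    by (rule sum.reindex_bij_witness[of _ Suc "\<lambda>i. i - 1"]) (auto simp: entry_def)
  finally show ?thesis by (simp add: sum_list_sum_nth atLeast0LessThan)
qed

lemma words_length: "w \<in> words a \<Longrightarrow> length w = sum_list a"
  by (metis words_content size_content size_mset)

lemma words_letters: "w \<in> words a \<Longrightarrow> set w \<subseteq> {1..length a}"
  by (simp add: words_def)

lemma tabA_nth: "T \<in> tabA al \<longleftrightarrow> length T = length al \<and> (\<forall>l<length al. T ! l \<in> words (al ! l))"
  by (auto simp: tabA_def listset_nth)

section \<open>Conjugation of partitions\<close>

lemma entry_le_sorted:
  assumes "sorted_wrt (\<ge>) p" "1 \<le> v" "1 \<le> k"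
  shows "v \<le> length (filter (\<lambda>x. k \<le> x) p) \<longleftrightarrow> k \<le> entry p v"
  using assms
proof (induction p arbitrary: v)
  case Nil
  then show ?case by (simp add: entry_def)
next
  case (Cons x p)
  have e: "entry (x # p) v = (if v = 1 then x else entry p (v - 1))"
    using Cons.prems(2) by (cases v) (auto simp: entry_def nth_Cons split: nat.split)
  show ?case
  proof (cases "k \<le> x")
    case True
    have "v - 1 \<le> length (filter (\<lambda>x. k \<le> x) p) \<longleftrightarrow> k \<le> entry p (v - 1)" if "v \<noteq> 1"
      using that Cons.prems by (intro Cons.IH) auto
    then show ?thesis unfolding e using True Cons.prems(2) by auto
  next
    case False
    have "filter (\<lambda>x. k \<le> x) (x # p) = []" using False Cons.prems(1) by (auto simp: filter_empty_conv)
    moreover have "entry p (v - 1) \<le> x"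
      using Cons.prems(1) by (auto simp: entry_def)
    ultimately show ?thesis unfolding e using False Cons.prems(2) by simp
  qed
qed

lemma length_conj_part [simp]: "length (conj_part p) = entry p 1"
  by (simp add: conj_part_def del: upt_Suc)

lemma is_partition_sorted: "is_partition m p \<Longrightarrow> sorted_wrt (\<ge>) p"
  by (simp add: is_partition_def)

lemma entry_conj_part:
  assumes "is_partition m p" "1 \<le> k"
  shows "entry (conj_part p) k = length (filter (\<lambda>x. k \<le> x) p)"
proof (cases "k \<le> entry p 1")
  case True
  then have "entry (conj_part p) k = conj_part p ! (k - 1)"
    using assms(2) by (simp add: entry_def[of "conj_part p"])
  also have "\<dots> = length (filter (\<lambda>x. k \<le> x) p)"
  proof -
    have "[1..<Suc (entry p 1)] ! (k - 1) = k" using True assms(2) by (subst nth_upt) auto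
    then show ?thesis using True assms(2) by (simp add: conj_part_def del: upt_Suc)
  qed
  finally show ?thesis .
next
  case False
  then have "\<not> 1 \<le> length (filter (\<lambda>x. k \<le> x) p)"
    using entry_le_sorted[OF is_partition_sorted[OF assms(1)] _ assms(2), of 1] by simp
  then have "length (filter (\<lambda>x. k \<le> x) p) = 0" by linarith
  then show ?thesis using False by (simp add: entry_def[of "conj_part p"])
qed

text \<open>Both sides say that the box in row \<open>v\<close> and column \<open>k\<close> belongs
  to the Young diagram of \<open>p\<close>. Involutivity of conjugation is this equivalence applied
  twice.\<close>

lemma conj_part_galois:
  assumes "is_partition m p" "1 \<le> k" "1 \<le> v"
  shows "v \<le> entry (conj_part p) k \<longleftrightarrow> k \<le> entry p v"
  using entry_le_sorted[OF is_partition_sorted[OF assms(1)] assms(3,2)] entry_conj_part[OF assms(1,2)]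
  by simp

lemma entry_conj_part_le: "is_partition m p \<Longrightarrow> entry (conj_part p) k \<le> length p"
proof (cases "1 \<le> k")
  case True
  assume "is_partition m p"
  then show ?thesis using entry_conj_part[OF _ True] by (metis length_filter_le)
qed (simp add: entry_def)

lemma entry_conj_part_antimono:
  assumes "is_partition m p" "1 \<le> a" "a \<le> b"
  shows "entry (conj_part p) b \<le> entry (conj_part p) a"
proof -
  have "length (filter (\<lambda>x. b \<le> x) p) \<le> length (filter (\<lambda>x. a \<le> x) p)"
    using assms(3) by (induction p) auto
  then show ?thesis using entry_conj_part[OF assms(1)] assms by simp
qed

lemma entry_conj_part_pos:
  assumes "is_partition m p" "1 \<le> k" "k \<le> length (conj_part p)"
  shows "1 \<le> entry (conj_part p) k"
  using conj_part_galois[OF assms(1,2), of 1] assms(3) by simp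

lemma sum_list_conj_part:
  assumes "is_partition m p"
  shows "sum_list (conj_part p) = m"
proof -
  \<comment> \<open>The boxes are counted by rows instead of columns. The bound \<open>M\<close> is
    kept general because the first part changes during the induction.\<close>
  have "(\<Sum>j\<leftarrow>[1..<Suc M]. length (filter (\<lambda>x. j \<le> x) q)) = (\<Sum>x\<leftarrow>q. min x M)" for M and q :: "nat list"
  proof (induction q)
    case (Cons x q)
    have "(\<Sum>j\<leftarrow>[1..<Suc M]. of_bool (j \<le> x)) = min x M"
      by (induction M) auto
    moreover have "(\<Sum>j\<leftarrow>[1..<Suc M]. length (filter (\<lambda>y. j \<le> y) (x # q))) =
        (\<Sum>j\<leftarrow>[1..<Suc M]. of_bool (j \<le> x) + length (filter (\<lambda>y. j \<le> y) q))"
      by (intro arg_cong[where f = sum_list] map_cong) auto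
    ultimately show ?case using Cons by (simp add: sum_list_addf del: upt_Suc)
  qed (simp del: upt_Suc add: sum_list_triv)
  then have "sum_list (conj_part p) = (\<Sum>x\<leftarrow>p. min x (entry p 1))" by (simp add: conj_part_def del: upt_Suc)
  also have "(\<Sum>x\<leftarrow>p. min x (entry p 1)) = (\<Sum>x\<leftarrow>p. x)"
  proof (intro arg_cong[where f = sum_list] map_cong refl)
    fix x assume "x \<in> set p"
    then have "x \<le> entry p 1"
      using is_partition_sorted[OF assms] by (cases p) (auto simp: entry_def)
    then show "min x (entry p 1) = x" by simp
  qed
  finally show ?thesis using assms by (simp add: is_partition_def)
qed

lemma nth_entry: "i < length a \<Longrightarrow> a ! i = entry a (Suc i)"
  by (simp add: entry_def)

lemma is_partition_conj_part:
  assumes "is_partition m p"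
  shows "is_partition m (conj_part p)"
  unfolding is_partition_def
proof (intro conjI)
  show "sorted_wrt (\<ge>) (conj_part p)"
    unfolding sorted_wrt_iff_nth_less using entry_conj_part_antimono[OF assms]
    by (auto simp: nth_entry simp del: length_conj_part)
  show "0 \<notin> set (conj_part p)"
  proof
    assume "0 \<in> set (conj_part p)"
    then obtain i where i: "i < length (conj_part p)" "conj_part p ! i = 0" by (metis in_set_conv_nth)
    then show False using entry_conj_part_pos[OF assms, of "Suc i"] by (simp add: nth_entry del: length_conj_part)
  qed
qed (rule sum_list_conj_part[OF assms])

lemma conj_part_conj_part:
  assumes "is_partition m p"
  shows "conj_part (conj_part p) = p"
proof -
  have e: "entry (conj_part (conj_part p)) v = entry p v" if v: "1 \<le> v" for v
  proof (rule antisym)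
    have g: "k \<le> entry (conj_part (conj_part p)) v \<longleftrightarrow> k \<le> entry p v" if "1 \<le> k" for k
      using conj_part_galois[OF is_partition_conj_part[OF assms] v that] conj_part_galois[OF assms that v]
      by simp
    show "entry (conj_part (conj_part p)) v \<le> entry p v"
      using g[of "entry (conj_part (conj_part p)) v"] by (cases "entry (conj_part (conj_part p)) v") auto
    show "entry p v \<le> entry (conj_part (conj_part p)) v"
      using g[of "entry p v"] by (cases "entry p v") auto
  qed
  have "filter (\<lambda>x. 1 \<le> x) p = p"
    using assms by (auto simp: is_partition_def filter_id_conv Suc_le_eq) (metis gr0I)
  then have l: "length (conj_part (conj_part p)) = length p"
    using entry_conj_part[OF assms, of 1] by simp
  show ?thesis
  proof (rule nth_equalityI[OF l])
    fix i assume i: "i < length (conj_part (conj_part p))"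
    then show "conj_part (conj_part p) ! i = p ! i"
      using e[of "Suc i"] nth_entry[OF i] nth_entry[of i p] l by simp
  qed
qed

lemma count_list_snd:
  assumes "length t = length x" "finite S" "set t \<subseteq> S"
  shows "count_list x v = (\<Sum>k\<in>S. count (mset (zip t x)) (k, v))"
  using assms(1,3)
proof (induction t x rule: list_induct2)
  case (Cons k t u x)
  have "(\<Sum>k'\<in>S. count (mset (zip (k # t) (u # x))) (k', v)) =
      (\<Sum>k'\<in>S. (if k' = k then of_bool (u = v) else 0) + count (mset (zip t x)) (k', v))"
    by (intro sum.cong) auto
  also have "\<dots> = of_bool (u = v) + count_list x v"
    using Cons assms(2) by (simp add: sum.distrib)
  finally show ?case by simp
qed simp

text \<open>Each letter of multiplicity at least \<open>v\<close> meets the value \<open>v\<close>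
  exactly once, so \<open>v\<close> occurs as often as \<open>conj_part p\<close> has entries at
  least \<open>v\<close>, which is part \<open>v\<close> of \<open>p\<close>. This is why content
  \<lambda>' leads to weight \<lambda>.\<close>

lemma cw_nonzero_words:
  assumes p: "is_partition m p" and t: "t \<in> words (conj_part p)" and len: "length x = length t"
    and nz: "cw t x \<noteq> 0"
  shows "x \<in> words p"
  unfolding words_count
proof
  fix v
  have std: "std_pairs (mset (zip t x))" using nz len cw_nonzero_iff[of t x] by simp
  have ct: "count_list t k = entry (conj_part p) k" for k using t words_count by blast
  have "count_list x v = (\<Sum>k\<in>set t. of_bool (1 \<le> v \<and> v \<le> count_list t k))"
    using count_list_snd[of t x "set t" v] count_zip_std[OF std] len by simp
  also have "\<dots> = card {k \<in> set t. 1 \<le> v \<and> v \<le> count_list t k}"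
    by (simp add: of_bool_def sum.If_cases Int_def)
  also have "{k \<in> set t. 1 \<le> v \<and> v \<le> count_list t k} = (if 1 \<le> v then {1..entry p v} else {})"
  proof (cases "1 \<le> v")
    case True
    have *: "k \<in> set t \<and> v \<le> count_list t k \<longleftrightarrow> 1 \<le> k \<and> k \<le> entry p v" for k
    proof (cases "1 \<le> k")
      case k: True
      show ?thesis using conj_part_galois[OF p k True] ct[of k] True k
        by (metis count_notin not_one_le_zero order_trans)
    next
      case False
      then have "k \<notin> set t" using words_letters[OF t] by auto
      then show ?thesis using False by simp
    qed
    show ?thesis
    proof (rule set_eqI)
      fix k
      show "k \<in> {k \<in> set t. 1 \<le> v \<and> v \<le> count_list t k} \<longleftrightarrow> k \<in> (if 1 \<le> v then {1..entry p v} else {})"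
        using *[of k] True by auto
    qed
  qed auto
  finally show "count_list x v = entry p v" by (auto simp: entry_def split: if_splits)
qed

section \<open>Boundaries\<close>

text \<open>Replacements at different positions give different tables, because the letter really
  changes; so the set can be indexed by positions.\<close>

lemma boundary_sum:
  assumes "a \<noteq> b" "l < length Y"
  shows "(\<Sum>S\<in>boundary l b a Y. f S) =
    (\<Sum>q | q < length (Y ! l) \<and> Y ! l ! q = a. f (Y[l := (Y ! l)[q := b]]))"
proof -
  let ?Q = "{q. q < length (Y ! l) \<and> Y ! l ! q = a}" and ?f = "\<lambda>q. Y[l := (Y ! l)[q := b]]"
  have "boundary l b a Y = ?f ` ?Q" by (auto simp: boundary_def)
  moreover have "inj_on ?f ?Q"
  proof (rule inj_onI, rule ccontr)
    fix q r assume qr: "q \<in> ?Q" "r \<in> ?Q" "?f q = ?f r" "q \<noteq> r"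
    then have "(Y ! l)[q := b] = (Y ! l)[r := b]" using assms(2) by (metis nth_list_update_eq)
    then have "(Y ! l)[q := b] ! q = (Y ! l)[r := b] ! q" by simp
    then show False using qr assms(1) by simp
  qed
  ultimately show ?thesis by (simp add: sum.reindex)
qed

lemma boundary_sum_repl:
  assumes "a \<noteq> b" "l < length Y"
  shows "(\<Sum>S\<in>boundary l b a Y. f S) = repl a b (\<lambda>w. f (Y[l := w])) (Y ! l)"
  unfolding boundary_sum[OF assms] repl_sum ..

lemma entry_move:
  assumes "1 \<le> i" "i < j" "j \<le> length a"
  shows "entry (a[i - 1 := a ! (i - 1) + 1, j - 1 := a ! (j - 1) - 1]) k =
    (if k = i then entry a k + 1 else if k = j then entry a k - 1 else entry a k)"
  using assms by (auto simp: entry_def nth_list_update)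

lemma count_list_update:
  "q < length y \<Longrightarrow> count_list (y[q := b]) k + of_bool (y ! q = k) = count_list y k + of_bool (b = k)"
proof (induction y arbitrary: q)
  case (Cons z y)
  then show ?case by (cases q) auto
qed simp

text \<open>The hypothesis on \<open>entry a j\<close> keeps the subtraction in the move from being
  truncated.\<close>

lemma words_move:
  assumes ij: "1 \<le> i" "i < j" "j \<le> length a" "1 \<le> entry a j" and q: "q < length y" "y ! q = i"
  shows "y \<in> words (a[i - 1 := a ! (i - 1) + 1, j - 1 := a ! (j - 1) - 1]) \<longleftrightarrow> y[q := j] \<in> words a"
  unfolding words_count entry_move[OF ij(1-3)]
proof (intro iffI allI)
  fix k
  note c = count_list_update[OF q(1), of j k]
  assume *: "\<forall>k. count_list y k = (if k = i then entry a k + 1 else if k = j then entry a k - 1 else entry a k)"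
  show "count_list (y[q := j]) k = entry a k"
    using c *[rule_format, of k] q(2) ij by (auto split: if_splits)
next
  fix k
  note c = count_list_update[OF q(1), of j k]
  assume *: "\<forall>k. count_list (y[q := j]) k = entry a k"
  show "count_list y k = (if k = i then entry a k + 1 else if k = j then entry a k - 1 else entry a k)"
    using c *[rule_format, of k] q(2) ij by (auto split: if_splits)
qed

lemma tabA_move:
  assumes ij: "1 \<le> i" "i < j" "j \<le> length (mu ! l)" "1 \<le> entry (mu ! l) j" and l: "l < length mu"
    and q: "q < length (Y ! l)" "Y ! l ! q = i" and Y: "length Y = length mu"
  shows "Y \<in> tabA (move l i j mu) \<longleftrightarrow> Y[l := (Y ! l)[q := j]] \<in> tabA mu"
proof -
  have "Y \<in> tabA (move l i j mu) \<longleftrightarrow>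
      (\<forall>l'<length mu. l' \<noteq> l \<longrightarrow> Y ! l' \<in> words (mu ! l')) \<and>
      Y ! l \<in> words ((mu ! l)[i - 1 := mu ! l ! (i - 1) + 1, j - 1 := mu ! l ! (j - 1) - 1])"
    unfolding tabA_nth move_def using l Y by (auto simp: nth_list_update)
  also have "\<dots> \<longleftrightarrow> (\<forall>l'<length mu. l' \<noteq> l \<longrightarrow> Y ! l' \<in> words (mu ! l')) \<and> (Y ! l)[q := j] \<in> words (mu ! l)"
    unfolding words_move[OF ij q] ..
  also have "\<dots> \<longleftrightarrow> Y[l := (Y ! l)[q := j]] \<in> tabA mu"
    unfolding tabA_nth using l Y by (auto simp: nth_list_update)
  finally show ?thesis .
qed

locale conj_shape =
  fixes d m :: nat and lam :: "nat list list"
  assumes shape: "partition_tuple d m lam" and d_pos: "1 \<le> d"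
begin

abbreviation "mu \<equiv> map conj_part lam"

lemma length_lam: "length lam = d" and part: "l < d \<Longrightarrow> is_partition m (lam ! l)"
  using shape by (auto simp: partition_tuple_def)

lemma mu_nth: "l < d \<Longrightarrow> mu ! l = conj_part (lam ! l)"
  by (simp add: length_lam)

lemma tabA_mu: "T \<in> tabA mu \<longleftrightarrow> length T = d \<and> (\<forall>l<d. mset (T ! l) = content (conj_part (lam ! l)))"
  by (auto simp: tabA_nth length_lam words_content)

lemma tabA_rect: "T \<in> tabA mu \<Longrightarrow> rect d m T"
  unfolding rect_def
proof (intro conjI ballI)
  assume T: "T \<in> tabA mu"
  then show len: "length T = d" by (simp add: tabA_nth length_lam)
  fix r assume "r \<in> set T"
  then obtain l where l: "l < d" "r = T ! l" using len by (metis in_set_conv_nth)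
  then have "r \<in> words (conj_part (lam ! l))" using T by (simp add: tabA_nth length_lam)
  then show "length r = m" using words_length sum_list_conj_part[OF part[OF l(1)]] by simp
qed

lemma pcol_tabA: "T \<in> tabA mu \<Longrightarrow> p permutes {..<m} \<Longrightarrow> pcol p T \<in> tabA mu"
  using tabA_rect[of T] unfolding tabA_mu by (simp add: rect_nth)

lemma CT_nonzero_tabA:
  assumes T: "T \<in> tabA mu" and X: "rect d m X" and nz: "CT T X \<noteq> 0"
  shows "X \<in> tabA lam"
  unfolding tabA_nth
proof (intro conjI allI impI)
  show "length X = length lam" using X by (simp add: rect_def length_lam)
  fix l assume "l < length lam"
  then have l: "l < d" by (simp add: length_lam)
  have "cw (T ! l) (X ! l) \<noteq> 0"
    using nz CT_prod[of T d X] l rect_length[OF X] rect_length[OF tabA_rect[OF T]] by auto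
  then show "X ! l \<in> words (lam ! l)"
    using T l rect_nth[OF X l] rect_nth[OF tabA_rect[OF T] l]
    by (intro cw_nonzero_words[OF part[OF l]]) (auto simp: tabA_nth length_lam)
qed

lemma boundary_tabA:
  assumes l: "l < d" and ij: "1 \<le> i" "i < j" "j \<le> length (mu ! l)" and Y: "Y \<in> tabA (move l i j mu)"
    and S: "S \<in> boundary l j i Y"
  shows "S \<in> tabA mu"
proof -
  have len: "length Y = length mu" using Y by (simp add: tabA_nth move_def)
  obtain q where q: "q < length (Y ! l)" "Y ! l ! q = i" "S = Y[l := (Y ! l)[q := j]]"
    using S by (auto simp: boundary_def)
  have "1 \<le> entry (mu ! l) j"
    using entry_conj_part_pos[OF part[OF l], of j] ij mu_nth[OF l] by simp
  then show ?thesis using tabA_move[OF ij _ _ q(1,2) len] Y l q(3) length_lam by simp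
qed

text \<open>With the other rows fixed, the boundary is the operator \<open>repl i j\<close> in row
  \<open>l\<close>, and the conjugate partition decreases weakly, as \<open>cw_repl\<close>
  requires.\<close>

lemma CT_boundary_sum:
  assumes l: "l < d" and ij: "1 \<le> i" "i < j" "j \<le> length (mu ! l)" and Y: "Y \<in> tabA (move l i j mu)"
    and X: "rect d m X"
  shows "(\<Sum>S\<in>boundary l j i Y. CT S X) = 0"
proof -
  have lenY: "length Y = d" using Y by (simp add: tabA_nth move_def length_lam)
  define A where "A = content (conj_part (lam ! l))"
  define C where "C = (\<Prod>l'\<in>{..<d} - {l}. cw (Y ! l') (X ! l'))"
  have mem: "mset ((Y ! l)[q := j]) = A" if "q < length (Y ! l)" "Y ! l ! q = i" for q
  proof -
    have "Y[l := (Y ! l)[q := j]] \<in> tabA mu"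
      using boundary_tabA[OF l ij Y] that by (auto simp: boundary_def)
    then show ?thesis using l lenY by (auto simp: tabA_mu A_def)
  qed
  have "(\<Sum>S\<in>boundary l j i Y. CT S X) =
      (\<Sum>q | q < length (Y ! l) \<and> Y ! l ! q = i. CT (Y[l := (Y ! l)[q := j]]) X)"
    by (rule boundary_sum) (use ij l lenY in auto)
  also have "\<dots> = (\<Sum>q | q < length (Y ! l) \<and> Y ! l ! q = i.
      C * (if mset ((Y ! l)[q := j]) = A then cw ((Y ! l)[q := j]) (X ! l) else 0))"
  proof (rule sum.cong[OF refl])
    fix q assume q: "q \<in> {q. q < length (Y ! l) \<and> Y ! l ! q = i}"
    have "CT (Y[l := (Y ! l)[q := j]]) X = (\<Prod>l'<d. cw (Y[l := (Y ! l)[q := j]] ! l') (X ! l'))"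
      by (rule CT_prod) (use lenY rect_length[OF X] in auto)
    also have "\<dots> = cw ((Y ! l)[q := j]) (X ! l) * C"
      using l lenY unfolding C_def by (subst prod.remove[of _ l]) (auto intro!: prod.cong)
    finally show "CT (Y[l := (Y ! l)[q := j]]) X =
        C * (if mset ((Y ! l)[q := j]) = A then cw ((Y ! l)[q := j]) (X ! l) else 0)"
      using mem q by simp
  qed
  also have "\<dots> = C * repl i j (\<lambda>w. if mset w = A then cw w (X ! l) else 0) (Y ! l)"
    by (simp add: repl_sum sum_distrib_left)
  also have "repl i j (\<lambda>w. if mset w = A then cw w (X ! l) else 0) (Y ! l) = 0"
  proof (rule cw_repl)
    show "count A j \<le> count A i"
      using entry_conj_part_antimono[OF part[OF l], of i j] ij by (simp add: A_def count_content)
    show "size A = length (X ! l)"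
      using sum_list_conj_part[OF part[OF l]] rect_nth[OF X l] by (simp add: A_def size_content)
  qed (use ij in auto)
  finally show ?thesis by simp
qed

end

section \<open>Invariance and weights\<close>

lemma indices_nth: "x \<in> indices n m \<Longrightarrow> q < m \<Longrightarrow> x ! q \<in> {1..n}"
  using nth_mem by (fastforce simp: indices_def)

text \<open>
  Row by row, acting by an upper unitriangular matrix replaces a coefficient by a product of minors
  of that matrix with initial columns. If \<open>y\<close> repeats a value inside a block of \<open>t\<close>, the sum
  vanishes by a sign reversing swap; otherwise triangularity leaves only the term \<open>x = y\<close>.
\<close>

lemma cw_unitriangular:
  fixes u :: "nat \<Rightarrow> nat \<Rightarrow> complex"
  assumes t: "length t = m" and y: "y \<in> indices n m"
    and u: "\<And>i j. i \<in> {1..n} \<Longrightarrow> j \<in> {1..n} \<Longrightarrow> (i = j \<longrightarrow> u i j = 1) \<and> (j < i \<longrightarrow> u i j = 0)"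
  shows "(\<Sum>x\<in>indices n m. cw t x * (\<Prod>q<m. u (y ! q) (x ! q))) = cw t y"
proof -
  have ly: "length y = m" using y by (simp add: indices_def)
  show ?thesis
  proof (cases "\<exists>a<m. \<exists>b<m. a \<noteq> b \<and> t ! a = t ! b \<and> y ! a = y ! b")
    case True
    then obtain a b where ab: "a < m" "b < m" "a \<noteq> b" "t ! a = t ! b" "y ! a = y ! b" by blast
    define f where "f x = cw t x * (\<Prod>q<m. u (y ! q) (x ! q))" for x
    define sw where "sw x = x[a := x ! b, b := x ! a]" for x :: "nat list"
    have sw_in: "sw x \<in> indices n m" if "x \<in> indices n m" for x
    proof -
      have lx: "length x = m" using that by (simp add: indices_def)
      have "mset (sw x) = mset x" unfolding sw_def using ab lx mset_swap[of b x a] by simp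
      then have "set (sw x) = set x" by (rule mset_eq_setD)
      then show ?thesis using that by (simp add: indices_def sw_def)
    qed
    have sw_sw: "sw (sw x) = x" if "x \<in> indices n m" for x
      using that ab by (intro nth_equalityI) (auto simp: sw_def indices_def nth_list_update)
    have f_sw: "f (sw x) = - f x" if x: "x \<in> indices n m" for x
    proof -
      have lx: "length x = m" using x by (simp add: indices_def)
      have "zip t (sw x) = (zip t x)[a := zip t x ! b, b := zip t x ! a]"
        using ab t lx by (intro nth_equalityI) (auto simp: sw_def nth_list_update)
      then have "cw t (sw x) = - cw t x"
        using alternates_swap_neq[OF pairs_sgn_alternates _ ab(3), of "zip t x"] ab t lx
        by (simp add: cw_pairs_sgn sw_def)
      moreover have "(\<Prod>q<m. u (y ! q) (sw x ! q)) = (\<Prod>q<m. u (y ! q) (x ! q))"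
      proof -
        have p: "swap a b permutes {..<m}" using ab by (intro permutes_swap_id) auto
        have "(\<Prod>q<m. u (y ! q) (x ! q)) = (\<Prod>q<m. u (y ! swap a b q) (x ! swap a b q))"
          using prod.permute[OF p, of "\<lambda>q. u (y ! q) (x ! q)"] by (simp add: o_def)
        also have "\<dots> = (\<Prod>q<m. u (y ! q) (sw x ! q))"
          using ab lx by (intro prod.cong) (auto simp: sw_def nth_list_update Transposition.transpose_def)
        finally show ?thesis by simp
      qed
      ultimately show ?thesis by (simp add: f_def)
    qed
    have "(\<Sum>x\<in>indices n m. f x) = (\<Sum>x\<in>indices n m. f (sw x))"
      by (rule sum.reindex_bij_witness[of _ sw sw]) (use sw_in sw_sw in auto)
    also have "\<dots> = - (\<Sum>x\<in>indices n m. f x)" using f_sw by (simp add: sum_negf)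
    finally have "(\<Sum>x\<in>indices n m. f x) = 0" by simp
    moreover have "cw t y = 0"
    proof -
      have "zip t y ! a = zip t y ! b" using ab t ly by simp
      then have "\<not> distinct (zip t y)" using ab t ly nth_eq_iff_index_eq[of "zip t y" a b] by auto
      then show ?thesis using cw_nonzero_iff[of t y] std_pairs_distinct t ly by metis
    qed
    ultimately show ?thesis by (simp add: f_def)
  next
    case False
    have zero: "cw t x * (\<Prod>q<m. u (y ! q) (x ! q)) = 0" if x: "x \<in> indices n m" "x \<noteq> y" for x
    proof (rule ccontr)
      assume nz: "cw t x * (\<Prod>q<m. u (y ! q) (x ! q)) \<noteq> 0"
      have lx: "length x = m" using x by (simp add: indices_def)
      have std: "std_pairs (mset (zip t x))" using nz cw_nonzero_iff[of t x] t lx by simp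
      have le: "y ! q \<le> x ! q" if "q < m" for q
      proof (rule ccontr)
        assume "\<not> y ! q \<le> x ! q"
        then have "u (y ! q) (x ! q) = 0"
          using u[of "y ! q" "x ! q"] indices_nth[OF x(1) that] indices_nth[OF y that] by simp
        then show False using nz that by auto
      qed
      \<comment> \<open>If \<open>y ! q\<close> were smaller than \<open>v\<close>, this smaller
        value would occur in \<open>x\<close> inside the same block, at some \<open>r\<close>. By
        induction \<open>y ! r\<close> is that value too, a repetition in \<open>y\<close> that is
        excluded in this case.\<close>
      have "q < m \<Longrightarrow> x ! q = v \<Longrightarrow> y ! q = v" for q v
      proof (induction v arbitrary: q rule: less_induct)
        case (less v)
        show ?case
        proof (rule ccontr)
          assume "y ! q \<noteq> v"
          then have lt: "y ! q < v" using le[OF less.prems(1)] less.prems(2) by simp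
          have "(t ! q, v) \<in> set (zip t x)"
            unfolding in_set_zip using less.prems t lx by (intro exI[of _ q]) auto
          then have "count (mset (zip t x)) (t ! q, v) \<noteq> 0" by (metis count_mset_0_iff)
          then have "v \<le> count_list t (t ! q)" using count_zip_std[OF std] t lx by (auto split: if_splits)
          then have "count (mset (zip t x)) (t ! q, y ! q) = 1"
            using count_zip_std[OF std, of "t ! q" "y ! q"] t lx lt indices_nth[OF y less.prems(1)] by simp
          then have "(t ! q, y ! q) \<in> set (zip t x)" by (metis count_mset_0_iff zero_neq_one)
          then obtain r where r: "r < m" "t ! r = t ! q" "x ! r = y ! q" unfolding in_set_zip using t by auto
          then have "y ! r = y ! q" using less.IH[OF lt r(1,3)] by simp
          moreover have "r \<noteq> q" using r lt less.prems by auto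
          ultimately show False using False r less.prems(1) by metis
        qed
      qed
      then have "x = y" using lx ly by (intro nth_equalityI) auto
      then show False using x by simp
    qed
    have "(\<Sum>x\<in>indices n m. cw t x * (\<Prod>q<m. u (y ! q) (x ! q))) =
        (\<Sum>x\<in>{y}. cw t x * (\<Prod>q<m. u (y ! q) (x ! q)))"
      using y zero by (intro sum.mono_neutral_right finite_indices) auto
    also have "(\<Prod>q<m. u (y ! q) (y ! q)) = 1"
      using u indices_nth[OF y] by (intro prod.neutral) blast
    then have "(\<Sum>x\<in>{y}. cw t x * (\<Prod>q<m. u (y ! q) (x ! q))) = cw t y" by simp
    finally show ?thesis .
  qed
qed

lemma row_tables_prod_sum:
  fixes f :: "nat \<Rightarrow> nat list \<Rightarrow> complex"
  shows "(\<Sum>X\<in>row_tables n d m. \<Prod>l<d. f l (X ! l)) = (\<Prod>l<d. \<Sum>x\<in>indices n m. f l x)"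
proof (induction d arbitrary: f)
  case 0
  have "row_tables n 0 m = {[]}" by (auto simp: row_tables_def)
  then show ?case by simp
next
  case (Suc d)
  have "row_tables n (Suc d) m = (\<lambda>(x, X). x # X) ` (indices n m \<times> row_tables n d m)"
    by (auto simp: row_tables_def length_Suc_conv image_iff)
  then have "(\<Sum>X\<in>row_tables n (Suc d) m. \<Prod>l<Suc d. f l (X ! l)) =
      (\<Sum>x\<in>indices n m. \<Sum>X\<in>row_tables n d m. \<Prod>l<Suc d. f l ((x # X) ! l))"
    by (simp add: sum.reindex inj_on_def sum.cartesian_product case_prod_unfold)
  also have "\<dots> = (\<Sum>x\<in>indices n m. f 0 x * (\<Sum>X\<in>row_tables n d m. \<Prod>l<d. f (Suc l) (X ! l)))"
    by (simp add: lessThan_Suc_eq_insert_0 prod.reindex sum_distrib_left)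
  also have "\<dots> = (\<Prod>l<Suc d. \<Sum>x\<in>indices n m. f l x)"
    unfolding Suc.IH[of "\<lambda>l. f (Suc l)"]
    by (simp add: lessThan_Suc_eq_insert_0 prod.reindex sum_distrib_right)
  finally show ?case .
qed

lemma prod_nth_count_list:
  fixes f :: "nat \<Rightarrow> complex"
  assumes "set x \<subseteq> {1..n}"
  shows "(\<Prod>q<length x. f (x ! q)) = (\<Prod>i=1..n. f i ^ count_list x i)"
  using assms
proof (induction x)
  case (Cons k x)
  have "(\<Prod>i=1..n. f i ^ count_list (k # x) i) = (\<Prod>i=1..n. (if i = k then f k else 1) * f i ^ count_list x i)"
    by (intro prod.cong) auto
  also have "\<dots> = f k * (\<Prod>i=1..n. f i ^ count_list x i)"
    using Cons.prems by (simp add: prod.distrib)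
  finally show ?case using Cons by (simp add: lessThan_Suc_eq_insert_0 prod.reindex)
qed simp

section \<open>Weights under the torus and unipotent invariance\<close>

definition tab_weight :: "nat \<Rightarrow> nat \<Rightarrow> mats \<Rightarrow> table \<Rightarrow> complex" where
  "tab_weight n d g X = (\<Prod>l<d. \<Prod>i=1..n. g l i i ^ count_list (X ! l) i)"

context power_algebra
begin

lemma act_torus_E:
  assumes d: "1 \<le> d" and g: "g \<in> torus n d" and X: "X \<in> row_tables n d m"
  shows "act n g (E (cols X)) = cscale (tab_weight n d g X) (E (cols X))"
proof -
  let ?c = "\<lambda>Y. \<Prod>l<d. \<Prod>q<m. g l (Y ! l ! q) (X ! l ! q)"
  have rX: "rect d m X" by (rule row_tables_rect[OF X])
  have Xin: "X ! l \<in> indices n m" if "l < d" for l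
    using X that nth_mem by (fastforce simp: row_tables_def)
  have zero: "cscale (?c Y) (E (cols Y)) = 0" if Y: "Y \<in> row_tables n d m - {X}" for Y
  proof -
    have rY: "rect d m Y" using Y row_tables_rect by blast
    obtain l where l: "l < d" "Y ! l \<noteq> X ! l"
      using Y rect_length[OF rX] rect_length[OF rY] nth_equalityI[of Y X] by auto
    then obtain q where q: "q < m" "Y ! l ! q \<noteq> X ! l ! q"
      using rect_nth[OF rX] rect_nth[OF rY] nth_equalityI[of "Y ! l" "X ! l"] by metis
    have "Y ! l \<in> indices n m" using Y l rect_length[OF rY] nth_mem by (fastforce simp: row_tables_def)
    then have "Y ! l ! q \<in> {1..n}" "X ! l ! q \<in> {1..n}"
      using indices_nth[OF Xin[OF l(1)] q(1)] indices_nth[of "Y ! l" n m q] q by blast+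
    moreover have "\<forall>i\<in>{1..n}. \<forall>j\<in>{1..n}. g l i j \<noteq> 0 \<longleftrightarrow> i = j"
      using g l by (simp add: torus_def)
    ultimately have "g l (Y ! l ! q) (X ! l ! q) = 0" using q(2) by blast
    then have "(\<Prod>q<m. g l (Y ! l ! q) (X ! l ! q)) = 0" using q by auto
    then have "?c Y = 0" using l by auto
    then show ?thesis by simp
  qed
  have "act n g (E (cols X)) = (\<Sum>Y\<in>{X}. cscale (?c Y) (E (cols Y)))"
    unfolding act_E_table[OF rX d]
    using X zero by (intro sum.mono_neutral_right finite_row_tables) auto
  moreover have "?c X = tab_weight n d g X"
    unfolding tab_weight_def
  proof (rule prod.cong[OF refl])
    fix l assume "l \<in> {..<d}"
    then have "X ! l \<in> indices n m" using Xin by simp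
    then show "(\<Prod>q<m. g l (X ! l ! q) (X ! l ! q)) = (\<Prod>i = 1..n. g l i i ^ count_list (X ! l) i)"
      using prod_nth_count_list[of "X ! l" n "\<lambda>i. g l i i"] by (simp add: indices_def)
  qed
  ultimately show ?thesis by simp
qed

lemma Alg_combination:
  assumes "\<And>i. i \<in> I \<Longrightarrow> p i \<in> Alg n d"
  shows "(\<Sum>i\<in>I. cscale (c i) (p i)) \<in> Alg n d"
  unfolding Alg_def
proof (clarify)
  fix K x assume K: "K \<in> keys (\<Sum>i\<in>I. cscale (c i) (p i))" and x: "x \<in> set (repr K)"
  then have "(\<Sum>i\<in>I. c i * lookup (p i) K) \<noteq> 0" by (simp add: in_keys_iff lookup_sum)
  then obtain i where i: "i \<in> I" "c i * lookup (p i) K \<noteq> 0" by (meson sum.neutral)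
  then have "K \<in> keys (p i)" by (auto simp: in_keys_iff)
  then show "x \<in> indices n d" using assms[OF i(1)] x by (auto simp: Alg_def)
qed

lemma E_Alg: "set cs \<subseteq> indices n d \<Longrightarrow> E cs \<in> Alg n d"
proof (cases "s = 1 \<or> distinct cs")
  case True
  assume "set cs \<subseteq> indices n d"
  then show ?thesis using repr_key[OF True] by (auto simp: Alg_def E_def split: if_splits)
qed (simp add: E_not_ok Alg_def)

lemma row_table_columns:
  "X \<in> row_tables n d m \<Longrightarrow> 1 \<le> d \<Longrightarrow> set (cols X) \<subseteq> indices n d"
  using transpose_row_tables[of d n m] by (auto simp: bij_betw_def)

lemma tab_row_tables:
  "set cs \<subseteq> indices n d \<Longrightarrow> 1 \<le> d \<Longrightarrow> tab d cs \<in> row_tables n d (length cs)"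
proof -
  assume cs: "set cs \<subseteq> indices n d" and d: "1 \<le> d"
  have "cs \<in> cols ` row_tables n d (length cs)"
    using transpose_row_tables[OF d, of n "length cs"] cs by (auto simp: bij_betw_def)
  then obtain X where X: "X \<in> row_tables n d (length cs)" "cs = cols X" by blast
  then have "tab d cs = X" using tab_transpose[OF row_tables_rect d] by blast
  then show ?thesis using X(1) by simp
qed

lemma lookup_act_torus:
  assumes d: "1 \<le> d" and g: "g \<in> torus n d" and p: "p \<in> Alg n d"
  shows "lookup (act n g p) K = tab_weight n d g (tab d (repr K)) * lookup p K"
proof -
  have "act n g p = (\<Sum>L\<in>keys p. cscale (lookup p L) (act_cols n g (repr L)))"
    unfolding act_def lin_def by (simp add: prds_expand act_cols_def)
  also have "\<dots> = (\<Sum>L\<in>keys p. cscale (lookup p L)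
      (cscale (tab_weight n d g (tab d (repr L))) (single L 1)))"
  proof (rule sum.cong[OF refl])
    fix L assume "L \<in> keys p"
    then have L: "set (repr L) \<subseteq> indices n d" using p by (auto simp: Alg_def)
    have "cols (tab d (repr L)) = repr L"
      using L by (intro transpose_tab[OF _ d]) (auto simp: indices_def)
    then have "act_cols n g (repr L) = cscale (tab_weight n d g (tab d (repr L))) (E (repr L))"
      using act_torus_E[OF d g tab_row_tables[OF L d]] by (simp add: act_E)
    then show "cscale (lookup p L) (act_cols n g (repr L)) = cscale (lookup p L)
      (cscale (tab_weight n d g (tab d (repr L))) (single L 1))" by (simp add: E_repr)
  qed
  finally show ?thesis
    by (auto simp: lookup_sum lookup_single when_def in_keys_iff if_distrib[of "(*) _"] cong: if_cong)
qed

lemma weight_char_tab_weight: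
  assumes "length al = d" "X \<in> tabA al"
  shows "weight_char n al g = tab_weight n d g X"
  unfolding weight_char_def tab_weight_def using assms
  by (intro prod.cong) (auto simp: tabA_nth words_count)

text \<open>Products of basis vectors are eigenvectors of the torus, and the torus separates
  contents. The condition \<open>rect\<close> is stated separately because the rows of an element of
  \<open>tabA al\<close> share a length only if the entries of \<open>al\<close> have equal
  sums.\<close>

lemma WV_iff:
  assumes al: "length al = d" "\<And>a. a \<in> set al \<Longrightarrow> length a \<le> n" and d: "1 \<le> d"
  shows "p \<in> WV n al \<longleftrightarrow> (\<forall>K\<in>keys p. \<exists>S\<in>tabA al. rect d (length (repr K)) S \<and> repr K = cols S)"
proof
  assume p: "p \<in> WV n al"
  then have A: "p \<in> Alg n d" using al by (simp add: WV_def)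
  show "\<forall>K\<in>keys p. \<exists>S\<in>tabA al. rect d (length (repr K)) S \<and> repr K = cols S"
  proof
    fix K assume K: "K \<in> keys p"
    then have cs: "set (repr K) \<subseteq> indices n d" using A by (auto simp: Alg_def)
    let ?X = "tab d (repr K)"
    have X: "?X \<in> row_tables n d (length (repr K))" by (rule tab_row_tables[OF cs d])
    have w: "tab_weight n d g ?X = weight_char n al g" if g: "g \<in> torus n d" for g
    proof -
      have "act n g p = cscale (weight_char n al g) p" using p g al by (auto simp: WV_def)
      then have "tab_weight n d g ?X * lookup p K = weight_char n al g * lookup p K"
        using lookup_act_torus[OF d g A, of K] by (metis lookup_cscale)
      then show ?thesis using K by (simp add: in_keys_iff)
    qed
    have "?X \<in> tabA al"
      unfolding tabA_nth words_count
    proof (intro conjI allI impI)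
      show lX: "length ?X = length al" using al by (simp add: tab_def)
      fix l i assume "l < length al"
      then have l: "l < d" using al by simp
      show "count_list (?X ! l) i = entry (al ! l) i"
      proof (cases "i \<in> {1..n}")
        case True
        \<comment> \<open>One diagonal entry is 2 and all others are 1: the eigenvalue is 2 to the
          multiplicity of the letter \<open>i\<close> in row \<open>l\<close>, and this power
          determines the multiplicity.\<close>
        define g :: mats where "g = (\<lambda>l' i' j'. if i' \<noteq> j' then 0 else if l' = l \<and> i' = i then 2 else 1)"
        have g: "g \<in> torus n d" by (auto simp: torus_def g_def)
        have e: "(\<Prod>l'<d. \<Prod>i'=1..n. g l' i' i' ^ f l' i') = 2 ^ f l i" for f
        proof -
          have "(\<Prod>i'=1..n. g l' i' i' ^ f l' i') = (if l' = l then 2 ^ f l i else 1)" for l'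
          proof (cases "l' = l")
            case True
            have "(\<Prod>i'=1..n. g l i' i' ^ f l i') = (\<Prod>i'=1..n. if i' = i then 2 ^ f l i else 1)"
              by (intro prod.cong) (auto simp: g_def)
            then show ?thesis using \<open>i \<in> {1..n}\<close> True by simp
          qed (simp add: g_def)
          then show ?thesis using l by simp
        qed
        have "(2::complex) ^ count_list (?X ! l) i = 2 ^ entry (al ! l) i"
          using w[OF g] unfolding tab_weight_def weight_char_def al(1) e .
        then have "of_nat (2 ^ count_list (?X ! l) i) = (of_nat (2 ^ entry (al ! l) i) :: complex)" by simp
        then have "(2::nat) ^ count_list (?X ! l) i = 2 ^ entry (al ! l) i" by (simp only: of_nat_eq_iff)
        then show ?thesis by simp
      next
        case False
        have "set (?X ! l) \<subseteq> {1..n}"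
        proof -
          have "?X ! l \<in> set ?X" using l X by (intro nth_mem) (simp add: row_tables_def)
          then have "?X ! l \<in> indices n (length (repr K))" using X unfolding row_tables_def by blast
          then show ?thesis by (simp add: indices_def)
        qed
        then have "i \<notin> set (?X ! l)" using False by auto
        moreover have "length (al ! l) \<le> n" using al l by simp
        ultimately show ?thesis using False by (auto simp: entry_def)
      qed
    qed
    moreover have "cols ?X = repr K"
      using cs by (intro transpose_tab[OF _ d]) (auto simp: indices_def)
    ultimately show "\<exists>S\<in>tabA al. rect d (length (repr K)) S \<and> repr K = cols S"
      using rect_tab by metis
  qed
next
  assume *: "\<forall>K\<in>keys p. \<exists>S\<in>tabA al. rect d (length (repr K)) S \<and> repr K = cols S"
  have rt: "S \<in> row_tables n d m" if tS: "S \<in> tabA al" and rS: "rect d m S" for S m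
    unfolding row_tables_def indices_def
  proof safe
    show "length S = d" using tS al by (simp add: tabA_nth)
    fix r assume "r \<in> set S"
    then obtain l where l: "l < d" "r = S ! l" using rect_length[OF rS] by (metis in_set_conv_nth)
    then show "length r = m" using rect_nth[OF rS] by simp
    fix i assume "i \<in> set r"
    then have "i \<in> {1..length (al ! l)}" using words_letters[of r "al ! l"] tS al l by (auto simp: tabA_nth)
    moreover have "length (al ! l) \<le> n" using al l by simp
    ultimately show "i \<in> {1..n}" by auto
  qed
  have A: "p \<in> Alg n d"
    unfolding Alg_def
  proof (clarify)
    fix K x assume K: "K \<in> keys p" and x: "x \<in> set (repr K)"
    obtain S where S: "S \<in> tabA al" "rect d (length (repr K)) S" "repr K = cols S" using * K by blast
    then show "x \<in> indices n d" using row_table_columns[OF rt[OF S(1,2)] d] x by auto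
  qed
  have "act n g p = cscale (weight_char n al g) p" if g: "g \<in> torus n d" for g
  proof (rule poly_mapping_eqI)
    fix K
    show "lookup (act n g p) K = lookup (cscale (weight_char n al g) p) K"
    proof (cases "K \<in> keys p")
      case True
      then obtain S where S: "S \<in> tabA al" "rect d (length (repr K)) S" "repr K = cols S" using * by blast
      then have "tab d (repr K) = S" using tab_transpose[OF S(2) d] by simp
      then show ?thesis
        using lookup_act_torus[OF d g A, of K] weight_char_tab_weight[OF al(1) S(1)] by simp
    next
      case False
      then show ?thesis using lookup_act_torus[OF d g A, of K] by (simp add: in_keys_iff)
    qed
  qed
  then show "p \<in> WV n al" using A al by (simp add: WV_def)
qed

lemma act_combination:
  "act n g (\<Sum>i\<in>I. cscale (c i) (p i)) = (\<Sum>i\<in>I. cscale (c i) (act n g (p i)))"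
  by (simp add: linear_cscale_sum[OF act_linear] linear_cscale_scale[OF act_linear])

lemma HWV_combination:
  assumes "\<And>i. i \<in> I \<Longrightarrow> p i \<in> HWV n al"
  shows "(\<Sum>i\<in>I. cscale (c i) (p i)) \<in> HWV n al"
  unfolding HWV_def WV_def
proof (intro CollectI conjI ballI)
  show "(\<Sum>i\<in>I. cscale (c i) (p i)) \<in> Alg n (length al)"
    using assms by (intro Alg_combination) (simp add: HWV_def WV_def)
  show "act n g (\<Sum>i\<in>I. cscale (c i) (p i)) = cscale (weight_char n al g) (\<Sum>i\<in>I. cscale (c i) (p i))"
    if "g \<in> torus n (length al)" for g
    unfolding act_combination cvec.scale_sum_right
    using assms that by (intro sum.cong) (auto simp: HWV_def WV_def mult.commute)
  show "act n u (\<Sum>i\<in>I. cscale (c i) (p i)) = (\<Sum>i\<in>I. cscale (c i) (p i))"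
    if "u \<in> unitriangular n (length al)" for u
    unfolding act_combination using assms that by (intro sum.cong) (auto simp: HWV_def)
qed

text \<open>Once the sums over \<open>X\<close> and \<open>Y\<close> are exchanged, the coefficient
  of each \<open>Y\<close> is a product over rows, and every row is an instance of
  \<open>cw_unitriangular\<close>.\<close>

lemma Phi_unitriangular:
  assumes T: "rect d m T" and d: "1 \<le> d" and u: "u \<in> unitriangular n d"
  shows "act n u (Phi n d m T) = Phi n d m T"
proof -
  let ?c = "\<lambda>X Y. \<Prod>l<d. \<Prod>q<m. u l (Y ! l ! q) (X ! l ! q)"
  have "act n u (Phi n d m T) = (\<Sum>X\<in>row_tables n d m. \<Sum>Y\<in>row_tables n d m.
      cscale (CT T X * ?c X Y) (E (cols Y)))"
    unfolding Phi_def act_combination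
    by (intro sum.cong refl) (simp add: act_E_table[OF row_tables_rect d] cvec.scale_sum_right)
  also have "\<dots> = (\<Sum>Y\<in>row_tables n d m. \<Sum>X\<in>row_tables n d m.
      cscale (CT T X * ?c X Y) (E (cols Y)))"
    by (rule sum.swap)
  also have "\<dots> = (\<Sum>Y\<in>row_tables n d m. cscale (CT T Y) (E (cols Y)))"
  proof (rule sum.cong[OF refl])
    fix Y assume Y: "Y \<in> row_tables n d m"
    have Yin: "Y ! l \<in> indices n m" if "l < d" for l
      using Y that nth_mem by (fastforce simp: row_tables_def)
    have "(\<Sum>X\<in>row_tables n d m. CT T X * ?c X Y) =
        (\<Sum>X\<in>row_tables n d m. \<Prod>l<d. cw (T ! l) (X ! l) * (\<Prod>q<m. u l (Y ! l ! q) (X ! l ! q)))"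
      by (intro sum.cong refl)
        (simp add: CT_prod[of T d] rect_length[OF T] rect_length[OF row_tables_rect] prod.distrib)
    also have "\<dots> = (\<Prod>l<d. \<Sum>x\<in>indices n m. cw (T ! l) x * (\<Prod>q<m. u l (Y ! l ! q) (x ! q)))"
      by (rule row_tables_prod_sum[where f = "\<lambda>l x. cw (T ! l) x * (\<Prod>q<m. u l (Y ! l ! q) (x ! q))"])
    also have "\<dots> = (\<Prod>l<d. cw (T ! l) (Y ! l))"
      using u Yin by (intro prod.cong refl cw_unitriangular) (auto simp: rect_nth[OF T] unitriangular_def)
    also have "\<dots> = CT T Y"
      using rect_length[OF T] rect_length[OF row_tables_rect[OF Y]] by (simp add: CT_prod)
    finally show "(\<Sum>X\<in>row_tables n d m. cscale (CT T X * ?c X Y) (E (cols Y))) =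
        cscale (CT T Y) (E (cols Y))"
      by (simp add: cvec.scale_sum_left[symmetric])
  qed
  finally show ?thesis by (simp add: Phi_def)
qed

lemma Phi_HWV:
  assumes "conj_shape d m lam" and T: "T \<in> tabA (map conj_part lam)"
  shows "Phi n d m T \<in> HWV n lam"
proof -
  interpret conj_shape d m lam by fact
  have r: "rect d m T" by (rule tabA_rect[OF T])
  show ?thesis
    unfolding HWV_def WV_def length_lam
  proof (intro CollectI conjI ballI)
    show "Phi n d m T \<in> Alg n d"
      unfolding Phi_def by (intro Alg_combination E_Alg row_table_columns d_pos)
    show "act n g (Phi n d m T) = cscale (weight_char n lam g) (Phi n d m T)" if g: "g \<in> torus n d" for g
      unfolding Phi_def act_combination cvec.scale_sum_right
    proof (rule sum.cong[OF refl])
      fix X assume X: "X \<in> row_tables n d m"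
      show "cscale (CT T X) (act n g (E (cols X))) =
          cscale (weight_char n lam g) (cscale (CT T X) (E (cols X)))"
      proof (cases "CT T X = 0")
        case False
        then have "X \<in> tabA lam" using CT_nonzero_tabA[OF T row_tables_rect[OF X]] by blast
        then show ?thesis
          using act_torus_E[OF d_pos g X] weight_char_tab_weight[OF length_lam] by (simp add: mult.commute)
      qed simp
    qed
    show "act n u (Phi n d m T) = Phi n d m T" if "u \<in> unitriangular n d" for u
      by (rule Phi_unitriangular[OF r d_pos that])
  qed
qed

lemma Phi_boundary:
  assumes "conj_shape d m lam" and l: "l < d" and ij: "1 \<le> i" "i < j" "j \<le> length (map conj_part lam ! l)"
    and Y: "Y \<in> tabA (move l i j (map conj_part lam))"
  shows "(\<Sum>S\<in>boundary l j i Y. Phi n d m S) = 0"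
proof -
  interpret conj_shape d m lam by fact
  have "(\<Sum>S\<in>boundary l j i Y. Phi n d m S) =
      (\<Sum>X\<in>row_tables n d m. \<Sum>S\<in>boundary l j i Y. cscale (CT S X) (E (cols X)))"
    unfolding Phi_def by (rule sum.swap)
  also have "\<dots> = (\<Sum>X\<in>row_tables n d m. cscale (\<Sum>S\<in>boundary l j i Y. CT S X) (E (cols X)))"
    by (simp add: cvec.scale_sum_left)
  also have "\<dots> = 0"
    using CT_boundary_sum[OF l ij Y row_tables_rect] by (intro sum.neutral) simp
  finally show ?thesis .
qed

end

section \<open>The kernel\<close>

lemma table_norm_nonzero: "table_norm T \<noteq> 0"
  by (simp add: table_norm_def)

lemma table_norm_distinct: "distinct (cols T) \<Longrightarrow> table_norm T = 1"
proof -
  assume "distinct (cols T)"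
  then have "count_list (cols T) c = 1" if "c \<in> set (cols T)" for c
    using that by (metis count_mset distinct_count_atmost_1)
  then show ?thesis by (simp add: table_norm_def)
qed

lemma table_norm_pcol:
  assumes "rect d m T" "1 \<le> d" "p permutes {..<m}"
  shows "table_norm (pcol p T) = table_norm T"
proof -
  have p: "p permutes {..<length (cols T)}" using assms by (simp add: length_transpose_rect)
  have "count_list (permute_list p (cols T)) c = count_list (cols T) c" for c
    using mset_permute_list[OF p] by (metis count_mset)
  then show ?thesis
    unfolding table_norm_def transpose_pcol[OF assms] set_permute_list[OF p] by simp
qed

text \<open>Parts are nonzero, so the vector padded by zeros still shows the length of the
  partition.\<close>

lemma words_eq_imp_eq:
  assumes "is_partition m p" "is_partition m' p'" "x \<in> words p" "x \<in> words p'"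
  shows "p = p'"
proof -
  have e: "entry p i = entry p' i" for i using assms(3,4) words_count by metis
  have *: "i \<le> length q \<longleftrightarrow> entry q i \<noteq> 0" if "is_partition k q" "1 \<le> i" for i k q
  proof (cases "i \<le> length q")
    case True
    then have "q ! (i - 1) \<in> set q" using that(2) by (intro nth_mem) auto
    then have "q ! (i - 1) \<noteq> 0" using that(1) by (metis is_partition_def)
    then show ?thesis using True that(2) by (simp add: entry_def)
  qed (simp add: entry_def)
  have "i \<le> length p \<longleftrightarrow> i \<le> length p'" if "1 \<le> i" for i
    using *[OF assms(1) that] *[OF assms(2) that] e by simp
  then have "length p = length p'" by (metis One_nat_def Suc_le_eq bot_nat_0.extremum_unique le_antisym le_refl not_less_eq_eq)
  then show ?thesis using e by (intro nth_equalityI) (auto simp: nth_entry)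
qed

text \<open>A table determines its content and hence its shape; for this reason functionals
  belonging to different shapes have disjoint supports.\<close>

lemma tabA_eq_imp_eq:
  assumes "conj_shape d m lam" "conj_shape d m' lam'" "X \<in> tabA lam" "X \<in> tabA lam'"
  shows "lam = lam'"
proof -
  interpret a: conj_shape d m lam by fact
  interpret b: conj_shape d m' lam' by fact
  show ?thesis
  proof (rule nth_equalityI)
    show "length lam = length lam'" by (simp add: a.length_lam b.length_lam)
    fix l assume "l < length lam"
    then have l: "l < d" by (simp add: a.length_lam)
    then show "lam ! l = lam' ! l"
      using assms(3,4) by (intro words_eq_imp_eq[OF a.part[OF l] b.part[OF l], of "X ! l"])
        (auto simp: tabA_nth a.length_lam b.length_lam)
  qed
qed

lemma alternates_sum:
  assumes "\<And>i. i \<in> I \<Longrightarrow> alternates s (G i)"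
  shows "alternates s (\<lambda>cs. \<Sum>i\<in>I. G i cs)"
  unfolding alternates_def
proof (intro allI)
  fix xs a b ys
  have "(\<Sum>i\<in>I. G i (xs @ a # b # ys)) = (\<Sum>i\<in>I. s * G i (xs @ b # a # ys))"
    by (intro sum.cong refl alternatesD assms)
  then show "(\<Sum>i\<in>I. G i (xs @ a # b # ys)) = s * (\<Sum>i\<in>I. G i (xs @ b # a # ys))"
    by (simp only: sum_distrib_left)
qed

lemma alternates_tab:
  assumes s: "s = 1 \<or> s = - 1"
    and G: "\<And>X p. rect d m X \<Longrightarrow> p permutes {..<m} \<Longrightarrow> G (pcol p X) = perm_eps s m p * G X"
  shows "alternates s (\<lambda>cs. if length cs = m then G (tab d cs) else 0)"
proof (rule alternatesI_permute[OF s])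
  fix p and cs :: "'a list list" assume p: "p permutes {..<length cs}"
  show "(if length (permute_list p cs) = m then G (tab d (permute_list p cs)) else 0) =
      perm_eps s (length cs) p * (if length cs = m then G (tab d cs) else 0)"
    using p tab_permute_list[OF p, of d] G[of "tab d cs" p] rect_tab[of d cs] by auto
qed

text \<open>The source carries the products indexed by tables, the target the vectors attached to
  them. The parity condition leaves the four combinations of the theorem.\<close>

locale kernel_pair =
  src: power_algebra s1 key1 repr1 prd1 + tgt: power_algebra s2 key2 repr2 prd2
  for s1 key1 repr1 and prd1 :: "('k \<Rightarrow>\<^sub>0 complex) \<Rightarrow> ('k \<Rightarrow>\<^sub>0 complex) \<Rightarrow> ('k \<Rightarrow>\<^sub>0 complex)"
    and s2 key2 repr2 and prd2 :: "('h \<Rightarrow>\<^sub>0 complex) \<Rightarrow> ('h \<Rightarrow>\<^sub>0 complex) \<Rightarrow> ('h \<Rightarrow>\<^sub>0 complex)" +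
  fixes n d :: nat
  assumes parity: "s1 * s2 = (- 1) ^ d" and d: "1 \<le> d"
begin

text \<open>
  With this weight the linear map of the theorem sends \<open>F S\<close> to \<open>Phi S\<close> for every table \<open>S\<close>, without
  denominators and without ordering the columns.
\<close>

definition F :: "table \<Rightarrow> ('k \<Rightarrow>\<^sub>0 complex)" where
  "F S = cscale (table_norm S) (src.E (cols S))"

lemma F_pcol:
  assumes "rect d m S" "p permutes {..<m}"
  shows "F (pcol p S) = cscale (perm_eps s1 m p) (F S)"
  using src.E_permute_list[of p "cols S"] assms d
  by (simp add: F_def table_norm_pcol transpose_pcol length_transpose_rect mult.commute)

lemma Phi_pcol_s1:
  assumes "rect d m T" "p permutes {..<m}"
  shows "tgt.Phi n d m (pcol p T) = cscale (perm_eps s1 m p) (tgt.Phi n d m T)"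
proof -
  have "s2 * (- 1) ^ d = s1" unfolding parity[symmetric] using tgt.s_sq by (simp add: ac_simps)
  then show ?thesis using tgt.Phi_pcol[OF assms(1) d assms(2)] by simp
qed

text \<open>The values \<open>fn \<theta> (F T)\<close> form a highest weight function of tables,
  since \<theta> kills the boundary sums. Elimination expands it in the columns of
  \<open>CT\<close>, and averaging makes the coefficients alternate with the sign \<open>s2\<close>
  of the target.\<close>

lemma shape_functional:
  assumes cs: "conj_shape d m lam" and n: "\<And>p. p \<in> set lam \<Longrightarrow> length p \<le> n"
    and \<theta>: "\<And>l i j Y. l < d \<Longrightarrow> 1 \<le> i \<Longrightarrow> i < j \<Longrightarrow> j \<le> length (map conj_part lam ! l) \<Longrightarrow>
      Y \<in> tabA (move l i j (map conj_part lam)) \<Longrightarrow> fn \<theta> (\<Sum>S\<in>boundary l j i Y. F S) = 0"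
  obtains G where "alternates s2 G" "\<And>cs. G cs \<noteq> 0 \<Longrightarrow> tab d cs \<in> tabA lam"
    "\<And>T. T \<in> tabA (map conj_part lam) \<Longrightarrow>
      (\<Sum>X\<in>row_tables n d m. G (cols X) * CT T X) = fn \<theta> (F T)"
proof -
  interpret conj_shape d m lam by fact
  define A where "A l = content (conj_part (lam ! l))" for l
  define h where "h T = (if T \<in> tabA mu then fn \<theta> (F T) else 0)" for T
  have W: "{T. length T = d \<and> (\<forall>l<d. mset (T ! l) = A l)} = tabA mu"
    by (auto simp: tabA_mu A_def)
  have h_hw: "repl a b (\<lambda>w. h (T[l := w])) y = 0"
    if l: "l < d" and T: "length T = d" and ab: "1 \<le> a" "a < b" for l T a b y
  proof (rule ccontr)
    assume nz: "repl a b (\<lambda>w. h (T[l := w])) y \<noteq> 0"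
    \<comment> \<open>A nonvanishing term shows that \<open>b\<close> is a letter of the shape and
      that \<open>Y\<close> has the moved content; so one of the given relations applies to
      \<open>Y\<close> and forces the sum to vanish.\<close>
    then obtain q where q: "q < length y" "y ! q = a" "h (T[l := y[q := b]]) \<noteq> 0"
      unfolding repl_sum by (metis (mono_tags, lifting) mem_Collect_eq sum.neutral)
    define Y where "Y = T[l := y]"
    have Y: "length Y = length mu" "Y ! l = y" using T l by (auto simp: Y_def length_lam)
    have mem: "Y[l := (Y ! l)[q := b]] \<in> tabA mu"
      using q(3) Y by (auto simp: h_def Y_def split: if_splits)
    have lt: "l < length mu" using l by (simp add: length_lam)
    have "(Y ! l)[q := b] \<in> words (mu ! l)" using mem lt Y by (auto simp: tabA_nth)
    moreover have "b \<in> set ((Y ! l)[q := b])" using q(1) Y by (simp add: set_update_memI)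
    ultimately have b: "b \<le> length (mu ! l)" using words_letters by fastforce
    have "1 \<le> entry (mu ! l) b"
      using entry_conj_part_pos[OF part[OF l], of b] ab b mu_nth[OF l] by simp
    then have YM: "Y \<in> tabA (move l a b mu)"
      using tabA_move[OF ab b _ lt _ _ Y(1), of q] mem q Y by simp
    have "repl a b (\<lambda>w. h (T[l := w])) y = repl a b (\<lambda>w. h (Y[l := w])) (Y ! l)"
      by (simp add: Y(2)) (simp add: Y_def)
    also have "\<dots> = (\<Sum>S\<in>boundary l b a Y. h S)"
      by (rule boundary_sum_repl[symmetric]) (use ab l T in \<open>auto simp: Y_def\<close>)
    also have "\<dots> = (\<Sum>S\<in>boundary l b a Y. fn \<theta> (F S))"
      using boundary_tabA[OF l ab b YM] by (intro sum.cong) (auto simp: h_def)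
    also have "\<dots> = 0" using \<theta>[OF l ab b YM] by (simp add: fn_sum)
    finally show False using nz by simp
  qed
  \<comment> \<open>The bound on the lengths enters here: a rank is at most a multiplicity in the
    conjugate partition, hence at most the length of the partition.\<close>
  have ranks_in: "map ranks ` tabA mu \<subseteq> row_tables n d m"
  proof safe
    fix T assume T: "T \<in> tabA mu"
    have "ranks r \<in> indices n m" if r: "r \<in> set T" for r
    proof -
      obtain l where l: "l < d" "r = T ! l" using r rect_length[OF tabA_rect[OF T]] by (metis in_set_conv_nth)
      have w: "r \<in> words (conj_part (lam ! l))" using T l by (simp add: tabA_nth length_lam)
      have "1 \<le> v \<and> v \<le> n" if "v \<in> set (ranks r)" for v
      proof -
        have "v \<in> snd ` set (zip r (ranks r))" using that by (metis length_ranks map_snd_zip set_map)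
        then obtain k where "(k, v) \<in> set (zip r (ranks r))" by auto
        then have "count (mset (zip r (ranks r))) (k, v) \<noteq> 0" by (metis count_mset_0_iff)
        then have "1 \<le> v" "v \<le> count_list r k" unfolding count_zip_ranks by (auto split: if_splits)
        moreover have "count_list r k \<le> length (lam ! l)"
          using w entry_conj_part_le[OF part[OF l(1)]] by (simp add: words_count)
        moreover have "length (lam ! l) \<le> n" using n l length_lam by simp
        ultimately show ?thesis by simp
      qed
      moreover have "length r = m" using rect_nth[OF tabA_rect[OF T] l(1)] l by simp
      ultimately show ?thesis by (auto simp: indices_def)
    qed
    then show "map ranks T \<in> row_tables n d m"
      using rect_length[OF tabA_rect[OF T]] by (auto simp: row_tables_def)
  qed
  have "\<exists>g. \<forall>T. h T = (\<Sum>X\<in>row_tables n d m. g X * (if T \<in> tabA mu then CT T X else 0))"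
    unfolding W[symmetric]
  proof (rule hw_function_span)
    show "0 \<notin># A l" if "l < d" for l
      by (simp add: A_def count_content entry_def flip: count_eq_zero_iff)
    show "map ranks ` {T. length T = d \<and> (\<forall>l<d. mset (T ! l) = A l)} \<subseteq> row_tables n d m"
      unfolding W by (rule ranks_in)
    show "T \<in> {T. length T = d \<and> (\<forall>l<d. mset (T ! l) = A l)}" if "h T \<noteq> 0" for T
      unfolding W using that by (auto simp: h_def split: if_splits)
  qed (use h_hw finite_row_tables in auto)
  then obtain g where g: "h T = (\<Sum>X\<in>row_tables n d m. g X * CT T X)" if "T \<in> tabA mu" for T by auto
  obtain G where G: "\<And>X p. rect d m X \<Longrightarrow> p permutes {..<m} \<Longrightarrow> G (pcol p X) = perm_eps s2 m p * G X"
    and hG: "\<And>T. T \<in> tabA mu \<Longrightarrow> h T = (\<Sum>X\<in>row_tables n d m. G X * CT T X)"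
  proof (rule symmetrize[OF src.s_cases tgt.s_cases parity, where XS = "row_tables n d m" and W = "tabA mu" and h = h and g = g])
    show "h (pcol p T) = perm_eps s1 m p * h T" if "T \<in> tabA mu" "p permutes {..<m}" for T p
      using that pcol_tabA[OF that] F_pcol[OF tabA_rect[OF that(1)] that(2)] by (simp add: h_def fn_scale)
  qed (use finite_row_tables row_tables_rect pcol_row_tables tabA_rect pcol_tabA g in auto)
  \<comment> \<open>Restricting \<open>G\<close> to content \<open>lam\<close> keeps the sum, as
    \<open>CT T X\<close> vanishes for all other \<open>X\<close>, and it confines the support to
    one shape.\<close>
  define G' where "G' X = (if X \<in> tabA lam then G X else 0)" for X
  have lam_pcol: "pcol p X \<in> tabA lam \<longleftrightarrow> X \<in> tabA lam" if "rect d m X" "p permutes {..<m}" for p X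
    using that by (auto simp: tabA_nth words_content length_lam rect_nth rect_length)
  define H where "H cs = (if length cs = m then G' (tab d cs) else 0)" for cs
  show ?thesis
  proof
    show "alternates s2 H"
      unfolding H_def[abs_def]
      by (rule alternates_tab[OF tgt.s_cases]) (simp add: G'_def lam_pcol G)
    show "tab d cs \<in> tabA lam" if "H cs \<noteq> 0" for cs
      using that by (auto simp: H_def G'_def split: if_splits)
    fix T assume T: "T \<in> tabA mu"
    have "(\<Sum>X\<in>row_tables n d m. H (cols X) * CT T X) = (\<Sum>X\<in>row_tables n d m. G X * CT T X)"
    proof (rule sum.cong[OF refl])
      fix X assume "X \<in> row_tables n d m"
      then have X: "rect d m X" by (rule row_tables_rect)
      show "H (cols X) * CT T X = G X * CT T X"
        using CT_nonzero_tabA[OF T X] length_transpose_rect[OF X d] tab_transpose[OF X d]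
        by (cases "CT T X = 0") (auto simp: H_def G'_def)
    qed
    then show "(\<Sum>X\<in>row_tables n d m. H (cols X) * CT T X) = fn \<theta> (F T)"
      using hG[OF T] T by (simp add: h_def)
  qed
qed

text \<open>The shapes may vary with \<open>c\<close>, as they do in algebraic relations. A
  functional \<theta> that kills the span but not the claimed vector yields one functional \<gamma>
  on the target whose value at each \<open>Del n (T c)\<close> is that of \<theta> at the product of
  \<open>T c\<close>; then the given relation forces \<theta> to vanish on the claimed vector after
  all.\<close>

lemma relation_in_span:
  assumes fin: "finite I"
    and lam: "\<And>c. c \<in> I \<Longrightarrow> conj_shape d (mm c) (lam c)" "\<And>c p. c \<in> I \<Longrightarrow> p \<in> set (lam c) \<Longrightarrow> length p \<le> n"
    and T: "\<And>c. c \<in> I \<Longrightarrow> T c \<in> tabA (map conj_part (lam c))"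
    and R: "\<And>c l i j Y. c \<in> I \<Longrightarrow> l < d \<Longrightarrow> 1 \<le> i \<Longrightarrow> i < j \<Longrightarrow> j \<le> length (map conj_part (lam c) ! l) \<Longrightarrow>
      Y \<in> tabA (move l i j (map conj_part (lam c))) \<Longrightarrow> (\<Sum>S\<in>boundary l j i Y. F S) \<in> cvec.span R"
    and rel: "(\<Sum>c\<in>I. cscale (a c) (tgt.Del n (T c))) = 0"
  shows "(\<Sum>c\<in>I. cscale (a c) (src.E (cols (T c)))) \<in> cvec.span R"
proof (rule ccontr)
  assume "(\<Sum>c\<in>I. cscale (a c) (src.E (cols (T c)))) \<notin> cvec.span R"
  then have "(\<Sum>c\<in>I. cscale (a c) (src.E (cols (T c)))) \<notin> cvec.span (cvec.span R)"
    by (simp add: cvec.span_span)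
  then obtain \<theta> where nz: "fn \<theta> (\<Sum>c\<in>I. cscale (a c) (src.E (cols (T c)))) \<noteq> 0"
    and zero: "\<And>r. r \<in> cvec.span R \<Longrightarrow> fn \<theta> r = 0"
    by (rule separating_functional) blast
  define P :: "nat list list \<Rightarrow> (nat list list \<Rightarrow> complex) \<Rightarrow> bool" where "P lm G \<longleftrightarrow> alternates s2 G \<and> (\<forall>cs. G cs \<noteq> 0 \<longrightarrow> tab d cs \<in> tabA lm) \<and>
    (\<forall>m T. conj_shape d m lm \<longrightarrow> T \<in> tabA (map conj_part lm) \<longrightarrow>
      (\<Sum>X\<in>row_tables n d m. G (cols X) * CT T X) = fn \<theta> (F T))" for lm G
  have ex: "\<exists>G. P (lam c) G" if c: "c \<in> I" for c
  proof -
    obtain G where G: "alternates s2 G" "\<And>cs. G cs \<noteq> 0 \<Longrightarrow> tab d cs \<in> tabA (lam c)"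
      "\<And>T. T \<in> tabA (map conj_part (lam c)) \<Longrightarrow>
        (\<Sum>X\<in>row_tables n d (mm c). G (cols X) * CT T X) = fn \<theta> (F T)"
    proof (rule shape_functional[OF lam(1)[OF c] lam(2)[OF c], where \<theta> = \<theta>])
      fix l i j Y assume "l < d" "1 \<le> i" "i < j" "j \<le> length (map conj_part (lam c) ! l)"
        "Y \<in> tabA (move l i j (map conj_part (lam c)))"
      then show "fn \<theta> (\<Sum>S\<in>boundary l j i Y. F S) = 0" by (intro zero R[OF c])
    qed (assumption, blast)
    \<comment> \<open>As \<open>d\<close> is positive, the first partition of the shape fixes
      \<open>m\<close>; so the property \<open>P\<close> can refer to the shape alone.\<close>
    have "m = mm c" if "conj_shape d m (lam c)" for m
    proof -
      have "is_partition m (lam c ! 0)" "is_partition (mm c) (lam c ! 0)"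
        using conj_shape.part[OF that, of 0] conj_shape.part[OF lam(1)[OF c], of 0] d by auto
      then show ?thesis by (simp add: is_partition_def)
    qed
    then have "P (lam c) G" unfolding P_def using G by blast
    then show ?thesis by (intro exI[where x = G])
  qed
  \<comment> \<open>The choice depends on the shape and not on \<open>c\<close>, and the next sum
    runs over the set of shapes, so a shape shared by several indices is counted once.\<close>
  define \<Gamma> where "\<Gamma> lm = (SOME G. P lm G)" for lm
  have \<Gamma>: "P (lam c) (\<Gamma> (lam c))" if "c \<in> I" for c
    unfolding \<Gamma>_def using someI_ex[OF ex[OF that]] .
  define H where "H cs = (\<Sum>lm\<in>lam ` I. \<Gamma> lm cs)" for cs
  have H_alt: "alternates s2 H"
    unfolding H_def[abs_def] by (rule alternates_sum) (use \<Gamma> in \<open>auto simp: P_def\<close>)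
  define \<gamma> where "\<gamma> K = H (repr2 K)" for K
  have main: "fn \<gamma> (tgt.Del n (T c)) = fn \<theta> (src.E (cols (T c)))" if c: "c \<in> I" for c
  proof -
    interpret conj_shape d "mm c" "lam c" by (rule lam(1)[OF c])
    have r: "rect d (mm c) (T c)" by (rule tabA_rect[OF T[OF c]])
    have "fn \<gamma> (tgt.Phi n d (mm c) (T c)) = (\<Sum>X\<in>row_tables n d (mm c). CT (T c) X * H (cols X))"
      unfolding tgt.Phi_def tgt.fn_combination \<gamma>_def tgt.fn_E[OF H_alt] ..
    also have "\<dots> = (\<Sum>X\<in>row_tables n d (mm c). \<Gamma> (lam c) (cols X) * CT (T c) X)"
    proof (rule sum.cong[OF refl])
      fix X assume "X \<in> row_tables n d (mm c)"
      then have X: "rect d (mm c) X" by (rule row_tables_rect)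
      show "CT (T c) X * H (cols X) = \<Gamma> (lam c) (cols X) * CT (T c) X"
      proof (cases "CT (T c) X = 0")
        case False
        then have XA: "X \<in> tabA (lam c)" using CT_nonzero_tabA[OF T[OF c] X] by blast
        have "\<Gamma> lm (cols X) = 0" if lm: "lm \<in> lam ` I - {lam c}" for lm
        proof (rule ccontr)
          assume g: "\<Gamma> lm (cols X) \<noteq> 0"
          obtain c' where c': "c' \<in> I" "lm = lam c'" using lm by auto
          have "X \<in> tabA lm" using g \<Gamma>[OF c'(1)] c'(2) tab_transpose[OF X d] unfolding P_def by metis
          then have "lam c' = lam c"
            using tabA_eq_imp_eq[OF lam(1)[OF c'(1)] lam(1)[OF c], of X] XA c'(2) by simp
          then show False using lm c'(2) by simp
        qed
        then have "H (cols X) = \<Gamma> (lam c) (cols X)"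
          unfolding H_def using fin c
          by (subst sum.remove[of _ "lam c"]) auto
        then show ?thesis by simp
      qed simp
    qed
    also have "\<dots> = fn \<theta> (F (T c))" using \<Gamma>[OF c] lam(1)[OF c] T[OF c] unfolding P_def by blast
    finally show ?thesis
      unfolding tgt.Del_Phi[OF r] fn_scale using table_norm_nonzero[of "T c"] by (simp add: F_def fn_scale)
  qed
  have "fn \<theta> (\<Sum>c\<in>I. cscale (a c) (src.E (cols (T c)))) =
      (\<Sum>c\<in>I. a c * fn \<gamma> (tgt.Del n (T c)))"
    using main by (simp add: src.fn_combination)
  also have "\<dots> = fn \<gamma> (\<Sum>c\<in>I. cscale (a c) (tgt.Del n (T c)))"
    by (simp add: tgt.fn_combination)
  finally show False using rel nz by simp
qed

lemma norm_Del: "rect d m S \<Longrightarrow> cscale (table_norm S) (tgt.Del n S) = tgt.Phi n d m S"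
  by (simp add: tgt.Del_Phi table_norm_nonzero)

text \<open>Exchanging two equal columns fixes the table but changes the sign of its vector. This
  makes the vectors compatible with an exterior source, where the product of such a table is
  0.\<close>

lemma Phi_zero:
  assumes "rect d m S" "\<not> (s1 = 1 \<or> distinct (cols S))"
  shows "tgt.Phi n d m S = 0"
proof (rule poly_mapping_eqI)
  fix K
  let ?G = "\<lambda>cs. if length cs = m then lookup (tgt.Phi n d m (tab d cs)) K else 0"
  have "alternates s1 ?G"
    by (rule alternates_tab[OF src.s_cases, where G = "\<lambda>X. lookup (tgt.Phi n d m X) K"])
      (simp add: Phi_pcol_s1)
  moreover have "s1 = - 1" using assms(2) src.s_cases by blast
  ultimately have "?G (cols S) = 0" using alternates_not_distinct[of ?G] assms(2) by metis
  then show "lookup (tgt.Phi n d m S) K = lookup 0 K"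
    using length_transpose_rect[OF assms(1) d] tab_transpose[OF assms(1) d] by simp
qed

section \<open>The linear map belonging to one shape\<close>

context
  fixes m :: nat and lam :: "nat list list"
  assumes cshape: "conj_shape d m lam"
begin

interpretation conj_shape d m lam by (rule cshape)

text \<open>This is \<open>tabA_lex\<close> for a symmetric and \<open>tabB_lex\<close> for an
  exterior source.\<close>

definition lex_tables :: "table set" where
  "lex_tables = {S \<in> tabA mu. sorted (cols S) \<and> (s1 = 1 \<or> distinct (cols S))}"

lemma boundary_Del:
  assumes "l < d" "1 \<le> i" "i < j" "j \<le> length (mu ! l)" "Y \<in> tabA (move l i j mu)"
  shows "(\<Sum>S\<in>boundary l j i Y. cscale (table_norm S) (tgt.Del n S)) = 0"
proof -
  have "(\<Sum>S\<in>boundary l j i Y. cscale (table_norm S) (tgt.Del n S)) = (\<Sum>S\<in>boundary l j i Y. tgt.Phi n d m S)"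
    using boundary_tabA[OF assms] tabA_rect norm_Del by (intro sum.cong) auto
  then show ?thesis using tgt.Phi_boundary[OF cshape assms] by simp
qed

lemma E_lex:
  assumes "S \<in> lex_tables"
  shows "src.E (cols S) = single (key1 (cols S)) 1"
    "repr1 (key1 (cols S)) = cols S"
proof -
  have ok: "s1 = 1 \<or> distinct (cols S)" and so: "sorted (cols S)"
    using assms by (auto simp: lex_tables_def)
  show "src.E (cols S) = single (key1 (cols S)) 1"
    using ok so by (simp add: src.E_def scoef_def inv_count_sorted)
  show "repr1 (key1 (cols S)) = cols S"
    using src.repr_key[OF ok] so by (simp add: sorted_sort_id)
qed

lemma linear_with_exists:
  "\<exists>D. linear_with D lex_tables (\<lambda>S. src.E (cols S)) (tgt.Del n)"
proof
  let ?D = "lin (\<lambda>K. tgt.Del n (tab d (repr1 K)))"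
  have "?D (src.E (cols S)) = tgt.Del n S" if S: "S \<in> lex_tables" for S
  proof -
    have "rect d m S" using S tabA_rect by (auto simp: lex_tables_def)
    then show ?thesis using E_lex[OF S] tab_transpose[of d m S] d by (simp add: lin_single)
  qed
  then show "linear_with ?D lex_tables (\<lambda>S. src.E (cols S)) (tgt.Del n)"
    by (simp add: linear_with_def lin_linear)
qed

text \<open>The map is prescribed only on tables with sorted columns. Sorting the columns of
  \<open>S\<close> changes \<open>F S\<close> and its vector by the same factor, so the formula
  extends to all tables of the shape.\<close>

lemma linear_with_F:
  assumes D: "linear_with D lex_tables (\<lambda>S. src.E (cols S)) (tgt.Del n)" and S: "S \<in> tabA mu"
  shows "D (F S) = tgt.Phi n d m S"
proof (cases "s1 = 1 \<or> distinct (cols S)")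
  case False
  then show ?thesis
    using Phi_zero[OF tabA_rect[OF S] False] src.E_not_ok[OF False] D
      linear_cscale_scale[of D 0] by (simp add: F_def linear_with_def)
next
  case True
  have lin: "Vector_Spaces.linear cscale cscale D" using D by (simp add: linear_with_def)
  have r: "rect d m S" by (rule tabA_rect[OF S])
  have len: "length (cols S) = m" by (rule length_transpose_rect[OF r d])
  obtain p where p: "p permutes {..<m}" "permute_list p (cols S) = sort (cols S)"
    using mset_eq_permutation[of "sort (cols S)" "cols S"] len by auto
  have tr: "cols (pcol p S) = sort (cols S)"
    using transpose_pcol[OF r d p(1)] p(2) by simp
  have lex: "pcol p S \<in> lex_tables"
    unfolding lex_tables_def using pcol_tabA[OF S p(1)] tr True by simp
  have "D (F (pcol p S)) = cscale (table_norm (pcol p S)) (tgt.Del n (pcol p S))"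
    using D lex unfolding F_def linear_cscale_scale[OF lin] by (simp add: linear_with_def)
  also have "\<dots> = tgt.Phi n d m (pcol p S)" by (rule norm_Del) (use r in simp)
  finally have "cscale (perm_eps s1 m p) (D (F S)) = cscale (perm_eps s1 m p) (tgt.Phi n d m S)"
    unfolding F_pcol[OF r p(1)] Phi_pcol_s1[OF r p(1)] linear_cscale_scale[OF lin] .
  moreover have "perm_eps s1 m p \<noteq> 0" using perm_eps_sq[OF src.s_cases, of m p] by auto
  ultimately show ?thesis by simp
qed

lemma linear_with_E:
  assumes D: "linear_with D lex_tables (\<lambda>S. src.E (cols S)) (tgt.Del n)" and S: "S \<in> tabA mu"
  shows "D (src.E (cols S)) = tgt.Del n S"
proof -
  have lin: "Vector_Spaces.linear cscale cscale D" using D by (simp add: linear_with_def)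
  have "src.E (cols S) = cscale (1 / table_norm S) (F S)"
    by (simp add: F_def table_norm_nonzero)
  then show ?thesis
    using linear_with_F[OF D S] tgt.Del_Phi[OF tabA_rect[OF S]] linear_cscale_scale[OF lin] by simp
qed

context
  assumes n1: "\<And>p. p \<in> set lam \<Longrightarrow> length p \<le> n" and n2: "\<And>p. p \<in> set lam \<Longrightarrow> entry p 1 \<le> n"
begin

text \<open>The bound on the first parts enters here: it keeps the letters of tables of content
  \<open>mu\<close> within \<open>{1..n}\<close>.\<close>

lemma WV_mu_iff:
  "p \<in> src.WV n mu \<longleftrightarrow> (\<forall>K\<in>keys p. \<exists>S\<in>tabA mu. rect d (length (repr1 K)) S \<and> repr1 K = cols S)"
  by (rule src.WV_iff[OF _ _ d]) (use n2 length_lam in auto)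

lemma WV_E: "S \<in> tabA mu \<Longrightarrow> src.E (cols S) \<in> src.WV n mu"
proof (cases "s1 = 1 \<or> distinct (cols S)")
  case True
  assume S: "S \<in> tabA mu"
  let ?cs = "cols S"
  have r: "rect d m S" by (rule tabA_rect[OF S])
  obtain p where p: "p permutes {..<m}" "permute_list p ?cs = sort ?cs"
    using mset_eq_permutation[of "sort ?cs" ?cs] length_transpose_rect[OF r d] by auto
  have "repr1 (key1 ?cs) = cols (pcol p S)"
    using src.repr_key[OF True] transpose_pcol[OF r d p(1)] p(2) by simp
  moreover have "rect d (length (repr1 (key1 ?cs))) (pcol p S)"
    using r src.repr_key[OF True] length_transpose_rect[OF r d] by simp
  ultimately have "\<exists>S\<in>tabA mu. rect d (length (repr1 (key1 ?cs))) S \<and> repr1 (key1 ?cs) = cols S"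
    using pcol_tabA[OF S p(1)] by blast
  then show ?thesis unfolding WV_mu_iff src.E_def by (simp split: if_splits)
qed (simp add: src.E_not_ok WV_mu_iff)

lemma WV_expand:
  assumes "w \<in> src.WV n mu"
  obtains S where "\<And>K. K \<in> keys w \<Longrightarrow> S K \<in> tabA mu"
    "w = (\<Sum>K\<in>keys w. cscale (lookup w K) (src.E (cols (S K))))"
proof -
  obtain S where S: "\<And>K. K \<in> keys w \<Longrightarrow> S K \<in> tabA mu \<and> repr1 K = cols (S K)"
    using assms unfolding WV_mu_iff by metis
  have "w = (\<Sum>K\<in>keys w. cscale (lookup w K) (single K 1))"
    by (rule poly_mapping_sum_single)
  also have "\<dots> = (\<Sum>K\<in>keys w. cscale (lookup w K) (src.E (cols (S K))))"
    using S src.E_repr by (intro sum.cong refl) metis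
  finally show ?thesis using that S by blast
qed

lemma WV_subspace: "cvec.subspace (src.WV n mu)"
  unfolding cvec.subspace_def
proof (intro conjI ballI allI)
  fix x y assume xy: "x \<in> src.WV n mu" "y \<in> src.WV n mu"
  have "keys (x + y) \<subseteq> keys x \<union> keys y" by (rule Poly_Mapping.keys_add)
  then show "x + y \<in> src.WV n mu" using xy unfolding WV_mu_iff by blast
next
  fix c x assume x: "x \<in> src.WV n mu"
  have "keys (cscale c x) \<subseteq> keys x" by (auto simp: in_keys_iff)
  then show "cscale c x \<in> src.WV n mu" using x unfolding WV_mu_iff by blast
qed (simp add: WV_mu_iff)

lemma linear_with_image:
  assumes D: "linear_with D lex_tables (\<lambda>S. src.E (cols S)) (tgt.Del n)"
  shows "D ` src.WV n mu \<subseteq> tgt.HWV n lam"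
proof safe
  fix w assume "w \<in> src.WV n mu"
  then obtain S where S: "\<And>K. K \<in> keys w \<Longrightarrow> S K \<in> tabA mu"
    "w = (\<Sum>K\<in>keys w. cscale (lookup w K) (src.E (cols (S K))))"
    using WV_expand by blast
  have lin: "Vector_Spaces.linear cscale cscale D" using D by (simp add: linear_with_def)
  have "D w = (\<Sum>K\<in>keys w. cscale (lookup w K) (D (src.E (cols (S K)))))"
    by (subst S(2)) (simp add: linear_cscale_sum[OF lin] linear_cscale_scale[OF lin])
  also have "\<dots> = (\<Sum>K\<in>keys w. cscale (lookup w K / table_norm (S K)) (tgt.Phi n d m (S K)))"
    by (intro sum.cong refl)
      (simp add: linear_with_E[OF D S(1)] tgt.Del_Phi[OF tabA_rect[OF S(1)]])
  also have "\<dots> \<in> tgt.HWV n lam"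
    using S(1) by (intro tgt.HWV_combination tgt.Phi_HWV[OF cshape])
  finally show "D w \<in> tgt.HWV n lam" .
qed

text \<open>\<open>R\<close> is given through its span because the exterior relations of the theorem
  are listed only for tables with distinct columns.\<close>

lemma kernel_eq_span:
  assumes D: "linear_with D lex_tables (\<lambda>S. src.E (cols S)) (tgt.Del n)"
    and R: "cvec.span R = cvec.span {\<Sum>S\<in>boundary l j i Y. F S | l i j Y. l < d \<and> 1 \<le> i \<and> i < j \<and>
      j \<le> length (mu ! l) \<and> Y \<in> tabA (move l i j mu)}"
  shows "{w \<in> src.WV n mu. D w = 0} = cvec.span R"
proof
  have lin: "Vector_Spaces.linear cscale cscale D" using D by (simp add: linear_with_def)
  show "{w \<in> src.WV n mu. D w = 0} \<subseteq> cvec.span R"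
  proof safe
    fix w assume w: "w \<in> src.WV n mu" "D w = 0"
    then obtain S where S: "\<And>K. K \<in> keys w \<Longrightarrow> S K \<in> tabA mu"
      "w = (\<Sum>K\<in>keys w. cscale (lookup w K) (src.E (cols (S K))))"
      using WV_expand by blast
    have "(\<Sum>K\<in>keys w. cscale (lookup w K) (src.E (cols (S K)))) \<in> cvec.span R"
    proof (rule relation_in_span[where lam = "\<lambda>_. lam" and mm = "\<lambda>_. m"])
      have "D w = (\<Sum>K\<in>keys w. cscale (lookup w K) (D (src.E (cols (S K)))))"
        by (subst S(2)) (simp add: linear_cscale_sum[OF lin] linear_cscale_scale[OF lin])
      then show "(\<Sum>K\<in>keys w. cscale (lookup w K) (tgt.Del n (S K))) = 0"
        using w(2) S(1) linear_with_E[OF D] by simp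
      show "(\<Sum>S\<in>boundary l j i Y. F S) \<in> cvec.span R"
        if "l < d" "1 \<le> i" "i < j" "j \<le> length (mu ! l)" "Y \<in> tabA (move l i j mu)" for l i j Y
        unfolding R using that by (intro cvec.span_base) blast
    qed (use S(1) cshape n1 in auto)
    then show "w \<in> cvec.span R" using S(2) by simp
  qed
  show "cvec.span R \<subseteq> {w \<in> src.WV n mu. D w = 0}"
    unfolding R
  proof (rule cvec.span_minimal)
    show "cvec.subspace {w \<in> src.WV n mu. D w = 0}"
      using WV_subspace lin
      unfolding cvec.subspace_def Vector_Spaces.linear_def
      by (auto simp: module_hom.add module_hom.scale module_hom.zero)
    show "{\<Sum>S\<in>boundary l j i Y. F S | l i j Y. l < d \<and> 1 \<le> i \<and> i < j \<and>
      j \<le> length (mu ! l) \<and> Y \<in> tabA (move l i j mu)} \<subseteq> {w \<in> src.WV n mu. D w = 0}"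
    proof safe
      fix l i j Y assume a: "l < d" "1 \<le> i" "i < j" "j \<le> length (mu ! l)" "Y \<in> tabA (move l i j mu)"
      show "(\<Sum>S\<in>boundary l j i Y. F S) \<in> src.WV n mu"
        using boundary_tabA[OF a] unfolding F_def
        by (intro cvec.subspace_sum[OF WV_subspace] cvec.subspace_scale[OF WV_subspace] WV_E)
      have "D (\<Sum>S\<in>boundary l j i Y. F S) = (\<Sum>S\<in>boundary l j i Y. tgt.Phi n d m S)"
        unfolding linear_cscale_sum[OF lin]
        using boundary_tabA[OF a] linear_with_F[OF D] by (intro sum.cong) auto
      then show "D (\<Sum>S\<in>boundary l j i Y. F S) = 0" using tgt.Phi_boundary[OF cshape a] by simp
    qed
  qed
qed

end

end

end

section \<open>Products\<close>

lemma block_append: "block c (ps @ qs) = block c ps @ block c qs"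
  by (simp add: block_def)

lemma block_notin: "c \<notin> set u \<Longrightarrow> block c (zip u x) = []"
  by (auto simp: block_def filter_empty_conv dest: set_zip_leftD)

lemma block_map:
  assumes "inj_on f (set w)" "a \<in> set w"
  shows "block (f a) (zip (map f w) x) = block a (zip w x)"
proof -
  have "block (f a) (zip (map f v) x) = block a (zip v x)" if "set v \<subseteq> set w" for v
    using that
  proof (induction v arbitrary: x)
    case (Cons b v)
    have "f b = f a \<longleftrightarrow> b = a" using assms Cons.prems by (auto dest: inj_onD)
    then show ?case using Cons by (cases x) auto
  qed simp
  then show ?thesis by blast
qed

text \<open>With disjoint letters no block meets both parts.\<close>

lemma word_sgn_append:
  assumes "length u = length x" "length w = length y" "set u \<inter> set w = {}"
  shows "word_sgn (u @ w) (x @ y) = word_sgn u x * word_sgn w y"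
proof -
  have "word_sgn (u @ w) (x @ y) =
      (\<Prod>c\<in>set u \<union> set w. seq_sgn (block c (zip u x) @ block c (zip w y)))"
    using assms by (simp add: word_sgn_blocks block_append)
  also have "\<dots> = (\<Prod>c\<in>set u. seq_sgn (block c (zip u x) @ block c (zip w y))) *
      (\<Prod>c\<in>set w. seq_sgn (block c (zip u x) @ block c (zip w y)))"
    using assms(3) by (intro prod.union_disjoint) auto
  also have "(\<Prod>c\<in>set u. seq_sgn (block c (zip u x) @ block c (zip w y))) = word_sgn u x"
    unfolding word_sgn_blocks[OF assms(1)] using assms(3)
    by (intro prod.cong refl) (simp add: disjoint_iff block_notin)
  also have "(\<Prod>c\<in>set w. seq_sgn (block c (zip u x) @ block c (zip w y))) = word_sgn w y"
    unfolding word_sgn_blocks[OF assms(2)] using assms(3)[unfolded Int_commute[of "set u"]]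
    by (intro prod.cong refl) (simp add: disjoint_iff block_notin)
  finally show ?thesis .
qed

lemma word_sgn_map:
  assumes "inj_on f (set w)" "length w = length x"
  shows "word_sgn (map f w) x = word_sgn w x"
proof -
  have "word_sgn (map f w) x = (\<Prod>c\<in>f ` set w. seq_sgn (block c (zip (map f w) x)))"
    using assms(2) by (simp add: word_sgn_blocks)
  also have "\<dots> = (\<Prod>a\<in>set w. seq_sgn (block a (zip w x)))"
    using assms(1) by (simp add: prod.reindex block_map)
  finally show ?thesis using assms(2) by (simp add: word_sgn_blocks)
qed

text \<open>No inversion runs between the two parts.\<close>

lemma word_sign_append:
  assumes "\<And>a b. a \<in> set u \<Longrightarrow> b \<in> set w \<Longrightarrow> a < b"
  shows "word_sign (u @ w) = word_sign u * word_sign w"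
proof -
  have "filter (\<lambda>y. y < x) w = []" if "x \<in> set u" for x
    using assms[OF that] by (fastforce simp: filter_empty_conv)
  then have z: "(\<Sum>x\<leftarrow>u. length (filter (\<lambda>y. y < x) w)) = 0" by (simp add: sum_list_0 cong: map_cong)
  show ?thesis unfolding word_sign_inv_count inv_count_append z by (simp add: power_add)
qed

lemma inv_count_add: "inv_count (map (\<lambda>a. k + a) v) = inv_count (v :: nat list)"
  by (induction v) (auto simp: filter_map o_def)

lemma table_sgn_prod: "length T = d \<Longrightarrow> length X = d \<Longrightarrow> table_sgn T X = (\<Prod>l<d. word_sgn (T ! l) (X ! l))"
  by (simp add: table_sgn_def prod_list_nth)

lemma table_sign_prod: "length T = d \<Longrightarrow> table_sign T = (\<Prod>l<d. word_sign (T ! l))"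
  by (simp add: table_sign_def prod.list_conv_set_nth atLeast0LessThan)

lemma word_sign_sq: "word_sign w * word_sign w = 1"
  by (simp add: word_sign_def power_mult_distrib[symmetric])

lemma table_sign_sq: "table_sign T * table_sign T = 1"
  by (simp add: table_sign_prod prod.distrib[symmetric] word_sign_sq)

definition relabel :: "(nat \<Rightarrow> nat \<Rightarrow> nat) \<Rightarrow> table \<Rightarrow> table" where
  "relabel f T = map (\<lambda>l. map (f l) (T ! l)) [0..<length T]"

lemma relabel_nth: "l < length T \<Longrightarrow> relabel f T ! l = map (f l) (T ! l)"
  by (simp add: relabel_def)

lemma length_relabel [simp]: "length (relabel f T) = length T"
  by (simp add: relabel_def)

lemma rect_relabel: "rect d m T \<Longrightarrow> rect d m (relabel f T)"
  by (auto simp: relabel_def rect_def)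

lemma table_sgn_relabel:
  assumes "rect d m T" "rect d m X" "\<And>l. l < d \<Longrightarrow> inj_on (f l) (set (T ! l))"
  shows "table_sgn (relabel f T) X = table_sgn T X"
  using assms by (simp add: table_sgn_prod rect_length relabel_nth word_sgn_map rect_nth)

lemma count_list_map_inj: "inj_on f (set xs) \<Longrightarrow> c \<in> set xs \<Longrightarrow> count_list (map f xs) (f c) = count_list xs c"
proof -
  assume f: "inj_on f (set xs)" "c \<in> set xs"
  have "count_list (map f ys) (f c) = count_list ys c" if "set ys \<subseteq> set xs" for ys
    using that f by (induction ys) (auto dest: inj_onD)
  then show ?thesis by blast
qed

lemma transpose_relabel:
  assumes "rect d m T" "1 \<le> d"
  shows "cols (relabel f T) = map (\<lambda>c. map (\<lambda>l. f l (c ! l)) [0..<d]) (cols T)"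
  using assms rect_relabel[OF assms(1), of f]
  by (intro nth_equalityI) (auto simp: transpose_rect rect_length relabel_nth rect_nth intro!: nth_equalityI)

lemma column_entry:
  assumes "rect d m T" "1 \<le> d" "c \<in> set (cols T)" "l < d"
  shows "c ! l \<in> set (T ! l)"
proof -
  obtain q where "q < m" "c = map (\<lambda>r. r ! q) T" using assms(3) unfolding transpose_rect[OF assms(1,2)] by auto
  then show ?thesis using assms(4) rect_length[OF assms(1)] rect_nth[OF assms(1,4)] by simp
qed

text \<open>Renaming letters injectively in each row is injective on columns, so the multiplicities
  of columns persist.\<close>

lemma table_norm_relabel:
  assumes T: "rect d m T" and d: "1 \<le> d" and f: "\<And>l. l < d \<Longrightarrow> inj_on (f l) (set (T ! l))"
  shows "table_norm (relabel f T) = table_norm T"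
proof -
  let ?f = "\<lambda>c. map (\<lambda>l. f l (c ! l)) [0..<d]"
  have inj: "inj_on ?f (set (cols T))"
  proof (rule inj_onI)
    fix c c' assume c: "c \<in> set (cols T)" "c' \<in> set (cols T)" "?f c = ?f c'"
    have len: "length c = d" "length c' = d" using length_column[OF T d] c by auto
    show "c = c'"
    proof (rule nth_equalityI)
      fix l assume "l < length c"
      then have l: "l < d" using len by simp
      have "f l (c ! l) = f l (c' ! l)" using c(3) l by simp
      then show "c ! l = c' ! l" using f[OF l] column_entry[OF T d _ l] c by (auto dest: inj_onD)
    qed (simp add: len)
  qed
  show ?thesis
    unfolding table_norm_def transpose_relabel[OF T d] set_map prod.reindex[OF inj] o_def
    by (intro prod.cong refl) (simp add: count_list_map_inj[OF inj])
qed

lemma rect_append: "rect d m X \<Longrightarrow> rect d m' Y \<Longrightarrow> rect d (m + m') (map2 (@) X Y)"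
  by (auto simp: rect_def set_zip)

lemma transpose_append:
  assumes "rect d m X" "rect d m' Y" "1 \<le> d"
  shows "cols (map2 (@) X Y) = cols X @ cols Y"
  using assms rect_append[OF assms(1,2)]
  by (intro nth_equalityI)
    (auto simp: transpose_rect rect_length rect_nth nth_append intro!: nth_equalityI)

text \<open>Disjoint letters in a single row already make every column of \<open>T\<close> different
  from every column of \<open>U\<close>.\<close>

lemma table_norm_append:
  assumes T: "rect d m T" and U: "rect d m' U" and d: "1 \<le> d" and disj: "set (T ! 0) \<inter> set (U ! 0) = {}"
  shows "table_norm (map2 (@) T U) = table_norm T * table_norm U"
proof -
  let ?t = "cols T" and ?u = "cols U"
  have dj: "set ?t \<inter> set ?u = {}"
    using column_entry[OF T d, of _ 0] column_entry[OF U d, of _ 0] disj d by fastforce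
  have "table_norm (map2 (@) T U) = (\<Prod>c\<in>set ?t \<union> set ?u. fact (count_list ?t c + count_list ?u c))"
    by (simp add: table_norm_def transpose_append[OF T U d])
  also have "\<dots> = (\<Prod>c\<in>set ?t. fact (count_list ?t c + count_list ?u c)) *
      (\<Prod>c\<in>set ?u. fact (count_list ?t c + count_list ?u c))"
    using dj by (intro prod.union_disjoint) auto
  also have "(\<Prod>c\<in>set ?t. fact (count_list ?t c + count_list ?u c)) = table_norm T"
    unfolding table_norm_def
  proof (intro prod.cong refl)
    fix c assume "c \<in> set ?t"
    then have "count_list ?u c = 0" using dj by (simp add: count_list_0_iff disjoint_iff)
    then show "fact (count_list ?t c + count_list ?u c) = (fact (count_list ?t c) :: complex)" by simp
  qed
  also have "(\<Prod>c\<in>set ?u. fact (count_list ?t c + count_list ?u c)) = table_norm U"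
    unfolding table_norm_def
  proof (intro prod.cong refl)
    fix c assume "c \<in> set ?u"
    then have "count_list ?t c = 0" using dj by (auto simp: count_list_0_iff)
    then show "fact (count_list ?t c + count_list ?u c) = (fact (count_list ?u c) :: complex)" by simp
  qed
  finally show ?thesis .
qed

lemma row_tables_append_sum:
  "(\<Sum>Z\<in>row_tables n d (m + m'). f Z) = (\<Sum>X\<in>row_tables n d m. \<Sum>Y\<in>row_tables n d m'. f (map2 (@) X Y))"
proof -
  have "(\<Sum>(X, Y)\<in>row_tables n d m \<times> row_tables n d m'. f (map2 (@) X Y)) = (\<Sum>Z\<in>row_tables n d (m + m'). f Z)"
  proof (rule sum.reindex_bij_witness[of _ "\<lambda>Z. (map (take m) Z, map (drop m) Z)" "\<lambda>(X, Y). map2 (@) X Y"])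
    fix p assume p: "p \<in> row_tables n d m \<times> row_tables n d m'"
    obtain X Y where XY: "p = (X, Y)" by (cases p)
    have X: "X \<in> row_tables n d m" and Y: "Y \<in> row_tables n d m'" using p XY by auto
    note r = row_tables_rect[OF X] row_tables_rect[OF Y]
    have "map (take m) (map2 (@) X Y) = X" "map (drop m) (map2 (@) X Y) = Y"
      using r by (auto intro!: nth_equalityI simp: rect_length rect_nth)
    then show "(map (take m) (case p of (X, Y) \<Rightarrow> map2 (@) X Y), map (drop m) (case p of (X, Y) \<Rightarrow> map2 (@) X Y)) = p"
      using XY by simp
    have "map2 (@) X Y \<in> row_tables n d (m + m')"
      unfolding row_tables_def
    proof safe
      show "length (map2 (@) X Y) = d" using r by (simp add: rect_length)
      fix z assume "z \<in> set (map2 (@) X Y)"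
      then obtain x y where xy: "(x, y) \<in> set (zip X Y)" "z = x @ y" by auto
      then have "x \<in> set X" "y \<in> set Y" by (auto dest: set_zip_leftD set_zip_rightD)
      then have "x \<in> indices n m" "y \<in> indices n m'" using X Y by (auto simp: row_tables_def)
      then show "z \<in> indices n (m + m')" using xy(2) by (auto simp: indices_def)
    qed
    then show "(case p of (X, Y) \<Rightarrow> map2 (@) X Y) \<in> row_tables n d (m + m')" using XY by simp
    show "f (case p of (X, Y) \<Rightarrow> map2 (@) X Y) = (case p of (X, Y) \<Rightarrow> f (map2 (@) X Y))" using XY by simp
  next
    fix Z assume Z: "Z \<in> row_tables n d (m + m')"
    show "(case (map (take m) Z, map (drop m) Z) of (X, Y) \<Rightarrow> map2 (@) X Y) = Z"
      by (auto intro!: nth_equalityI)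
    show "(map (take m) Z, map (drop m) Z) \<in> row_tables n d m \<times> row_tables n d m'"
      using Z by (auto simp: row_tables_def indices_def subset_iff dest: in_set_takeD in_set_dropD)
  qed
  then show ?thesis by (simp add: sum.cartesian_product)
qed

context power_algebra
begin

lemma Del_rect:
  "rect d m T \<Longrightarrow> Del n T = cscale (table_sign T / table_norm T)
     (\<Sum>X\<in>row_tables n d m. cscale (table_sgn T X) (E (cols X)))"
  by (simp add: Del_def same_shape_rect)

text \<open>Only the division of the positions into blocks of equal letters enters
  \<open>table_sgn\<close> and \<open>table_norm\<close>; the order of the letters is felt by
  \<open>table_sign\<close> alone.\<close>

lemma Del_relabel:
  assumes T: "rect d m T" and d: "1 \<le> d" and f: "\<And>l. l < d \<Longrightarrow> inj_on (f l) (set (T ! l))"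
  shows "Del n T = cscale (table_sign T * table_sign (relabel f T)) (Del n (relabel f T))"
proof -
  have "Del n (relabel f T) = cscale (table_sign (relabel f T) / table_norm T)
      (\<Sum>X\<in>row_tables n d m. cscale (table_sgn T X) (E (cols X)))"
  proof -
    have "table_norm (relabel f T) = table_norm T" by (rule table_norm_relabel[OF T d f])
    moreover have "table_sgn (relabel f T) X = table_sgn T X" if "X \<in> row_tables n d m" for X
      by (rule table_sgn_relabel[OF T row_tables_rect[OF that] f])
    ultimately show ?thesis by (simp add: Del_rect[OF rect_relabel[OF T]])
  qed
  moreover have "table_sign T * table_sign (relabel f T) * (table_sign (relabel f T) / table_norm T) =
      table_sign T / table_norm T"
    using table_sign_sq[of "relabel f T"] by (simp add: mult.assoc)
  ultimately show ?thesis by (simp add: Del_rect[OF T])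
qed

text \<open>In each row the letters of \<open>T\<close> lie below those of \<open>U\<close>, so
  signs, coefficients and norms are all multiplicative, and the tables over which the product sums
  are the concatenations.\<close>

lemma Del_append:
  assumes T: "rect d m T" and U: "rect d m' U" and d: "1 \<le> d"
    and lt: "\<And>l a b. l < d \<Longrightarrow> a \<in> set (T ! l) \<Longrightarrow> b \<in> set (U ! l) \<Longrightarrow> a < b"
  shows "prd (Del n T) (Del n U) = Del n (map2 (@) T U)"
proof -
  have len: "length T = d" "length U = d" using T U by (simp_all add: rect_length)
  have sgn: "table_sgn (map2 (@) T U) (map2 (@) X Y) = table_sgn T X * table_sgn U Y"
    if "X \<in> row_tables n d m" "Y \<in> row_tables n d m'" for X Y
  proof -
    have r: "rect d m X" "rect d m' Y" using that by (auto intro: row_tables_rect)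
    then have "length X = d" "length Y = d" by (simp_all add: rect_length)
    moreover have "word_sgn (T ! l @ U ! l) (X ! l @ Y ! l) = word_sgn (T ! l) (X ! l) * word_sgn (U ! l) (Y ! l)"
      if "l < d" for l
      using that lt[OF that] by (intro word_sgn_append)
        (auto simp: rect_nth[OF T] rect_nth[OF U] rect_nth[OF r(1)] rect_nth[OF r(2)])
    ultimately show ?thesis using len by (simp add: table_sgn_prod[of _ d] prod.distrib[symmetric])
  qed
  have sign: "table_sign (map2 (@) T U) = table_sign T * table_sign U"
    using len lt by (simp add: table_sign_prod[of _ d] prod.distrib[symmetric] word_sign_append)
  have norm: "table_norm (map2 (@) T U) = table_norm T * table_norm U"
    using lt[of 0] d by (intro table_norm_append[OF T U d]) fastforce
  have "prd (Del n T) (Del n U) = cscale (table_sign T / table_norm T * (table_sign U / table_norm U))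
      (\<Sum>X\<in>row_tables n d m. \<Sum>Y\<in>row_tables n d m'.
        cscale (table_sgn T X * table_sgn U Y) (E (cols X @ cols Y)))"
    unfolding Del_rect[OF T] Del_rect[OF U] linear_cscale_scale[OF prd_linear1]
      linear_cscale_scale[OF prd_linear2] prd_sum_sum E_append by (simp add: mult.commute)
  also have "(\<Sum>X\<in>row_tables n d m. \<Sum>Y\<in>row_tables n d m'.
        cscale (table_sgn T X * table_sgn U Y) (E (cols X @ cols Y))) =
      (\<Sum>X\<in>row_tables n d m. \<Sum>Y\<in>row_tables n d m'.
        cscale (table_sgn (map2 (@) T U) (map2 (@) X Y)) (E (cols (map2 (@) X Y))))"
    using sgn transpose_append[OF row_tables_rect row_tables_rect d] by (intro sum.cong refl) simp
  also have "\<dots> = (\<Sum>Z\<in>row_tables n d (m + m'). cscale (table_sgn (map2 (@) T U) Z) (E (cols Z)))"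
    by (rule row_tables_append_sum[symmetric])
  finally show ?thesis by (simp add: Del_rect[OF rect_append[OF T U]] sign norm)
qed

lemma prds_E: "prds (map (\<lambda>c. E [c]) cs) = E cs"
  by (induction cs) (auto simp: prds_def E_Cons)

end

section \<open>Juxtaposition of tables\<close>

lemma foldr_max_ge: "a \<in> set u \<Longrightarrow> a \<le> foldr max u (0::nat)"
  by (induction u) (auto simp: le_max_iff_disj)

text \<open>Conditions that juxtaposition preserves. The letter 0 is excluded because shifting it by
  the maximum of the other word could produce a letter of that word; multiplicities are bounded
  because the largest of them becomes the length of a partition.\<close>

definition good_table :: "nat \<Rightarrow> nat \<Rightarrow> nat \<Rightarrow> table \<Rightarrow> bool" where
  "good_table n d m T \<longleftrightarrow> rect d m T \<and> (\<forall>r\<in>set T. 0 \<notin> set r \<and> (\<forall>c. count_list r c \<le> n))"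

lemma count_list_add: "count_list (map (\<lambda>a. k + a) v) (c :: nat) = (if k \<le> c then count_list v (c - k) else 0)"
proof (induction v)
  case (Cons a v)
  have "k + a = c \<longleftrightarrow> k \<le> c \<and> a = c - k" by auto
  then show ?case using Cons by auto
qed simp

lemma juxt_word_good:
  assumes "0 \<notin> set u" "0 \<notin> set v" "\<And>c. count_list u c \<le> n" "\<And>c. count_list v c \<le> n"
  shows "0 \<notin> set (juxt_word u v)" "count_list (juxt_word u v) c \<le> n"
proof -
  let ?M = "foldr max u 0"
  show "0 \<notin> set (juxt_word u v)" using assms(1,2) by (auto simp: juxt_word_def)
  show "count_list (juxt_word u v) c \<le> n"
  proof (cases "c \<le> ?M")
    case True
    have "0 = count_list v 0" using assms(2) by simp
    then have "count_list (map (\<lambda>a. ?M + a) v) c = 0" using True by (auto simp: count_list_add)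
    then show ?thesis using assms(3) by (simp add: juxt_word_def)
  next
    case False
    then have "c \<notin> set u" using foldr_max_ge by blast
    then show ?thesis using assms(4) by (simp add: juxt_word_def count_list_add)
  qed
qed

lemma juxt_append:
  assumes "length T = length U"
  shows "map2 juxt_word T U = map2 (@) T (relabel (\<lambda>l a. foldr max (T ! l) 0 + a) U)"
  using assms by (intro nth_equalityI) (auto simp: juxt_word_def relabel_nth)

context power_algebra
begin

lemma prds_juxt:
  assumes d: "1 \<le> d" and Ts: "\<And>T. T \<in> set Ts \<Longrightarrow> \<exists>m. good_table n d m T"
  shows "prds (map (Del n) Ts) = Del n (juxt d Ts) \<and> (\<exists>m. good_table n d m (juxt d Ts))"
  using Ts
proof (induction Ts)
  case Nil
  have r: "rect d 0 (replicate d [] :: table)" by (simp add: rect_def)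
  \<comment> \<open>There is exactly one table without columns, so the empty product is the vector
    of the empty table.\<close>
  have rt: "row_tables n d 0 = {replicate d []}"
    by (auto simp: row_tables_def indices_def intro!: replicate_eqI)
  have tr: "cols (replicate d [] :: table) = []" using transpose_rect[OF r d] by simp
  have "Del n (replicate d []) = E []"
    unfolding Del_rect[OF r] rt using tr
    by (simp add: table_sign_prod[of _ d] table_sgn_prod[of _ d] word_sign_def word_sgn_def table_norm_def)
  moreover have "good_table n d 0 (replicate d [])" by (simp add: good_table_def r)
  ultimately show ?case by (auto simp: prds_def juxt_def)
next
  case (Cons T Ts)
  define U where "U = juxt d Ts"
  have IH: "prds (map (Del n) Ts) = Del n U" and "\<exists>m. good_table n d m U"
    using Cons by (auto simp: U_def)
  then obtain m' where U: "good_table n d m' U" by blast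
  obtain m where T: "good_table n d m T" using Cons.prems by auto
  have rT: "rect d m T" and rU: "rect d m' U" using T U by (auto simp: good_table_def)
  have len: "length T = d" "length U = d" using rT rU by (simp_all add: rect_length)
  define f where "f l a = foldr max (T ! l) 0 + a" for l and a :: nat
  have inj: "inj_on (f l) (set (U ! l))" for l by (auto simp: inj_on_def f_def)
  have j: "juxt d (T # Ts) = map2 (@) T (relabel f U)"
    using juxt_append[of T U] len by (simp add: juxt_def U_def f_def[abs_def])
  \<comment> \<open>Adding a constant to all letters of a row preserves its inversions, so the shift
    costs no sign.\<close>
  have "table_sign (relabel f U) = table_sign U"
    using len by (simp add: table_sign_prod[of _ d] relabel_nth f_def[abs_def] word_sign_inv_count inv_count_add)
  then have "Del n U = Del n (relabel f U)"
    using Del_relabel[OF rU d inj] table_sign_sq[of U] by simp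
  moreover have "prd (Del n T) (Del n (relabel f U)) = Del n (map2 (@) T (relabel f U))"
  proof (rule Del_append[OF rT rect_relabel[OF rU] d])
    fix l a b assume l: "l < d" and a: "a \<in> set (T ! l)" and b: "b \<in> set (relabel f U ! l)"
    obtain b' where b': "b' \<in> set (U ! l)" "b = f l b'" using b l len by (auto simp: relabel_nth)
    have "0 \<notin> set (U ! l)" using U l len by (simp add: good_table_def)
    then have "b' \<noteq> 0" using b' by metis
    then show "a < b" using foldr_max_ge[OF a] b' by (simp add: f_def)
  qed
  ultimately have "prds (map (Del n) (T # Ts)) = Del n (juxt d (T # Ts))"
    using IH j by (simp add: prds_def)
  moreover have "good_table n d (m + m') (juxt d (T # Ts))"
    unfolding good_table_def
  proof (intro conjI ballI)
    show "rect d (m + m') (juxt d (T # Ts))" unfolding j by (rule rect_append[OF rT rect_relabel[OF rU]])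
    fix r assume "r \<in> set (juxt d (T # Ts))"
    then have "r \<in> set (map2 juxt_word T U)" by (simp add: juxt_def U_def)
    then obtain u v where uv: "(u, v) \<in> set (zip T U)" "r = juxt_word u v" by auto
    then have "u \<in> set T" "v \<in> set U" by (auto dest: set_zip_leftD set_zip_rightD)
    then have "0 \<notin> set u" "0 \<notin> set v" "\<And>c. count_list u c \<le> n" "\<And>c. count_list v c \<le> n"
      using T U by (auto simp: good_table_def)
    from juxt_word_good[OF this] uv(2) show "0 \<notin> set r" "\<forall>c. count_list r c \<le> n" by auto
  qed
  ultimately show ?case by blast
qed

end

section \<open>Renumbering letters by decreasing multiplicity\<close>

definition letter_rank :: "nat list \<Rightarrow> nat \<Rightarrow> nat" where
  "letter_rank w a = card {b \<in> set w. count_list w b > count_list w a \<or>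
     count_list w b = count_list w a \<and> b \<le> a}"

lemma sort_letters_map: "sort_letters w = map (letter_rank w) w"
  by (simp add: sort_letters_def letter_rank_def)

lemma letter_rank_less:
  assumes "a \<in> set w" "b \<in> set w" "count_list w b > count_list w a \<or> count_list w b = count_list w a \<and> b < a"
  shows "letter_rank w b < letter_rank w a"
  unfolding letter_rank_def
proof (rule psubset_card_mono)
  let ?S = "\<lambda>a. {b \<in> set w. count_list w b > count_list w a \<or> count_list w b = count_list w a \<and> b \<le> a}"
  have "a \<in> ?S a" "a \<notin> ?S b" using assms by auto
  moreover have "?S b \<subseteq> ?S a" using assms(3) by auto
  ultimately show "?S b \<subset> ?S a" by blast
qed simp

lemma letter_rank_inj: "inj_on (letter_rank w) (set w)"
proof (rule inj_onI, rule ccontr)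
  fix a b assume ab: "a \<in> set w" "b \<in> set w" "letter_rank w a = letter_rank w b" "a \<noteq> b"
  then consider "count_list w b > count_list w a \<or> count_list w b = count_list w a \<and> b < a"
    | "count_list w a > count_list w b \<or> count_list w a = count_list w b \<and> a < b" by linarith
  then show False using letter_rank_less ab by cases fastforce+
qed

lemma letter_rank_image: "letter_rank w ` set w = {1..card (set w)}"
proof (rule card_subset_eq)
  show "letter_rank w ` set w \<subseteq> {1..card (set w)}"
  proof
    fix i assume "i \<in> letter_rank w ` set w"
    then obtain a where a: "a \<in> set w" "i = letter_rank w a" by auto
    have "i \<le> card (set w)" unfolding a letter_rank_def by (rule card_mono) auto
    moreover have "0 < i" unfolding a letter_rank_def using a(1) by (auto simp: card_gt_0_iff)
    ultimately show "i \<in> {1..card (set w)}" by simp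
  qed
  show "card (letter_rank w ` set w) = card {1..card (set w)}" by (simp add: card_image letter_rank_inj)
qed simp

text \<open>After renumbering, the multiplicities \<open>nu\<close> decrease weakly and form a
  partition. Its conjugate is the desired \<open>p\<close>, whose length is the largest
  multiplicity.\<close>

lemma sort_letters_words:
  assumes "\<And>c. count_list w c \<le> n"
  obtains p where "is_partition (length w) p" "length p \<le> n" "sort_letters w \<in> words (conj_part p)"
proof -
  let ?v = "sort_letters w" and ?N = "card (set w)"
  have sv: "set ?v = {1..?N}" by (simp add: sort_letters_map letter_rank_image)
  have cv: "count_list ?v (letter_rank w a) = count_list w a" if "a \<in> set w" for a
    unfolding sort_letters_map by (rule count_list_map_inj[OF letter_rank_inj that])
  define nu where "nu = map (count_list ?v) [1..<Suc ?N]"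
  have ln: "length nu = ?N" by (simp add: nu_def del: upt_Suc)
  have nth: "nu ! i = count_list ?v (Suc i)" if "i < ?N" for i
    using that by (simp add: nu_def del: upt_Suc)
  have v_in: "?v \<in> words nu"
    unfolding words_def using sv ln nth by (auto simp: Suc_le_eq)
  have ex: "\<exists>a\<in>set w. letter_rank w a = Suc i" if "i < ?N" for i
  proof -
    have "Suc i \<in> letter_rank w ` set w" unfolding letter_rank_image using that by simp
    then show ?thesis by auto
  qed
  have part: "is_partition (length w) nu"
    unfolding is_partition_def
  proof (intro conjI)
    show "sorted_wrt (\<ge>) nu"
      unfolding sorted_wrt_iff_nth_less
    proof (intro allI impI)
      fix i j assume ij: "i < j" "j < length nu"
      then have N: "i < ?N" "j < ?N" using ln by auto
      obtain a b where ab: "a \<in> set w" "letter_rank w a = Suc i" "b \<in> set w" "letter_rank w b = Suc j"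
        using ex[OF N(1)] ex[OF N(2)] by blast
      have "\<not> count_list w a < count_list w b"
        using letter_rank_less[OF ab(1,3)] ab ij by auto
      then show "nu ! j \<le> nu ! i" using cv[OF ab(1)] cv[OF ab(3)] ab nth[OF N(1)] nth[OF N(2)] by simp
    qed
    show "0 \<notin> set nu"
    proof
      assume "0 \<in> set nu"
      then obtain i where i: "i < ?N" "nu ! i = 0" using ln by (metis in_set_conv_nth)
      then have "Suc i \<notin> set ?v" using nth by (metis count_list_0_iff)
      then show False using sv i by simp
    qed
    show "sum_list nu = length w" using words_length[OF v_in] by (simp add: sort_letters_map)
  qed
  show ?thesis
  proof
    show "is_partition (length w) (conj_part nu)" by (rule is_partition_conj_part[OF part])
    show "sort_letters w \<in> words (conj_part (conj_part nu))"
      unfolding conj_part_conj_part[OF part] by (rule v_in)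
    show "length (conj_part nu) \<le> n"
    proof (cases "0 < ?N")
      case True
      then obtain a where "a \<in> set w" "letter_rank w a = Suc 0" using ex by blast
      then show ?thesis using cv[of a] assms[of a] nth[OF True] ln True by (simp add: entry_def)
    qed (use ln in \<open>simp add: entry_def\<close>)
  qed
qed

lemma hw_shapes_conj_shape:
  assumes "lam \<in> hw_shapes n d" "1 \<le> d"
  shows "\<exists>m. conj_shape d m lam" "\<And>p. p \<in> set lam \<Longrightarrow> length p \<le> n"
  using assms by (auto simp: hw_shapes_def conj_shape_def)

lemma hw_tables_good:
  assumes "T \<in> hw_tables n d" "1 \<le> d"
  shows "\<exists>m. good_table n d m T"
proof -
  obtain lam where lam: "lam \<in> hw_shapes n d" "T \<in> tabA (map conj_part lam)" using assms(1) by (auto simp: hw_tables_def)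
  obtain m where "conj_shape d m lam" using hw_shapes_conj_shape[OF lam(1) assms(2)] by blast
  then interpret conj_shape d m lam .
  have "0 \<notin> set r \<and> (\<forall>c. count_list r c \<le> n)" if r: "r \<in> set T" for r
  proof -
    obtain l where l: "l < d" "r = T ! l" using r rect_length[OF tabA_rect[OF lam(2)]] by (metis in_set_conv_nth)
    have w: "r \<in> words (conj_part (lam ! l))" using lam(2) l by (simp add: tabA_nth length_lam)
    have "length (lam ! l) \<le> n" using hw_shapes_conj_shape(2)[OF lam(1) assms(2)] l length_lam by simp
    then have "count_list r c \<le> n" for c
      using w entry_conj_part_le[OF part[OF l(1)], of c] by (simp add: words_count)
    moreover have "0 \<notin> set r" using words_letters[OF w] by auto
    ultimately show ?thesis by blast
  qed
  then show ?thesis unfolding good_table_def using tabA_rect[OF lam(2)] by blast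
qed

lemma good_table_sort:
  assumes "good_table n d m T" "1 \<le> d"
  shows "\<exists>lam\<in>hw_shapes n d. map sort_letters T \<in> tabA (map conj_part lam)"
proof -
  have "\<exists>p. is_partition m p \<and> length p \<le> n \<and> sort_letters r \<in> words (conj_part p)" if r: "r \<in> set T" for r
  proof -
    have c: "count_list r c \<le> n" for c using assms r by (simp add: good_table_def)
    have len: "length r = m" using assms r by (simp add: good_table_def rect_def)
    show ?thesis using sort_letters_words[of r n, OF c] len by metis
  qed
  then obtain P where P: "\<And>r. r \<in> set T \<Longrightarrow> is_partition m (P r) \<and> length (P r) \<le> n \<and> sort_letters r \<in> words (conj_part (P r))"
    by metis
  have len: "length T = d" using assms by (simp add: good_table_def rect_def)
  have "map P T \<in> hw_shapes n d"
    unfolding hw_shapes_def partition_tuple_def using P len by auto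
  moreover have "map sort_letters T \<in> tabA (map conj_part (map P T))"
    unfolding tabA_nth using P by simp
  ultimately show ?thesis by blast
qed

context power_algebra
begin

lemma prds_prod_table:
  assumes d: "1 \<le> d" and Ts: "set Ts \<subseteq> hw_tables n d"
  shows "prds (map (Del n) Ts) = cscale (prod_sign d Ts) (Del n (prod_table d Ts))"
    and "\<exists>lam\<in>hw_shapes n d. prod_table d Ts \<in> tabA (map conj_part lam)"
proof -
  have *: "prds (map (Del n) Ts) = Del n (juxt d Ts)" "\<exists>m. good_table n d m (juxt d Ts)"
    using prds_juxt[OF d, of Ts n] hw_tables_good[OF _ d] Ts by blast+
  then obtain m where g: "good_table n d m (juxt d Ts)" by blast
  then have r: "rect d m (juxt d Ts)" by (simp add: good_table_def)
  have pt: "prod_table d Ts = relabel (\<lambda>l. letter_rank (juxt d Ts ! l)) (juxt d Ts)"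
    by (intro nth_equalityI) (auto simp: prod_table_def relabel_nth sort_letters_map)
  show "prds (map (Del n) Ts) = cscale (prod_sign d Ts) (Del n (prod_table d Ts))"
    unfolding *(1) prod_sign_def pt by (rule Del_relabel[OF r d letter_rank_inj])
  show "\<exists>lam\<in>hw_shapes n d. prod_table d Ts \<in> tabA (map conj_part lam)"
    unfolding prod_table_def by (rule good_table_sort[OF g d])
qed

end

section \<open>The two algebras\<close>

lemma cscale_single: "cscale a (single K b) = single K (a * b)"
  by (rule poly_mapping_eqI) (simp add: lookup_single when_def)

text \<open>Scaling as multiplication by a constant polynomial turns bilinearity of the product into
  ring laws.\<close>

lemma cscale_conv_mult:
  fixes p :: "'a::comm_monoid_add \<Rightarrow>\<^sub>0 complex"
  shows "cscale c p = single 0 c * p"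
proof -
  have "single 0 c * p =
      single 0 c * (\<Sum>K\<in>keys p. cscale (lookup p K) (single K 1))"
    using poly_mapping_sum_single[of p] by simp
  also have "\<dots> = (\<Sum>K\<in>keys p. cscale c (cscale (lookup p K) (single K 1)))"
    by (simp only: sum_distrib_left cscale_single mult_single add_0)
  also have "\<dots> = cscale c (\<Sum>K\<in>keys p. cscale (lookup p K) (single K 1))"
    by (simp only: cvec.scale_sum_right)
  also have "\<dots> = cscale c p" using poly_mapping_sum_single[of p] by simp
  finally show ?thesis by simp
qed

lemma scoef_1 [simp]: "scoef 1 cs = 1"
  by (simp add: scoef_def)

global_interpretation sym: power_algebra 1 mset sorted_list_of_multiset "(*) :: sym_alg \<Rightarrow> sym_alg \<Rightarrow> sym_alg"
proof (rule power_algebra.intro)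
  show "Vector_Spaces.linear cscale cscale (\<lambda>p. p * q)" for q :: sym_alg
    by (rule linearI_cscale) (simp_all add: distrib_right cscale_conv_mult mult.assoc)
  show "Vector_Spaces.linear cscale cscale ((*) p)" for p :: sym_alg
    by (rule linearI_cscale) (simp_all add: distrib_left cscale_conv_mult ac_simps)
qed (simp_all add: mult_single)

lemma wedge_lin:
  "wedge p q = lin (\<lambda>P. lin (\<lambda>Q. single (P |\<union>| Q) (wedge_sign P Q)) q) p"
  by (simp add: wedge_def lin_def cvec.scale_sum_right cscale_single ac_simps)

lemma wedge_single:
  "wedge (single P a) (single Q b) =
     single (P |\<union>| Q) (a * b * wedge_sign P Q)"
  by (simp add: wedge_lin lin_single cscale_single mult.assoc)

text \<open>The inversions of \<open>xs @ ys\<close> are those of the two parts and the cross ones,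
  which \<open>wedge_sign\<close> counts; a common element makes both sides 0.\<close>

lemma wedge_sign_scoef:
  "scoef (- 1) xs * scoef (- 1) ys * wedge_sign (fset_of_list xs) (fset_of_list ys) = scoef (- 1) (xs @ ys)"
proof (cases "distinct xs \<and> distinct ys")
  case True
  have int: "fset_of_list xs |\<inter>| fset_of_list ys = {||} \<longleftrightarrow> set xs \<inter> set ys = {}"
    by (auto simp: fset_eq_iff fset_of_list_elem disjoint_iff)
  have set: "{(a, b). a |\<in>| fset_of_list xs \<and> b |\<in>| fset_of_list ys \<and> b < a} =
      (SIGMA a:set xs. {b \<in> set ys. b < a})"
    by (auto simp: fset_of_list_elem)
  have "card (SIGMA a:set xs. {b \<in> set ys. b < a}) = (\<Sum>a\<in>set xs. card {b \<in> set ys. b < a})"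
    by (rule card_SigmaI) auto
  also have "\<dots> = (\<Sum>a\<in>set xs. length (filter (\<lambda>b. b < a) ys))"
  proof (rule sum.cong[OF refl])
    fix a
    have "card (set (filter (\<lambda>b. b < a) ys)) = length (filter (\<lambda>b. b < a) ys)"
      using True by (intro distinct_card) simp
    then show "card {b \<in> set ys. b < a} = length (filter (\<lambda>b. b < a) ys)" by simp
  qed
  also have "\<dots> = (\<Sum>a\<leftarrow>xs. length (filter (\<lambda>b. b < a) ys))"
    using True by (simp add: sum_list_distinct_conv_sum_set)
  finally show ?thesis
    using True unfolding scoef_def wedge_sign_def int set
    by (simp add: inv_count_append power_add)
qed (auto simp: scoef_def)

global_interpretation ext: power_algebra "- 1" fset_of_list sorted_list_of_fset wedge
proof (rule power_algebra.intro)
  show "sorted (sorted_list_of_fset K)" "- 1 = (1::complex) \<or> distinct (sorted_list_of_fset K)" for K :: "nat list fset"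
    by (simp_all add: sorted_list_of_fset.rep_eq)
  show "sorted_list_of_fset (fset_of_list cs) = sort cs" if "- 1 = (1::complex) \<or> distinct cs" for cs :: "nat list list"
    using that by (auto simp: sorted_list_of_fset.rep_eq fset_of_list.rep_eq
        sorted_list_of_set_sort_remdups distinct_remdups_id)
  show "Vector_Spaces.linear cscale cscale (\<lambda>p. wedge p q)" for q
    unfolding wedge_lin by (rule lin_linear)
  show "Vector_Spaces.linear cscale cscale (wedge p)" for p
  proof (rule linearI_cscale)
    show "wedge p (q + r) = wedge p q + wedge p r" for q r
    proof -
      have "lin \<theta> (q + r) = lin \<theta> q + lin \<theta> r" for \<theta> :: "nat list fset \<Rightarrow> ext_alg"
        by (rule poly_mapping_eqI) (simp add: lookup_lin fn_add lookup_add)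
      then show ?thesis
        unfolding wedge_lin lin_def[of _ p] by (simp add: cvec.scale_right_distrib sum.distrib)
    qed
    show "wedge p (cscale c q) = cscale c (wedge p q)" for c q
      unfolding wedge_lin lin_def[of _ p]
      by (simp add: linear_cscale_scale[OF lin_linear] cvec.scale_sum_right mult.commute)
  qed
  show "wedge (single (fset_of_list xs) (scoef (- 1) xs)) (single (fset_of_list ys) (scoef (- 1) ys)) =
      single (fset_of_list (xs @ ys)) (scoef (- 1) (xs @ ys))" for xs ys
    unfolding wedge_single wedge_sign_scoef by simp
qed simp_all

lemma sym_E_Nil: "sym.E [] = 1"
  by (simp add: sym.E_def)

lemma sym_prds: "sym.prds ps = prod_list ps"
  by (simp add: sym.prds_def sym_E_Nil prod_list.eq_foldr)

lemma sym_E_single: "sym.E [c] = svar c"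
  by (simp add: sym.E_def svar_def)

lemma vee_e_E: "vee_e S = sym.E (cols S)"
  using sym.prds_E[of "cols S"] by (simp add: vee_e_def sym_prds sym_E_single)

lemma Delta_Del: "Delta n = sym.Del n"
  by (rule ext) (simp add: Delta_def sym.Del_def vee_e_E)

lemma act_sym_act: "act_sym n g = sym.act n g"
proof
  fix p
  have "(\<Prod>c\<in>#M. f c) = prod_list (map f (sorted_list_of_multiset M))" for f :: "nat list \<Rightarrow> sym_alg" and M
    by (metis mset_map mset_sorted_list_of_multiset prod_mset_prod_list)
  then show "act_sym n g p = sym.act n g p"
    by (simp add: act_sym_def sym.act_def lin_def sym_prds sym_E_single)
qed

lemma WV_sym_WV: "WV_sym n al = sym.WV n al"
  by (simp add: WV_sym_def sym.WV_def Sym_def sym.Alg_def act_sym_act)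

lemma HWV_sym_HWV: "HWV_sym n al = sym.HWV n al"
  by (simp add: HWV_sym_def sym.HWV_def WV_sym_WV act_sym_act)

lemma ext_prds: "ext.prds ps = wedge_list ps"
  by (simp add: ext.prds_def ext.E_def wedge_list_def scoef_def)

lemma ext_E_single: "ext.E [c] = evar c"
  by (simp add: ext.E_def evar_def scoef_def)

lemma wedge_e_E: "wedge_e S = ext.E (cols S)"
  using ext.prds_E[of "cols S"] by (simp add: wedge_e_def ext_prds ext_E_single)

lemma Nabla_Del: "Nabla n = ext.Del n"
  by (rule HOL.ext) (simp add: Nabla_def ext.Del_def wedge_e_E)

lemma act_ext_act: "act_ext n g = ext.act n g"
  by (rule HOL.ext) (simp add: act_ext_def ext.act_def lin_def ext_prds ext_E_single)

lemma WV_ext_WV: "WV_ext n al = ext.WV n al"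
  by (simp add: WV_ext_def ext.WV_def Ext_def ext.Alg_def act_ext_act)

lemma HWV_ext_HWV: "HWV_ext n al = ext.HWV n al"
  by (simp add: HWV_ext_def ext.HWV_def WV_ext_WV act_ext_act)

section \<open>Spans of the relations\<close>

text \<open>
  A table with a repeated column contributes no relation to the exterior algebra: swapping the two
  equal columns permutes the boundary and changes the sign.
\<close>

lemma (in power_algebra) boundary_E_not_distinct:
  assumes s: "s = - 1" and Y: "rect d m Y" and d: "1 \<le> d" and nd: "\<not> distinct (cols Y)"
    and l: "l < d" and ij: "i \<noteq> j"
  shows "(\<Sum>S\<in>boundary l j i Y. E (cols S)) = 0"
proof -
  have len: "length (cols Y) = m" by (rule length_transpose_rect[OF Y d])
  obtain a b where ab: "a < m" "b < m" "a \<noteq> b" "cols Y ! a = cols Y ! b"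
    using nd len unfolding distinct_conv_nth by auto
  define t where "t = swap a b"
  have tp: "t permutes {..<m}" unfolding t_def using ab by (intro permutes_swap_id) auto
  have tt: "t (t q) = q" for q by (simp add: t_def)
  have tm: "t q < m" if "q < m" for q using that ab by (auto simp: t_def Transposition.transpose_def)
  have row: "Y ! l' ! t q = Y ! l' ! q" if "l' < d" for l' q
    using transpose_nth_nth[OF Y d ab(1) that] transpose_nth_nth[OF Y d ab(2) that] ab(4)
    by (auto simp: t_def Transposition.transpose_def)
  let ?S = "\<lambda>q. Y[l := (Y ! l)[q := j]]"
  let ?Q = "{q. q < length (Y ! l) \<and> Y ! l ! q = i}"
  have lY: "length Y = d" by (rule rect_length[OF Y])
  have rS: "rect d m (?S q)" for q
    using Y l rect_nth[OF Y l] by (auto simp: rect_def dest!: set_update_subset_insert[THEN subsetD])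
  have pS: "pcol t (?S q) = ?S (t q)" if "q < m" for q
  proof (rule nth_equalityI)
    fix l' assume "l' < length (pcol t (?S q))"
    then have l': "l' < d" using lY by simp
    show "pcol t (?S q) ! l' = ?S (t q) ! l'"
    proof (rule nth_equalityI)
      show "length (pcol t (?S q) ! l') = length (?S (t q) ! l')"
        using l' lY rect_nth[OF rS l'] by simp
      fix k assume "k < length (pcol t (?S q) ! l')"
      then have k: "k < m" using l' lY rect_nth[OF rS l', of q] by simp
      have e: "t k = q \<longleftrightarrow> k = t q" using tt by metis
      have "pcol t (?S q) ! l' ! k = ?S q ! l' ! t k"
        using l' lY k rect_nth[OF rS l', of q] by (simp add: permute_list_def)
      also have "\<dots> = ?S (t q) ! l' ! k"
        using l' l lY rect_nth[OF Y l'] row[OF l', of k] tm[OF k] k e tm[OF that]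
        by (auto simp: nth_list_update)
      finally show "pcol t (?S q) ! l' ! k = ?S (t q) ! l' ! k" .
    qed
  qed (simp add: lY)
  have neg: "E (cols (?S (t q))) = - E (cols (?S q))" if q: "q < m" for q
  proof -
    have "perm_eps s m t = s" unfolding t_def by (rule perm_eps_transpose[OF s_cases ab(3,1,2)])
    then have "E (permute_list t (cols (?S q))) = cscale s (E (cols (?S q)))"
      using E_permute_list[of t "cols (?S q)"] tp length_transpose_rect[OF rS d] by simp
    moreover have "cols (?S (t q)) = permute_list t (cols (?S q))"
      unfolding pS[OF q, symmetric] by (rule transpose_pcol[OF rS d tp])
    moreover have "cscale (- 1) p = - p" for p :: "'k \<Rightarrow>\<^sub>0 complex"
      by (rule poly_mapping_eqI) simp
    ultimately show ?thesis using s by simp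
  qed
  have "(\<Sum>q\<in>?Q. E (cols (?S q))) = (\<Sum>q\<in>?Q. E (cols (?S (t q))))"
    by (rule sum.reindex_bij_witness[of _ t t]) (use tt tm row[OF l] rect_nth[OF Y l] in auto)
  also have "\<dots> = - (\<Sum>q\<in>?Q. E (cols (?S q)))"
    unfolding sum_negf[symmetric] using neg rect_nth[OF Y l] by (intro sum.cong) auto
  finally have *: "(\<Sum>q\<in>?Q. E (cols (?S q))) = - (\<Sum>q\<in>?Q. E (cols (?S q)))" .
  have "(\<Sum>q\<in>?Q. E (cols (?S q))) = 0"
  proof (rule poly_mapping_eqI)
    fix K
    have "lookup (\<Sum>q\<in>?Q. E (cols (?S q))) K =
        - lookup (\<Sum>q\<in>?Q. E (cols (?S q))) K"
      using arg_cong[OF *, of "\<lambda>p. lookup p K"] by simp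
    then show "lookup (\<Sum>q\<in>?Q. E (cols (?S q))) K = lookup 0 K" by simp
  qed
  then show ?thesis using boundary_sum[OF ij, of l Y "\<lambda>S. E (cols S)"] l lY by simp
qed

lemma (in power_algebra) norm_E:
  assumes "s = - 1"
  shows "cscale (table_norm S) (E (cols S)) = E (cols S)"
proof (cases "distinct (cols S)")
  case True
  then show ?thesis by (simp add: table_norm_distinct)
next
  case False
  have "s \<noteq> 1" using assms by simp
  then show ?thesis using False by (simp add: E_not_ok)
qed

text \<open>The common form in which the argument for a general pair of algebras delivers the
  relations.\<close>

definition weighted_relations :: "(table \<Rightarrow> ('k \<Rightarrow>\<^sub>0 complex)) \<Rightarrow> nat list list \<Rightarrow> ('k \<Rightarrow>\<^sub>0 complex) set" where
  "weighted_relations f mu = {\<Sum>S\<in>boundary l j i Y. cscale (table_norm S) (f S) | l i j Y.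
     l < length mu \<and> 1 \<le> i \<and> i < j \<and> j \<le> length (mu ! l) \<and> Y \<in> tabA (move l i j mu)}"

lemma sym_relations_weighted: "sym_relations mu = weighted_relations vee_e mu"
  by (simp add: sym_relations_def weighted_relations_def vee_boundary_def)

lemma sum_list_move:
  assumes "1 \<le> i" "i < j" "j \<le> length a" "1 \<le> entry a j"
  shows "sum_list (a[i - 1 := a ! (i - 1) + 1, j - 1 := a ! (j - 1) - 1]) = sum_list a"
proof -
  have aj: "1 \<le> a ! (j - 1)" using assms by (simp add: entry_def)
  have "sum_list (a[i - 1 := a ! (i - 1) + 1]) = sum_list a + 1"
    using assms by (simp add: sum_list_update)
  moreover have "a[i - 1 := a ! (i - 1) + 1] ! (j - 1) = a ! (j - 1)"
    using assms by (auto simp: nth_list_update)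
  moreover have "a ! (j - 1) \<le> sum_list a + 1"
    using assms member_le_sum_list[of "a ! (j - 1)" a] by (simp add: le_SucI)
  ultimately show ?thesis using assms aj by (simp add: sum_list_update)
qed

lemma (in conj_shape) tabA_move_rect:
  assumes l: "l < d" and ij: "1 \<le> i" "i < j" "j \<le> length (mu ! l)" and Y: "Y \<in> tabA (move l i j mu)"
  shows "rect d m Y"
  unfolding rect_def
proof (intro conjI ballI)
  show len: "length Y = d" using Y by (simp add: tabA_nth move_def length_lam)
  fix r assume "r \<in> set Y"
  then obtain l' where l': "l' < d" "r = Y ! l'" using len by (metis in_set_conv_nth)
  have "r \<in> words (move l i j mu ! l')" using Y l' by (simp add: tabA_nth move_def length_lam)
  then have "length r = sum_list (move l i j mu ! l')" by (rule words_length)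
  also have "\<dots> = sum_list (mu ! l')"
  proof (cases "l' = l")
    case True
    have "1 \<le> entry (mu ! l) j" using entry_conj_part_pos[OF part[OF l], of j] ij mu_nth[OF l] by simp
    then show ?thesis
      using sum_list_move[OF ij] True l by (simp add: move_def length_lam)
  qed (simp add: move_def)
  also have "\<dots> = m" using sum_list_conj_part[OF part[OF l'(1)]] mu_nth[OF l'(1)] by simp
  finally show "length r = m" .
qed

text \<open>The weights are invisible on wedge products, and a table with a repeated column yields
  only the relation 0, so the two sets differ at most by 0.\<close>

lemma (in conj_shape) ext_relations_span:
  "cvec.span (ext_relations mu) = cvec.span (weighted_relations wedge_e mu)"
proof -
  have eq: "wedge_boundary l j i Y = (\<Sum>S\<in>boundary l j i Y. cscale (table_norm S) (wedge_e S))" for l i j Y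
    by (simp add: wedge_boundary_def wedge_e_E ext.norm_E)
  have "ext_relations mu \<subseteq> weighted_relations wedge_e mu"
    unfolding ext_relations_def weighted_relations_def eq tabB_def by blast
  moreover have "weighted_relations wedge_e mu \<subseteq> insert 0 (ext_relations mu)"
  proof
    fix r assume "r \<in> weighted_relations wedge_e mu"
    then obtain l i j Y where r: "r = wedge_boundary l j i Y" and a: "l < d" "1 \<le> i" "i < j" "j \<le> length (mu ! l)"
      "Y \<in> tabA (move l i j mu)"
      unfolding weighted_relations_def eq[symmetric] by (auto simp: length_lam)
    show "r \<in> insert 0 (ext_relations mu)"
    proof (cases "distinct (cols Y)")
      case True
      then have "Y \<in> tabB (move l i j mu)" using a by (simp add: tabB_def)
      then show ?thesis using r a unfolding ext_relations_def by (auto simp: length_lam)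
    next
      case False
      have "i \<noteq> j" using a by simp
      then have "r = 0"
        unfolding r wedge_boundary_def wedge_e_E
        by (intro ext.boundary_E_not_distinct[OF refl tabA_move_rect[OF a] d_pos False a(1)])
      then show ?thesis by simp
    qed
  qed
  ultimately show ?thesis
    by (metis cvec.span_insert_0 cvec.span_mono subset_antisym)
qed

lemma lex_sym: "tabA_lex mu = {S \<in> tabA mu. sorted (cols S) \<and> ((1::complex) = 1 \<or> distinct (cols S))}"
  by (simp add: tabA_lex_def)

lemma lex_ext: "tabB_lex mu = {S \<in> tabA mu. sorted (cols S) \<and> ((- 1::complex) = 1 \<or> distinct (cols S))}"
  by (auto simp: tabB_lex_def tabB_def)

section \<open>The statements of the theorem for a pair of algebras\<close>

context kernel_pair
begin

text \<open>Products, index set and relations enter through equations, so that \<open>vee_e\<close>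
  and \<open>wedge_e\<close> with their own index sets and relations can be substituted
  directly.\<close>

lemma kernel_theorem:
  assumes shape: "conj_shape d m lam"
    and n: "\<And>p. p \<in> set lam \<Longrightarrow> length p \<le> n" "\<And>p. p \<in> set lam \<Longrightarrow> entry p 1 \<le> n"
    and mu: "mu = map conj_part lam"
    and e: "e = (\<lambda>S. src.E (cols S))"
    and L: "L = {S \<in> tabA mu. sorted (cols S) \<and> (s1 = 1 \<or> distinct (cols S))}"
    and R: "cvec.span R = cvec.span (weighted_relations e mu)"
  shows "\<exists>D. linear_with D L e (tgt.Del n)"
    and "linear_with D L e (tgt.Del n) \<Longrightarrow> D ` src.WV n mu \<subseteq> tgt.HWV n lam"
    and "linear_with D L e (tgt.Del n) \<Longrightarrow> {w \<in> src.WV n mu. D w = 0} = cvec.span R"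
proof -
  have L': "L = lex_tables lam" unfolding L mu lex_tables_def[OF shape] ..
  show "\<exists>D. linear_with D L e (tgt.Del n)"
    unfolding L' e by (rule linear_with_exists[OF shape])
  show "D ` src.WV n mu \<subseteq> tgt.HWV n lam" if "linear_with D L e (tgt.Del n)"
    unfolding mu by (rule linear_with_image[OF shape n]) (use that in \<open>simp_all add: L' e\<close>)
  show "{w \<in> src.WV n mu. D w = 0} = cvec.span R" if "linear_with D L e (tgt.Del n)"
    unfolding mu
  proof (rule kernel_eq_span[OF shape n])
    have "length lam = d" by (rule conj_shape.length_lam[OF shape])
    then show "cvec.span R = cvec.span {\<Sum>S\<in>boundary l j i Y. F S | l i j Y. l < d \<and> 1 \<le> i \<and> i < j \<and>
      j \<le> length (map conj_part lam ! l) \<and> Y \<in> tabA (move l i j (map conj_part lam))}"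
      unfolding R weighted_relations_def mu e F_def by simp
  qed (use that in \<open>simp_all add: L' e\<close>)
qed

text \<open>For an exterior source the weights drop out: a table with distinct columns has norm 1,
  and the vector of any other table is 0.\<close>

lemma boundary_relation:
  assumes shape: "conj_shape d m lam" and mu: "mu = map conj_part lam"
    and a: "l < d" "1 \<le> i \<and> i < j \<and> j \<le> length (mu ! l)" "Y \<in> tabA (move l i j mu)"
  shows "(\<Sum>S\<in>boundary l j i Y. cscale (table_norm S) (tgt.Del n S)) = 0"
    and "s1 = - 1 \<Longrightarrow> (\<Sum>S\<in>boundary l j i Y. tgt.Del n S) = 0"
proof -
  interpret c: conj_shape d m lam by (rule shape)
  show *: "(\<Sum>S\<in>boundary l j i Y. cscale (table_norm S) (tgt.Del n S)) = 0"
    using a unfolding mu by (intro boundary_Del[OF shape]) auto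
  assume s1: "s1 = - 1"
  have "cscale (table_norm S) (tgt.Del n S) = tgt.Del n S" if "S \<in> boundary l j i Y" for S
  proof (cases "distinct (cols S)")
    case True
    then show ?thesis by (simp add: table_norm_distinct)
  next
    case False
    have "S \<in> tabA (map conj_part lam)"
      using a that unfolding mu by (intro c.boundary_tabA) auto
    then have r: "rect d m S" by (rule c.tabA_rect)
    have "\<not> (s1 = 1 \<or> distinct (cols S))" using s1 False by simp
    then have "tgt.Phi n d m S = 0" by (rule Phi_zero[OF r])
    then show ?thesis by (simp add: tgt.Del_Phi[OF r])
  qed
  then show "(\<Sum>S\<in>boundary l j i Y. tgt.Del n S) = 0" using * by simp
qed

text \<open>Each product is a signed single vector whose shape depends on the factors, so an
  algebraic relation is a linear one across several shapes, possibly with different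
  \<open>m\<close>.\<close>

lemma product_relation:
  fixes N k :: nat and \<alpha> :: "nat \<Rightarrow> complex"
  assumes Ts: "\<forall>c<N. length (Ts c) = k \<and> set (Ts c) \<subseteq> hw_tables n d"
    and rel: "(\<Sum>c<N. cscale (\<alpha> c) (tgt.prds (map (tgt.Del n) (Ts c)))) = 0"
    and R: "\<And>lam m. lam \<in> hw_shapes n d \<Longrightarrow> conj_shape d m lam \<Longrightarrow>
      weighted_relations (\<lambda>S. src.E (cols S)) (map conj_part lam) \<subseteq> cvec.span R"
  shows "(\<Sum>c<N. cscale (\<alpha> c * prod_sign d (Ts c)) (src.E (cols (prod_table d (Ts c))))) \<in> cvec.span R"
proof -
  have "\<exists>lam m. lam \<in> hw_shapes n d \<and> conj_shape d m lam \<and> prod_table d (Ts c) \<in> tabA (map conj_part lam)"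
    if "c < N" for c
    using tgt.prds_prod_table(2)[OF d, of "Ts c" n] Ts that hw_shapes_conj_shape(1)[OF _ d] by metis
  then obtain lam mm where lam: "\<And>c. c < N \<Longrightarrow> lam c \<in> hw_shapes n d \<and> conj_shape d (mm c) (lam c) \<and>
      prod_table d (Ts c) \<in> tabA (map conj_part (lam c))" by metis
  show ?thesis
  proof (rule relation_in_span[where lam = lam and mm = mm])
    show "length p \<le> n" if "c \<in> {..<N}" "p \<in> set (lam c)" for c p
      using hw_shapes_conj_shape(2)[OF _ d] lam that by auto
    show "(\<Sum>c<N. cscale (\<alpha> c * prod_sign d (Ts c)) (tgt.Del n (prod_table d (Ts c)))) = 0"
      using rel tgt.prds_prod_table(1)[OF d, of _ n] Ts by simp
    show "(\<Sum>S\<in>boundary l j i Y. F S) \<in> cvec.span R"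
      if c: "c \<in> {..<N}" and a: "l < d" "1 \<le> i" "i < j" "j \<le> length (map conj_part (lam c) ! l)"
        "Y \<in> tabA (move l i j (map conj_part (lam c)))" for c l i j Y
    proof -
      have "length (lam c) = d" using lam c conj_shape.length_lam by blast
      then have "(\<Sum>S\<in>boundary l j i Y. F S) \<in>
          weighted_relations (\<lambda>S. src.E (cols S)) (map conj_part (lam c))"
        unfolding weighted_relations_def F_def
        by (intro CollectI exI[of _ l] exI[of _ i] exI[of _ j] exI[of _ Y] conjI refl) (use a in simp_all)
      then show ?thesis using R lam c by blast
    qed
  qed (use lam in auto)
qed

end

lemma vee_e_fun: "vee_e = (\<lambda>S. sym.E (cols S))"
  by (simp add: fun_eq_iff vee_e_E)

lemma wedge_e_fun: "wedge_e = (\<lambda>S. ext.E (cols S))"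
  by (simp add: fun_eq_iff wedge_e_E)

lemma sym_relations_all:
  assumes "lam \<in> hw_shapes n d"
  shows "weighted_relations (\<lambda>S. sym.E (cols S)) (map conj_part lam) \<subseteq> cvec.span (all_sym_relations n d)"
  unfolding vee_e_fun[symmetric] sym_relations_weighted[symmetric]
  using assms cvec.span_superset[of "all_sym_relations n d"] by (auto simp: all_sym_relations_def)

lemma ext_relations_all:
  assumes "lam \<in> hw_shapes n d" "conj_shape d m lam"
  shows "weighted_relations (\<lambda>S. ext.E (cols S)) (map conj_part lam) \<subseteq> cvec.span (all_ext_relations n d)"
proof -
  have "weighted_relations wedge_e (map conj_part lam) \<subseteq> cvec.span (ext_relations (map conj_part lam))"
    unfolding conj_shape.ext_relations_span[OF assms(2)] by (rule cvec.span_superset)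
  also have "\<dots> \<subseteq> cvec.span (all_ext_relations n d)"
    using assms(1) by (intro cvec.span_mono) (auto simp: all_ext_relations_def)
  finally show ?thesis unfolding wedge_e_fun .
qed

theorem mainTheorem1:
  fixes n d m :: nat and lam lam' :: "nat list list"
  assumes "n \<ge> 1" and "d \<ge> 1"
    and "partition_tuple d m lam"
    and "\<And>p. p \<in> set lam \<Longrightarrow> length p \<le> n"
    and "\<And>p. p \<in> set lam \<Longrightarrow> entry p 1 \<le> n"
    and "lam' = map conj_part lam"
  shows
    "(odd d \<longrightarrow>
      (\<forall>l<d. \<forall>i j. 1 \<le> i \<and> i < j \<and> j \<le> length (lam' ! l) \<longrightarrow>
        (\<forall>X\<in>tabB (move l i j lam'). (\<Sum>T\<in>boundary l j i X. Delta n T) = 0) \<and>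
        (\<forall>Y\<in>tabA (move l i j lam').
           (\<Sum>S\<in>boundary l j i Y. cscale (table_norm S) (Nabla n S)) = 0)) \<and>
      (\<exists>D. linear_with D (tabB_lex lam') wedge_e (Delta n)) \<and>
      (\<forall>D. linear_with D (tabB_lex lam') wedge_e (Delta n) \<longrightarrow>
        D ` WV_ext n lam' \<subseteq> HWV_sym n lam \<and>
        {w \<in> WV_ext n lam'. D w = 0} = cvec.span (ext_relations lam')) \<and>
      (\<exists>D. linear_with D (tabA_lex lam') vee_e (Nabla n)) \<and>
      (\<forall>D. linear_with D (tabA_lex lam') vee_e (Nabla n) \<longrightarrow>
        D ` WV_sym n lam' \<subseteq> HWV_ext n lam \<and>
        {p \<in> WV_sym n lam'. D p = 0} = cvec.span (sym_relations lam'))) \<and>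

     (even d \<longrightarrow>
      (\<forall>l<d. \<forall>i j. 1 \<le> i \<and> i < j \<and> j \<le> length (lam' ! l) \<longrightarrow>
        (\<forall>Y\<in>tabA (move l i j lam').
           (\<Sum>S\<in>boundary l j i Y. cscale (table_norm S) (Delta n S)) = 0) \<and>
        (\<forall>X\<in>tabB (move l i j lam'). (\<Sum>T\<in>boundary l j i X. Nabla n T) = 0)) \<and>
      (\<exists>D. linear_with D (tabA_lex lam') vee_e (Delta n)) \<and>
      (\<forall>D. linear_with D (tabA_lex lam') vee_e (Delta n) \<longrightarrow>
        D ` WV_sym n lam' \<subseteq> HWV_sym n lam \<and>
        {p \<in> WV_sym n lam'. D p = 0} = cvec.span (sym_relations lam')) \<and>
      (\<exists>D. linear_with D (tabB_lex lam') wedge_e (Nabla n)) \<and>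
      (\<forall>D. linear_with D (tabB_lex lam') wedge_e (Nabla n) \<longrightarrow>
        D ` WV_ext n lam' \<subseteq> HWV_ext n lam \<and>
        {w \<in> WV_ext n lam'. D w = 0} = cvec.span (ext_relations lam'))) \<and>

     (\<forall>Ts. set Ts \<subseteq> hw_tables n d \<longrightarrow>
      prod_list (map (Delta n) Ts) = cscale (prod_sign d Ts) (Delta n (prod_table d Ts)) \<and>
      wedge_list (map (Nabla n) Ts) = cscale (prod_sign d Ts) (Nabla n (prod_table d Ts))) \<and>

     (\<forall>k N (\<alpha> :: nat \<Rightarrow> complex) Ts.
      (\<forall>c<N. length (Ts c) = k \<and> set (Ts c) \<subseteq> hw_tables n d) \<and>
      (\<Sum>c<N. cscale (\<alpha> c) (prod_list (map (Delta n) (Ts c)))) = 0 \<longrightarrow>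
      (odd d \<longrightarrow> (\<Sum>c<N. cscale (\<alpha> c * prod_sign d (Ts c)) (wedge_e (prod_table d (Ts c))))
        \<in> cvec.span (all_ext_relations n d)) \<and>
      (even d \<longrightarrow> (\<Sum>c<N. cscale (\<alpha> c * prod_sign d (Ts c)) (vee_e (prod_table d (Ts c))))
        \<in> cvec.span (all_sym_relations n d))) \<and>

     (\<forall>k N (\<beta> :: nat \<Rightarrow> complex) Ss.
      (\<forall>c<N. length (Ss c) = k \<and> set (Ss c) \<subseteq> hw_tables n d) \<and>
      (\<Sum>c<N. cscale (\<beta> c) (wedge_list (map (Nabla n) (Ss c)))) = 0 \<longrightarrow>
      (odd d \<longrightarrow> (\<Sum>c<N. cscale (\<beta> c * prod_sign d (Ss c)) (vee_e (prod_table d (Ss c))))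
        \<in> cvec.span (all_sym_relations n d)) \<and>
      (even d \<longrightarrow> (\<Sum>c<N. cscale (\<beta> c * prod_sign d (Ss c)) (wedge_e (prod_table d (Ss c))))
        \<in> cvec.span (all_ext_relations n d)))"
proof -
  have shape: "conj_shape d m lam" using assms(2,3) by (simp add: conj_shape_def)
  note n = assms(4,5) and mu = assms(6)
  have tabB: "Y \<in> tabA al" if "Y \<in> tabB al" for Y al using that by (simp add: tabB_def)
  have ext_span: "cvec.span (ext_relations lam') = cvec.span (weighted_relations wedge_e lam')"
    unfolding mu by (rule conj_shape.ext_relations_span[OF shape])
  have sym_span: "cvec.span (sym_relations lam') = cvec.span (weighted_relations vee_e lam')"
    by (simp add: sym_relations_weighted)
  note simps = Delta_Del Nabla_Del WV_sym_WV WV_ext_WV HWV_sym_HWV HWV_ext_HWV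
  \<comment> \<open>For odd \<open>d\<close> the exterior source serves \<open>Delta\<close> and the
    symmetric source serves \<open>Nabla\<close>.\<close>
  have odd_pairs:
    "kernel_pair (- 1) fset_of_list sorted_list_of_fset wedge 1 mset sorted_list_of_multiset (*) d"
    "kernel_pair 1 mset sorted_list_of_multiset (*) (- 1) fset_of_list sorted_list_of_fset wedge d" if "odd d"
    using that assms(2) by (simp_all add: kernel_pair_def kernel_pair_axioms_def
        sym.power_algebra_axioms ext.power_algebra_axioms)
  \<comment> \<open>For even \<open>d\<close> source and target are the same algebra.\<close>
  have even_pairs:
    "kernel_pair 1 mset sorted_list_of_multiset (*) 1 mset sorted_list_of_multiset (*) d"
    "kernel_pair (- 1) fset_of_list sorted_list_of_fset wedge (- 1) fset_of_list sorted_list_of_fset wedge d"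
    if "even d"
    using that assms(2) by (simp_all add: kernel_pair_def kernel_pair_axioms_def
        sym.power_algebra_axioms ext.power_algebra_axioms)
  show ?thesis
    unfolding simps
  proof (intro conjI)
    show "odd d \<longrightarrow>
      (\<forall>l<d. \<forall>i j. 1 \<le> i \<and> i < j \<and> j \<le> length (lam' ! l) \<longrightarrow>
        (\<forall>X\<in>tabB (move l i j lam'). (\<Sum>T\<in>boundary l j i X. sym.Del n T) = 0) \<and>
        (\<forall>Y\<in>tabA (move l i j lam').
           (\<Sum>S\<in>boundary l j i Y. cscale (table_norm S) (ext.Del n S)) = 0)) \<and>
      (\<exists>D. linear_with D (tabB_lex lam') wedge_e (sym.Del n)) \<and>
      (\<forall>D. linear_with D (tabB_lex lam') wedge_e (sym.Del n) \<longrightarrow>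
        D ` ext.WV n lam' \<subseteq> sym.HWV n lam \<and>
        {w \<in> ext.WV n lam'. D w = 0} = cvec.span (ext_relations lam')) \<and>
      (\<exists>D. linear_with D (tabA_lex lam') vee_e (ext.Del n)) \<and>
      (\<forall>D. linear_with D (tabA_lex lam') vee_e (ext.Del n) \<longrightarrow>
        D ` sym.WV n lam' \<subseteq> ext.HWV n lam \<and>
        {p \<in> sym.WV n lam'. D p = 0} = cvec.span (sym_relations lam'))"
      (is "_ \<longrightarrow> ?goal")
    proof
      assume "odd d"
      note p1 = odd_pairs(1)[OF this] and p2 = odd_pairs(2)[OF this]
      show ?goal
        using kernel_pair.boundary_relation(2)[OF p1 shape mu _ _ tabB refl]
          kernel_pair.boundary_relation(1)[OF p2 shape mu]
          kernel_pair.kernel_theorem[OF p1 shape n mu wedge_e_fun lex_ext ext_span]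
          kernel_pair.kernel_theorem[OF p2 shape n mu vee_e_fun lex_sym sym_span]
        by (intro conjI allI impI ballI)
    qed
    show "even d \<longrightarrow>
      (\<forall>l<d. \<forall>i j. 1 \<le> i \<and> i < j \<and> j \<le> length (lam' ! l) \<longrightarrow>
        (\<forall>Y\<in>tabA (move l i j lam').
           (\<Sum>S\<in>boundary l j i Y. cscale (table_norm S) (sym.Del n S)) = 0) \<and>
        (\<forall>X\<in>tabB (move l i j lam'). (\<Sum>T\<in>boundary l j i X. ext.Del n T) = 0)) \<and>
      (\<exists>D. linear_with D (tabA_lex lam') vee_e (sym.Del n)) \<and>
      (\<forall>D. linear_with D (tabA_lex lam') vee_e (sym.Del n) \<longrightarrow>
        D ` sym.WV n lam' \<subseteq> sym.HWV n lam \<and>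
        {p \<in> sym.WV n lam'. D p = 0} = cvec.span (sym_relations lam')) \<and>
      (\<exists>D. linear_with D (tabB_lex lam') wedge_e (ext.Del n)) \<and>
      (\<forall>D. linear_with D (tabB_lex lam') wedge_e (ext.Del n) \<longrightarrow>
        D ` ext.WV n lam' \<subseteq> ext.HWV n lam \<and>
        {w \<in> ext.WV n lam'. D w = 0} = cvec.span (ext_relations lam'))"
      (is "_ \<longrightarrow> ?goal")
    proof
      assume "even d"
      note p1 = even_pairs(1)[OF this] and p2 = even_pairs(2)[OF this]
      show ?goal
        using kernel_pair.boundary_relation(1)[OF p1 shape mu]
          kernel_pair.boundary_relation(2)[OF p2 shape mu _ _ tabB refl]
          kernel_pair.kernel_theorem[OF p1 shape n mu vee_e_fun lex_sym sym_span]
          kernel_pair.kernel_theorem[OF p2 shape n mu wedge_e_fun lex_ext ext_span]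
        by (intro conjI allI impI ballI)
    qed
    show "\<forall>Ts. set Ts \<subseteq> hw_tables n d \<longrightarrow>
      prod_list (map (sym.Del n) Ts) = cscale (prod_sign d Ts) (sym.Del n (prod_table d Ts)) \<and>
      wedge_list (map (ext.Del n) Ts) = cscale (prod_sign d Ts) (ext.Del n (prod_table d Ts))"
      using sym.prds_prod_table(1)[OF assms(2)] ext.prds_prod_table(1)[OF assms(2)]
      unfolding sym_prds ext_prds by blast
    show "\<forall>k N (\<alpha> :: nat \<Rightarrow> complex) Ts.
      (\<forall>c<N. length (Ts c) = k \<and> set (Ts c) \<subseteq> hw_tables n d) \<and>
      (\<Sum>c<N. cscale (\<alpha> c) (prod_list (map (sym.Del n) (Ts c)))) = 0 \<longrightarrow>
      (odd d \<longrightarrow> (\<Sum>c<N. cscale (\<alpha> c * prod_sign d (Ts c)) (wedge_e (prod_table d (Ts c))))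
        \<in> cvec.span (all_ext_relations n d)) \<and>
      (even d \<longrightarrow> (\<Sum>c<N. cscale (\<alpha> c * prod_sign d (Ts c)) (vee_e (prod_table d (Ts c))))
        \<in> cvec.span (all_sym_relations n d))"
      unfolding sym_prds[symmetric] wedge_e_fun vee_e_fun
      by (intro allI impI, elim conjE, intro conjI impI)
        (rule kernel_pair.product_relation[OF odd_pairs(1)], assumption+, erule (1) ext_relations_all,
         rule kernel_pair.product_relation[OF even_pairs(1)], assumption+, erule sym_relations_all)
    show "\<forall>k N (\<beta> :: nat \<Rightarrow> complex) Ss.
      (\<forall>c<N. length (Ss c) = k \<and> set (Ss c) \<subseteq> hw_tables n d) \<and>
      (\<Sum>c<N. cscale (\<beta> c) (wedge_list (map (ext.Del n) (Ss c)))) = 0 \<longrightarrow>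
      (odd d \<longrightarrow> (\<Sum>c<N. cscale (\<beta> c * prod_sign d (Ss c)) (vee_e (prod_table d (Ss c))))
        \<in> cvec.span (all_sym_relations n d)) \<and>
      (even d \<longrightarrow> (\<Sum>c<N. cscale (\<beta> c * prod_sign d (Ss c)) (wedge_e (prod_table d (Ss c))))
        \<in> cvec.span (all_ext_relations n d))"
      unfolding ext_prds[symmetric] wedge_e_fun vee_e_fun
      by (intro allI impI, elim conjE, intro conjI impI)
        (rule kernel_pair.product_relation[OF odd_pairs(2)], assumption+, erule sym_relations_all,
         rule kernel_pair.product_relation[OF even_pairs(2)], assumption+, erule (1) ext_relations_all)
  qed
qed

end
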